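(* Let $\mathfrak X$ be a 3-Hilbert space, let ${}_aY_b\in\mathfrak X$ be a 1-morphism, and let $c\in\mathfrak X$. The functors $${}_aY\otimes_b-:\mathfrak X(b\to c)\to\mathfrak X(a\to c)\qquad\text{and}\qquad{}_bY^\vee\otimes_a-:\mathfrak X(a\to c)\to\mathfrak X(b\to c),$$ with adjunction data coming from the UAF $\vee$, are unitary adjoints. In other words, $\mathfrak X(-\to c):\mathfrak X^{1\mathrm{op}}\to2\mathrm{Hilb}$ is $\dagger$- and UAF-preserving, i.e. a 1-morphism of 3-Hilbert spaces. Similarly, for every 1-morphism ${}_bZ_c$ the functors $-\otimes_bZ_c$ and $-\otimes_cZ^\vee_b$ (between $\mathfrak X(a\to b)$ and $\mathfrak X(a\to c)$) are unitary adjoints, $-\otimes_bZ_c\dashv^\dagger-\otimes_cZ_b^\vee$, and each $\mathfrak X(a\to-):\mathfrak X\to2\mathrm{Hilb}$ is a 1-morphism of 3-Hilbert spaces.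
   Context: **2-Hilbert spaces.** A 2-Hilbert space is a finitely semisimple $C^*$-category $\mathcal C$ with faithful positive linear functionals $\mathrm{Tr}^{\mathcal C}_c:\mathrm{End}(c)\to\mathbb C$ such that $\mathrm{Tr}_a(gf)=\mathrm{Tr}_b(fg)$ for $f:a\to b$, $g:b\to a$. Each $\mathcal C(a\to b)$ is a Hilbert space with $\langle f|g\rangle=\mathrm{Tr}_a(f^\dagger g)$; $d_c=\mathrm{Tr}_c(\mathrm{id}_c)$. Dagger functors $F:\mathcal A\to\mathcal B$ and $G:\mathcal B\to\mathcal A$ are unitary adjoints, $F\dashv^\dagger G$, if there are natural unitary isomorphisms $\mathcal B(F(a)\to b)\cong\mathcal A(a\to G(b))$. **(Pre-)3-Hilbert spaces.** A unitary 2-category is a $C^*$-2-category $\mathfrak X$ such that for all $a_1,\dots,a_n\in\mathfrak X$ the linking category $\mathcal L=\bigoplus_{i,j}\mathfrak X(a_j\to a_i)$ (matrix multiplication and composition) is a unitary multitensor category; it is finite if all $\mathcal L$ are multifusion and $\dim \mathrm{End}_{\mathcal Z(\mathcal L)}(1_{\mathcal L})$ is globally bounded ($\mathcal Z$ is the Drinfeld center). A 1-morphism $X:a\to b$ is written ${}_aX_b$, and ${}_aX\otimes_bY_c:a\to c$ is "first $X$, then $Y$". A unitary adjoint functor (UAF) $\vee$ is a choice for each ${}_aX_b$ of an adjoint ${}_bX^\vee_a$ with $\mathrm{ev}_X:X^\vee\otimes_aX\Rightarrow1_b$, $\mathrm{coev}_X:1_a\Rightarrow X\otimes_bX^\vee$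 satisfying the zig-zag equations, such that the canonical maps $1_a^\vee\to1_a$ and $X^\vee\otimes Y^\vee\Rightarrow(Y\otimes X)^\vee$ are unitary and $(f^\vee)^\dagger=(f^\dagger)^\vee$. A spherical weight $\Psi$ is a family of faithful positive functionals $\Psi_a:\mathrm{End}(1_a)\to\mathbb C$ with $\Psi_a(\mathrm{coev}_X^\dagger(f\otimes1)\mathrm{coev}_X)=\Psi_b(\mathrm{ev}_X(1\otimes f)\mathrm{ev}_X^\dagger)=:\mathrm{Tr}_X(f)$ for all $f\in\mathrm{End}({}_aX_b)$; with these traces each $\mathfrak X(a\to b)$ is a 2-Hilbert space. A pre-3-Hilbert space is a finite unitary 2-category with a UAF and a spherical weight. A 1-morphism ${}_aX_b$ is an isometry if $\mathrm{coev}_X$ is unitary and $\mathrm{ev}_X$ is an isometry. A Hilbert direct sum of $a,b$ is an object $a\boxplus b$ with isometries $I:a\to a\boxplus b$, $J:b\to a\boxplus b$ such that $\mathrm{ev}_I\mathrm{ev}_I^\dagger+\mathrm{ev}_J\mathrm{ev}_J^\dagger=\mathrm{id}_{1_{a\boxplus b}}$. An $H^*$-monad on $a$ is an associative unital algebra $({}_aA_a,\mu,\iota)$ in $\mathfrak X(a\to a)$ such that $\mu^\dagger$ is an $A$–$A$-bimodule map, $\mu\mu^\dagger$ is invertible, and $\Psi_a(\iota^\dagger\mu(1\otimes f)\mu^\dagger\iota)=\Psi_a(\iota^\dagger\mu(f\otimes1)\mu^\dagger\iota)$ for all $f\in\mathrm{End}(A)$. It splits if there are ${}_aX_b$ with $\mathrm{ev}_X\mathrm{ev}_X^\dagger$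 invertible and a unitary algebra isomorphism $A\cong X\otimes_bX^\vee$. A 3-Hilbert space is a pre-3-Hilbert space admitting all (finite) Hilbert direct sums and in which all $H^*$-monads split. **Morphisms.** A 1-morphism $F:\mathfrak X\to\mathfrak Y$ of 3-Hilbert spaces is a linear $\dagger$-2-functor that is UAF-preserving: the canonical isomorphisms $F(X^\vee)\Rightarrow F(X)^\vee$ are unitary. $2\mathrm{Hilb}$ is the 3-Hilbert space of 2-Hilbert spaces, linear $\dagger$-functors and natural transformations, with UAF given by unitary adjunction and weight $\Psi_{\mathcal A}(\eta)=\sum_{a\in\mathrm{Irr}\,\mathcal A}d_a\mathrm{Tr}^{\mathcal A}_a(\eta_a)$ for $\eta:\mathrm{id}_{\mathcal A}\Rightarrow\mathrm{id}_{\mathcal A}$. $\mathfrak X^{1\mathrm{op}}$ reverses 1-morphisms, keeps $\Psi$ and $\vee$, with evaluation/coevaluation replaced by $\mathrm{coev}_X^\dagger$, $\mathrm{ev}_X^\dagger$. *)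

theory Defs
  imports Complex_Main "HOL-Library.FuncSet"
begin

section \<open>Linear dagger categories\<close>

text \<open>
  Every arrow has a unique domain and codomain, so distinct hom spaces are disjoint and the
  operations of the vector spaces need no index, except for the zero vectors.
\<close>

record ('x, 'm) dcat =
  Obj :: "'x set"
  Arr :: "'m set"
  Dom :: "'m \<Rightarrow> 'x"
  Cod :: "'m \<Rightarrow> 'x"
  Idn :: "'x \<Rightarrow> 'm" ("\<i>\<d>\<index>")
  Cmp :: "'m \<Rightarrow> 'm \<Rightarrow> 'm" (infixr "\<cdot>\<index>" 70)
  Zer :: "'x \<Rightarrow> 'x \<Rightarrow> 'm"
  Add :: "'m \<Rightarrow> 'm \<Rightarrow> 'm" (infixl "\<oplus>\<index>" 65)
  Scl :: "complex \<Rightarrow> 'm \<Rightarrow> 'm" (infixr "\<odot>\<index>" 75)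
  Dag :: "'m \<Rightarrow> 'm" ("_\<dagger>\<index>" [1000] 999)

definition hom :: "('x, 'm, 'z) dcat_scheme \<Rightarrow> 'x \<Rightarrow> 'x \<Rightarrow> 'm set"
  where "hom C x y = {f \<in> Arr C. Dom C f = x \<and> Cod C f = y}"

definition csum :: "('x, 'm, 'z) dcat_scheme \<Rightarrow> 'x \<Rightarrow> 'x \<Rightarrow> 'm list \<Rightarrow> 'm"
  where "csum C x y fs = foldr (Add C) fs (Zer C x y)"

definition is_iso :: "('x, 'm, 'z) dcat_scheme \<Rightarrow> 'm \<Rightarrow> bool"
  where "is_iso C f \<longleftrightarrow> f \<in> Arr C \<and>
    (\<exists>g \<in> hom C (Cod C f) (Dom C f). g \<cdot> f = \<i>\<d> (Dom C f) \<and> f \<cdot> g = \<i>\<d> (Cod C f))"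
  for C (structure)

definition isomorphic :: "('x, 'm, 'z) dcat_scheme \<Rightarrow> 'x \<Rightarrow> 'x \<Rightarrow> bool"
  where "isomorphic C x y \<longleftrightarrow> (\<exists>f \<in> hom C x y. is_iso C f)"

definition isometric :: "('x, 'm, 'z) dcat_scheme \<Rightarrow> 'm \<Rightarrow> bool"
  where "isometric C v \<longleftrightarrow> v \<in> Arr C \<and> v\<dagger> \<cdot> v = \<i>\<d> (Dom C v)"
  for C (structure)

definition unitary :: "('x, 'm, 'z) dcat_scheme \<Rightarrow> 'm \<Rightarrow> bool"
  where "unitary C u \<longleftrightarrow>
    u \<in> Arr C \<and> u\<dagger> \<cdot> u = \<i>\<d> (Dom C u) \<and> u \<cdot> u\<dagger> = \<i>\<d> (Cod C u)"
  for C (structure)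

locale lin_dagger_category =
  fixes C :: "('x, 'm, 'z) dcat_scheme" (structure)
  assumes arr_obj: "f \<in> Arr C \<Longrightarrow> Dom C f \<in> Obj C \<and> Cod C f \<in> Obj C"
    and id_hom: "x \<in> Obj C \<Longrightarrow> \<i>\<d> x \<in> hom C x x"
    and comp_hom: "f \<in> hom C x y \<Longrightarrow> g \<in> hom C y z \<Longrightarrow> g \<cdot> f \<in> hom C x z"
    and comp_assoc: "f \<in> hom C w x \<Longrightarrow> g \<in> hom C x y \<Longrightarrow> h \<in> hom C y z \<Longrightarrow>
      (h \<cdot> g) \<cdot> f = h \<cdot> (g \<cdot> f)"
    and id_left: "f \<in> hom C x y \<Longrightarrow> \<i>\<d> y \<cdot> f = f"
    and id_right: "f \<in> hom C x y \<Longrightarrow> f \<cdot> \<i>\<d> x = f"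
    and zero_hom: "x \<in> Obj C \<Longrightarrow> y \<in> Obj C \<Longrightarrow> Zer C x y \<in> hom C x y"
    and add_hom: "f \<in> hom C x y \<Longrightarrow> g \<in> hom C x y \<Longrightarrow> f \<oplus> g \<in> hom C x y"
    and scl_hom: "f \<in> hom C x y \<Longrightarrow> r \<odot> f \<in> hom C x y"
    and add_assoc: "f \<in> hom C x y \<Longrightarrow> g \<in> hom C x y \<Longrightarrow> h \<in> hom C x y \<Longrightarrow>
      (f \<oplus> g) \<oplus> h = f \<oplus> (g \<oplus> h)"
    and add_commute: "f \<in> hom C x y \<Longrightarrow> g \<in> hom C x y \<Longrightarrow> f \<oplus> g = g \<oplus> f"
    and add_zero: "f \<in> hom C x y \<Longrightarrow> f \<oplus> Zer C x y = f"
    and add_minus: "f \<in> hom C x y \<Longrightarrow> f \<oplus> (- 1) \<odot> f = Zer C x y"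
    and scl_one: "f \<in> hom C x y \<Longrightarrow> 1 \<odot> f = f"
    and scl_scl: "f \<in> hom C x y \<Longrightarrow> r \<odot> (s \<odot> f) = (r * s) \<odot> f"
    and scl_add_left: "f \<in> hom C x y \<Longrightarrow> (r + s) \<odot> f = r \<odot> f \<oplus> s \<odot> f"
    and scl_add_right: "f \<in> hom C x y \<Longrightarrow> g \<in> hom C x y \<Longrightarrow> r \<odot> (f \<oplus> g) = r \<odot> f \<oplus> r \<odot> g"
    and comp_add_left: "f \<in> hom C x y \<Longrightarrow> g \<in> hom C y z \<Longrightarrow> h \<in> hom C y z \<Longrightarrow>
      (g \<oplus> h) \<cdot> f = g \<cdot> f \<oplus> h \<cdot> f"
    and comp_add_right: "f \<in> hom C x y \<Longrightarrow> g \<in> hom C x y \<Longrightarrow> h \<in> hom C y z \<Longrightarrow>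
      h \<cdot> (f \<oplus> g) = h \<cdot> f \<oplus> h \<cdot> g"
    and comp_scl_left: "f \<in> hom C x y \<Longrightarrow> g \<in> hom C y z \<Longrightarrow> (r \<odot> g) \<cdot> f = r \<odot> (g \<cdot> f)"
    and comp_scl_right: "f \<in> hom C x y \<Longrightarrow> g \<in> hom C y z \<Longrightarrow> g \<cdot> (r \<odot> f) = r \<odot> (g \<cdot> f)"
    and dag_hom: "f \<in> hom C x y \<Longrightarrow> f\<dagger> \<in> hom C y x"
    and dag_dag: "f \<in> hom C x y \<Longrightarrow> (f\<dagger>)\<dagger> = f"
    and dag_comp: "f \<in> hom C x y \<Longrightarrow> g \<in> hom C y z \<Longrightarrow> (g \<cdot> f)\<dagger> = f\<dagger> \<cdot> g\<dagger>"
    and dag_add: "f \<in> hom C x y \<Longrightarrow> g \<in> hom C x y \<Longrightarrow> (f \<oplus> g)\<dagger> = f\<dagger> \<oplus> g\<dagger>"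
    and dag_scl: "f \<in> hom C x y \<Longrightarrow> (r \<odot> f)\<dagger> = cnj r \<odot> f\<dagger>"

text \<open>
  A \<open>C\<^sup>*\<close>-norm on a dagger category; it makes every hom space a Banach space.
\<close>

definition cstar_norm :: "('x, 'm, 'z) dcat_scheme \<Rightarrow> ('m \<Rightarrow> real) \<Rightarrow> bool"
  where "cstar_norm C N \<longleftrightarrow>
    (\<forall>x \<in> Obj C. \<forall>y \<in> Obj C.
      (\<forall>f \<in> hom C x y. 0 \<le> N f \<and> (N f = 0 \<longleftrightarrow> f = Zer C x y) \<and> (\<forall>r. N (r \<odot> f) = cmod r * N f)) \<and>
      (\<forall>f \<in> hom C x y. \<forall>g \<in> hom C x y. N (f \<oplus> g) \<le> N f + N g) \<and>
      (\<forall>s :: nat \<Rightarrow> 'm.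
        (\<forall>n. s n \<in> hom C x y) \<and>
        (\<forall>e > 0. \<exists>k. \<forall>m \<ge> k. \<forall>n \<ge> k. N (s m \<oplus> (- 1) \<odot> s n) < e) \<longrightarrow>
        (\<exists>l \<in> hom C x y. (\<lambda>n. N (s n \<oplus> (- 1) \<odot> l)) \<longlonglongrightarrow> 0)) \<and>
      (\<forall>f \<in> hom C x y. N (f\<dagger> \<cdot> f) = (N f)\<^sup>2) \<and>
      (\<forall>z \<in> Obj C. \<forall>f \<in> hom C x y. \<forall>g \<in> hom C y z. N (g \<cdot> f) \<le> N g * N f))"
  for C (structure)

text \<open>
  The \<open>C\<^sup>*\<close>-norm is unique, so its existence is a property of the dagger category.
\<close>

locale cstar_category = lin_dagger_category +
  assumes ex_cstar_norm: "\<exists>N. cstar_norm C N"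
    and dag_positive: "f \<in> hom C x y \<Longrightarrow> \<exists>h \<in> hom C x x. f\<dagger> \<cdot> f = h\<dagger> \<cdot> h"

definition orth_sum ::
    "('x, 'm, 'z) dcat_scheme \<Rightarrow> 'x list \<Rightarrow> 'x \<Rightarrow> 'm list \<Rightarrow> bool"
  where "orth_sum C xs s vs \<longleftrightarrow>
    s \<in> Obj C \<and> length vs = length xs \<and>
    (\<forall>j < length xs. vs ! j \<in> hom C (xs ! j) s) \<and>
    (\<forall>j < length xs. \<forall>k < length xs.
      (vs ! j)\<dagger> \<cdot> (vs ! k) = (if j = k then \<i>\<d> (xs ! j) else Zer C (xs ! k) (xs ! j))) \<and>
    csum C s s (map (\<lambda>v. v \<cdot> v\<dagger>) vs) = \<i>\<d> s"
  for C (structure)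

definition simple :: "('x, 'm, 'z) dcat_scheme \<Rightarrow> 'x \<Rightarrow> bool"
  where "simple C s \<longleftrightarrow>
    s \<in> Obj C \<and> \<i>\<d> s \<noteq> Zer C s s \<and> hom C s s = {r \<odot> \<i>\<d> s | r. True}"
  for C (structure)

locale semisimple_cstar_category = cstar_category +
  assumes ex_orth_sum: "set xs \<subseteq> Obj C \<Longrightarrow> \<exists>s vs. orth_sum C xs s vs"
    and projection_splits: "p \<in> hom C x x \<Longrightarrow> p \<cdot> p = p \<Longrightarrow> p\<dagger> = p \<Longrightarrow>
      \<exists>y \<in> Obj C. \<exists>v \<in> hom C y x. v\<dagger> \<cdot> v = \<i>\<d> y \<and> v \<cdot> v\<dagger> = p"
    and ex_simple_decomposition: "x \<in> Obj C \<Longrightarrow>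
      \<exists>ss vs. (\<forall>s \<in> set ss. simple C s) \<and> orth_sum C ss x vs"

locale finitely_semisimple_cstar_category = semisimple_cstar_category +
  assumes finitely_many_simples:
    "\<exists>S. finite S \<and> (\<forall>s. simple C s \<longrightarrow> (\<exists>t \<in> S. isomorphic C s t))"

definition faithful_positive_functional ::
    "('x, 'm, 'z) dcat_scheme \<Rightarrow> 'x \<Rightarrow> ('m \<Rightarrow> complex) \<Rightarrow> bool"
  where "faithful_positive_functional C c \<phi> \<longleftrightarrow>
    (\<forall>f \<in> hom C c c. \<forall>g \<in> hom C c c. \<phi> (f \<oplus> g) = \<phi> f + \<phi> g) \<and>
    (\<forall>f \<in> hom C c c. \<forall>r. \<phi> (r \<odot> f) = r * \<phi> f) \<and>
    (\<forall>f \<in> hom C c c. \<phi> (f\<dagger> \<cdot> f) \<in> \<real> \<and> 0 \<le> Re (\<phi> (f\<dagger> \<cdot> f)) \<and>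
      (\<phi> (f\<dagger> \<cdot> f) = 0 \<longrightarrow> f = Zer C c c))"
  for C (structure)


section \<open>2-Hilbert spaces\<close>

record ('x, 'm) twohilb = "('x, 'm) dcat" +
  Tr :: "'x \<Rightarrow> 'm \<Rightarrow> complex"

locale two_hilbert = finitely_semisimple_cstar_category C
  for C :: "('x, 'm, 'z) twohilb_scheme" (structure) +
  assumes trace_functional: "c \<in> Obj C \<Longrightarrow> faithful_positive_functional C c (Tr C c)"
    and trace_commute: "f \<in> hom C a b \<Longrightarrow> g \<in> hom C b a \<Longrightarrow> Tr C a (g \<cdot> f) = Tr C b (f \<cdot> g)"

definition inner_hom :: "('x, 'm) twohilb \<Rightarrow> 'm \<Rightarrow> 'm \<Rightarrow> complex"
  where "inner_hom C f g = Tr C (Dom C f) (f\<dagger> \<cdot> g)"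
  for C (structure)

text \<open>
  Functors and natural transformations carry their source and target, and their maps are
  \<open>undefined\<close> off the source, so that they can be compared by equality.
\<close>

record ('x, 'm) hfun =
  FDom :: "('x, 'm) twohilb"
  FCod :: "('x, 'm) twohilb"
  FO :: "'x \<Rightarrow> 'x"
  FM :: "'m \<Rightarrow> 'm"

record ('x, 'm) hnat =
  NDom :: "('x, 'm) hfun"
  NCod :: "('x, 'm) hfun"
  NC :: "'x \<Rightarrow> 'm"

definition dagger_functor :: "('x, 'm) hfun \<Rightarrow> bool"
  where "dagger_functor F \<longleftrightarrow>
    (let A = FDom F; B = FCod F in
      two_hilbert A \<and> two_hilbert B \<and>
      FO F \<in> Obj A \<rightarrow>\<^sub>E Obj B \<and> FM F \<in> extensional (Arr A) \<and>
      (\<forall>x y. \<forall>f \<in> hom A x y. FM F f \<in> hom B (FO F x) (FO F y)) \<and>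
      (\<forall>x \<in> Obj A. FM F (Idn A x) = Idn B (FO F x)) \<and>
      (\<forall>x y z. \<forall>f \<in> hom A x y. \<forall>g \<in> hom A y z. FM F (g \<cdot>\<^bsub>A\<^esub> f) = FM F g \<cdot>\<^bsub>B\<^esub> FM F f) \<and>
      (\<forall>x y. \<forall>f \<in> hom A x y. \<forall>g \<in> hom A x y. FM F (f \<oplus>\<^bsub>A\<^esub> g) = FM F f \<oplus>\<^bsub>B\<^esub> FM F g) \<and>
      (\<forall>r. \<forall>f \<in> Arr A. FM F (r \<odot>\<^bsub>A\<^esub> f) = r \<odot>\<^bsub>B\<^esub> FM F f) \<and>
      (\<forall>f \<in> Arr A. FM F (Dag A f) = Dag B (FM F f)))"

definition nat_trans :: "('x, 'm) hnat \<Rightarrow> bool"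
  where "nat_trans \<eta> \<longleftrightarrow>
    (let F = NDom \<eta>; G = NCod \<eta>; A = FDom F; B = FCod F in
      dagger_functor F \<and> dagger_functor G \<and> FDom G = A \<and> FCod G = B \<and>
      NC \<eta> \<in> extensional (Obj A) \<and>
      (\<forall>x \<in> Obj A. NC \<eta> x \<in> hom B (FO F x) (FO G x)) \<and>
      (\<forall>x y. \<forall>f \<in> hom A x y. NC \<eta> y \<cdot>\<^bsub>B\<^esub> FM F f = FM G f \<cdot>\<^bsub>B\<^esub> NC \<eta> x))"

definition hf_id :: "('x, 'm) twohilb \<Rightarrow> ('x, 'm) hfun"
  where "hf_id A =
    \<lparr> FDom = A, FCod = A, FO = (\<lambda>x \<in> Obj A. x), FM = (\<lambda>f \<in> Arr A. f) \<rparr>"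

text \<open>First \<open>F\<close>, then \<open>G\<close>.\<close>

definition hf_comp :: "('x, 'm) hfun \<Rightarrow> ('x, 'm) hfun \<Rightarrow> ('x, 'm) hfun"
  where "hf_comp F G =
    \<lparr> FDom = FDom F, FCod = FCod G,
      FO = (\<lambda>x \<in> Obj (FDom F). FO G (FO F x)), FM = (\<lambda>f \<in> Arr (FDom F). FM G (FM F f)) \<rparr>"

definition natural_unitary_iso ::
    "('x, 'm) hfun \<Rightarrow> ('x, 'm) hfun \<Rightarrow> ('x \<Rightarrow> 'x \<Rightarrow> 'm \<Rightarrow> 'm) \<Rightarrow> bool"
  where "natural_unitary_iso F G \<phi> \<longleftrightarrow>
    (let A = FDom F; B = FCod F in
      (\<forall>a \<in> Obj A. \<forall>b \<in> Obj B.
        bij_betw (\<phi> a b) (hom B (FO F a) b) (hom A a (FO G b)) \<and>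
        (\<forall>f \<in> hom B (FO F a) b. \<forall>g \<in> hom B (FO F a) b.
          \<phi> a b (f \<oplus>\<^bsub>B\<^esub> g) = \<phi> a b f \<oplus>\<^bsub>A\<^esub> \<phi> a b g \<and>
          inner_hom A (\<phi> a b f) (\<phi> a b g) = inner_hom B f g) \<and>
        (\<forall>r. \<forall>f \<in> hom B (FO F a) b. \<phi> a b (r \<odot>\<^bsub>B\<^esub> f) = r \<odot>\<^bsub>A\<^esub> \<phi> a b f)) \<and>
      (\<forall>a a' b b'. \<forall>k \<in> hom A a' a. \<forall>h \<in> hom B b b'. \<forall>f \<in> hom B (FO F a) b.
        \<phi> a' b' (h \<cdot>\<^bsub>B\<^esub> f \<cdot>\<^bsub>B\<^esub> FM F k) = FM G h \<cdot>\<^bsub>A\<^esub> \<phi> a b f \<cdot>\<^bsub>A\<^esub> k))"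

text \<open>
  \<open>F \<stileturn>\<^sup>\<dagger> G\<close> for dagger functors, with given unit \<open>\<eta>\<close> and counit \<open>\<epsilon>\<close>: the
  natural unitary isomorphisms are the mates \<open>f \<mapsto> G(f) \<eta>\<close>.
\<close>

definition unitary_adjunction ::
    "('x, 'm) hfun \<Rightarrow> ('x, 'm) hfun \<Rightarrow> ('x, 'm) hnat \<Rightarrow> ('x, 'm) hnat \<Rightarrow> bool"
  where "unitary_adjunction F G \<eta> \<epsilon> \<longleftrightarrow>
    (let A = FDom F; B = FCod F in
      dagger_functor F \<and> dagger_functor G \<and> FDom G = B \<and> FCod G = A \<and>
      nat_trans \<eta> \<and> NDom \<eta> = hf_id A \<and> NCod \<eta> = hf_comp F G \<and>
      nat_trans \<epsilon> \<and> NDom \<epsilon> = hf_comp G F \<and> NCod \<epsilon> = hf_id B \<and>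
      (\<forall>a \<in> Obj A. NC \<epsilon> (FO F a) \<cdot>\<^bsub>B\<^esub> FM F (NC \<eta> a) = Idn B (FO F a)) \<and>
      (\<forall>b \<in> Obj B. FM G (NC \<epsilon> b) \<cdot>\<^bsub>A\<^esub> NC \<eta> (FO G b) = Idn A (FO G b)) \<and>
      natural_unitary_iso F G (\<lambda>a b f. FM G f \<cdot>\<^bsub>A\<^esub> NC \<eta> a))"


section \<open>\<open>C\<^sup>*\<close>-2-categories\<close>

text \<open>
  The underlying dcat has the 1-morphisms as objects and the 2-morphisms as arrows.
  The product \<open>x \<otimes> y\<close> is ``first \<open>x\<close>, then \<open>y\<close>'', and \<open>\<star>\<close> is the horizontal composition
  of 2-morphisms in the same order.  A monoidal category is the case where \<open>'o\<close> is \<open>unit\<close>.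
\<close>

record ('x, 'm, 'o) bicat = "('x, 'm) dcat" +
  Ob0 :: "'o set"
  Src :: "'x \<Rightarrow> 'o"
  Trg :: "'x \<Rightarrow> 'o"
  One :: "'o \<Rightarrow> 'x"
  Ten1 :: "'x \<Rightarrow> 'x \<Rightarrow> 'x" (infixr "\<otimes>\<index>" 80)
  Ten2 :: "'m \<Rightarrow> 'm \<Rightarrow> 'm" (infixr "\<star>\<index>" 80)
  Asc :: "'x \<Rightarrow> 'x \<Rightarrow> 'x \<Rightarrow> 'm" \<comment> \<open>\<open>(x \<otimes> y) \<otimes> z \<Rightarrow> x \<otimes> (y \<otimes> z)\<close>\<close>
  Lun :: "'x \<Rightarrow> 'm" \<comment> \<open>\<open>1 \<otimes> x \<Rightarrow> x\<close>\<close>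
  Run :: "'x \<Rightarrow> 'm" \<comment> \<open>\<open>x \<otimes> 1 \<Rightarrow> x\<close>\<close>

definition hom1 :: "('x, 'm, 'o, 'z) bicat_scheme \<Rightarrow> 'o \<Rightarrow> 'o \<Rightarrow> 'x set"
  where "hom1 B a b = {x \<in> Obj B. Src B x = a \<and> Trg B x = b}"

definition hom_cat :: "('x, 'm, 'o, 'z) bicat_scheme \<Rightarrow> 'o \<Rightarrow> 'o \<Rightarrow> ('x, 'm) dcat"
  where "hom_cat B a b =
    \<lparr> Obj = hom1 B a b, Arr = {f \<in> Arr B. Dom B f \<in> hom1 B a b}, Dom = Dom B, Cod = Cod B,
      Idn = Idn B, Cmp = Cmp B, Zer = Zer B, Add = Add B, Scl = Scl B, Dag = Dag B \<rparr>"

locale cstar_2category =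
  fixes B :: "('x, 'm, 'o, 'z) bicat_scheme" (structure)
  assumes src_trg: "x \<in> Obj B \<Longrightarrow> Src B x \<in> Ob0 B \<and> Trg B x \<in> Ob0 B"
    and arr_parallel: "f \<in> Arr B \<Longrightarrow> Dom B f \<in> Obj B \<and> Cod B f \<in> Obj B \<and>
      Src B (Dom B f) = Src B (Cod B f) \<and> Trg B (Dom B f) = Trg B (Cod B f)"
    and hom_cat_cstar: "a \<in> Ob0 B \<Longrightarrow> b \<in> Ob0 B \<Longrightarrow> cstar_category (hom_cat B a b)"
    and one_hom1: "a \<in> Ob0 B \<Longrightarrow> One B a \<in> hom1 B a a"
    and ten_hom1: "x \<in> hom1 B a b \<Longrightarrow> y \<in> hom1 B b c \<Longrightarrow> x \<otimes> y \<in> hom1 B a c"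
    and ten_hom: "f \<in> hom B x x' \<Longrightarrow> g \<in> hom B y y' \<Longrightarrow> Trg B x = Src B y \<Longrightarrow>
      f \<star> g \<in> hom B (x \<otimes> y) (x' \<otimes> y')"
    and ten_id: "x \<in> hom1 B a b \<Longrightarrow> y \<in> hom1 B b c \<Longrightarrow> \<i>\<d> x \<star> \<i>\<d> y = \<i>\<d> (x \<otimes> y)"
    and interchange: "f \<in> hom B x x' \<Longrightarrow> f' \<in> hom B x' x'' \<Longrightarrow>
      g \<in> hom B y y' \<Longrightarrow> g' \<in> hom B y' y'' \<Longrightarrow> Trg B x = Src B y \<Longrightarrow>
      (f' \<cdot> f) \<star> (g' \<cdot> g) = (f' \<star> g') \<cdot> (f \<star> g)"
    and ten_add_left: "f \<in> hom B x x' \<Longrightarrow> f' \<in> hom B x x' \<Longrightarrow> g \<in> hom B y y' \<Longrightarrow>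
      Trg B x = Src B y \<Longrightarrow> (f \<oplus> f') \<star> g = f \<star> g \<oplus> f' \<star> g"
    and ten_add_right: "f \<in> hom B x x' \<Longrightarrow> g \<in> hom B y y' \<Longrightarrow> g' \<in> hom B y y' \<Longrightarrow>
      Trg B x = Src B y \<Longrightarrow> f \<star> (g \<oplus> g') = f \<star> g \<oplus> f \<star> g'"
    and ten_scl_left: "f \<in> hom B x x' \<Longrightarrow> g \<in> hom B y y' \<Longrightarrow> Trg B x = Src B y \<Longrightarrow>
      (r \<odot> f) \<star> g = r \<odot> (f \<star> g)"
    and ten_scl_right: "f \<in> hom B x x' \<Longrightarrow> g \<in> hom B y y' \<Longrightarrow> Trg B x = Src B y \<Longrightarrow>
      f \<star> (r \<odot> g) = r \<odot> (f \<star> g)"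
    and ten_dag: "f \<in> hom B x x' \<Longrightarrow> g \<in> hom B y y' \<Longrightarrow> Trg B x = Src B y \<Longrightarrow>
      (f \<star> g)\<dagger> = f\<dagger> \<star> g\<dagger>"
    and asc_hom: "x \<in> hom1 B a b \<Longrightarrow> y \<in> hom1 B b c \<Longrightarrow> z \<in> hom1 B c d \<Longrightarrow>
      Asc B x y z \<in> hom B ((x \<otimes> y) \<otimes> z) (x \<otimes> (y \<otimes> z))"
    and asc_unitary: "x \<in> hom1 B a b \<Longrightarrow> y \<in> hom1 B b c \<Longrightarrow> z \<in> hom1 B c d \<Longrightarrow>
      unitary B (Asc B x y z)"
    and asc_natural: "f \<in> hom B x x' \<Longrightarrow> g \<in> hom B y y' \<Longrightarrow> h \<in> hom B z z' \<Longrightarrow>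
      Trg B x = Src B y \<Longrightarrow> Trg B y = Src B z \<Longrightarrow>
      Asc B x' y' z' \<cdot> ((f \<star> g) \<star> h) = (f \<star> (g \<star> h)) \<cdot> Asc B x y z"
    and lun_hom: "x \<in> hom1 B a b \<Longrightarrow> Lun B x \<in> hom B (One B a \<otimes> x) x"
    and lun_unitary: "x \<in> Obj B \<Longrightarrow> unitary B (Lun B x)"
    and lun_natural: "f \<in> hom B x y \<Longrightarrow> Lun B y \<cdot> (\<i>\<d> (One B (Src B x)) \<star> f) = f \<cdot> Lun B x"
    and run_hom: "x \<in> hom1 B a b \<Longrightarrow> Run B x \<in> hom B (x \<otimes> One B b) x"
    and run_unitary: "x \<in> Obj B \<Longrightarrow> unitary B (Run B x)"
    and run_natural: "f \<in> hom B x y \<Longrightarrow> Run B y \<cdot> (f \<star> \<i>\<d> (One B (Trg B x))) = f \<cdot> Run B x"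
    and pentagon: "w \<in> hom1 B a b \<Longrightarrow> x \<in> hom1 B b c \<Longrightarrow> y \<in> hom1 B c d \<Longrightarrow> z \<in> hom1 B d e \<Longrightarrow>
      (\<i>\<d> w \<star> Asc B x y z) \<cdot> Asc B w (x \<otimes> y) z \<cdot> (Asc B w x y \<star> \<i>\<d> z)
      = Asc B w x (y \<otimes> z) \<cdot> Asc B (w \<otimes> x) y z"
    and triangle: "x \<in> hom1 B a b \<Longrightarrow> y \<in> hom1 B b c \<Longrightarrow>
      (\<i>\<d> x \<star> Lun B y) \<cdot> Asc B x (One B b) y = Run B x \<star> \<i>\<d> y"

text \<open>\<open>y\<close> is a dual of \<open>x\<close>, with evaluation \<open>e : y \<otimes> x \<Rightarrow> 1\<close> and coevaluation \<open>c : 1 \<Rightarrow> x \<otimes> y\<close>.\<close>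

definition is_dual ::
    "('x, 'm, 'o, 'z) bicat_scheme \<Rightarrow> 'x \<Rightarrow> 'x \<Rightarrow> 'm \<Rightarrow> 'm \<Rightarrow> bool"
  where "is_dual B x y e c \<longleftrightarrow>
    x \<in> Obj B \<and> y \<in> hom1 B (Trg B x) (Src B x) \<and>
    e \<in> hom B (y \<otimes> x) (One B (Trg B x)) \<and> c \<in> hom B (One B (Src B x)) (x \<otimes> y) \<and>
    Run B x \<cdot> (\<i>\<d> x \<star> e) \<cdot> Asc B x y x \<cdot> (c \<star> \<i>\<d> x) \<cdot> (Lun B x)\<dagger> = \<i>\<d> x \<and>
    Lun B y \<cdot> (e \<star> \<i>\<d> y) \<cdot> (Asc B y x y)\<dagger> \<cdot> (\<i>\<d> y \<star> c) \<cdot> (Run B y)\<dagger> = \<i>\<d> y"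
  for B (structure)

text \<open>
  The map \<open>w \<Rightarrow> v\<close> obtained from \<open>e : w \<otimes> x \<Rightarrow> 1\<close> and \<open>c : 1 \<Rightarrow> x \<otimes> v\<close>; for two duals \<open>w\<close>
  and \<open>v\<close> of \<open>x\<close>, with the evaluation of \<open>w\<close> and the coevaluation of \<open>v\<close>, it is the canonical
  isomorphism between them.
\<close>

definition dual_map ::
    "('x, 'm, 'o, 'z) bicat_scheme \<Rightarrow> 'x \<Rightarrow> 'x \<Rightarrow> 'x \<Rightarrow> 'm \<Rightarrow> 'm \<Rightarrow> 'm"
  where "dual_map B w x v e c =
    Lun B v \<cdot> (e \<star> \<i>\<d> v) \<cdot> (Asc B w x v)\<dagger> \<cdot> (\<i>\<d> w \<star> c) \<cdot> (Run B w)\<dagger>"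
  for B (structure)


section \<open>Unitary 2-categories\<close>

locale unitary_multitensor = cstar_2category M
  for M :: "('x, 'm, unit, 'z) bicat_scheme" (structure) +
  assumes one_object: "Ob0 M = {()}"
    and semisimple: "semisimple_cstar_category (hom_cat M () ())"
    and rigid: "x \<in> Obj M \<Longrightarrow> (\<exists>y e c. is_dual M x y e c) \<and> (\<exists>y e c. is_dual M y x e c)"

locale unitary_multifusion = unitary_multitensor +
  assumes finitely_semisimple: "finitely_semisimple_cstar_category (hom_cat M () ())"

text \<open>
  The linking category of \<open>a\<^sub>0, \<dots>, a\<^sub>n\<^sub>-\<^sub>1\<close>.  An object is a matrix with \<open>(i,j)\<close>-entry in the
  1-morphisms from \<open>a\<^sub>j\<close> to \<open>a\<^sub>i\<close>, and the monoidal product is matrix multiplication, with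
  \<open>(M N)\<^sub>i\<^sub>k\<close> a chosen orthogonal direct sum of the composites ``\<open>M\<^sub>i\<^sub>j\<close> after \<open>N\<^sub>j\<^sub>k\<close>''.
  Choices exist once the linking category is semisimple, since its direct sums are entrywise.
\<close>

definition chosen_sum :: "('x, 'm, 'z) dcat_scheme \<Rightarrow> 'x list \<Rightarrow> 'x \<times> 'm list"
  where "chosen_sum C xs = (SOME p. orth_sum C xs (fst p) (snd p))"

definition mat :: "nat \<Rightarrow> (nat \<Rightarrow> nat \<Rightarrow> 'c) \<Rightarrow> nat \<Rightarrow> nat \<Rightarrow> 'c"
  where "mat n f = (\<lambda>i j. if i < n \<and> j < n then f i j else undefined)"

definition mat_summands ::
    "('x, 'm, 'o, 'z) bicat_scheme \<Rightarrow> 'o list \<Rightarrow> (nat \<Rightarrow> nat \<Rightarrow> 'x) \<Rightarrow> (nat \<Rightarrow> nat \<Rightarrow> 'x) \<Rightarrow>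
      nat \<Rightarrow> nat \<Rightarrow> 'x \<times> 'm list"
  where "mat_summands B as M N i k =
    chosen_sum (hom_cat B (as ! k) (as ! i))
      (map (\<lambda>j. N j k \<otimes>\<^bsub>B\<^esub> M i j) [0..<length as])"

definition mat_mult ::
    "('x, 'm, 'o, 'z) bicat_scheme \<Rightarrow> 'o list \<Rightarrow> (nat \<Rightarrow> nat \<Rightarrow> 'x) \<Rightarrow> (nat \<Rightarrow> nat \<Rightarrow> 'x) \<Rightarrow>
      nat \<Rightarrow> nat \<Rightarrow> 'x"
  where "mat_mult B as M N = mat (length as) (\<lambda>i k. fst (mat_summands B as M N i k))"

text \<open>The isometry \<open>N\<^sub>j\<^sub>k \<otimes> M\<^sub>i\<^sub>j \<Rightarrow> (M N)\<^sub>i\<^sub>k\<close>.\<close>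

definition mat_inj ::
    "('x, 'm, 'o, 'z) bicat_scheme \<Rightarrow> 'o list \<Rightarrow> (nat \<Rightarrow> nat \<Rightarrow> 'x) \<Rightarrow> (nat \<Rightarrow> nat \<Rightarrow> 'x) \<Rightarrow>
      nat \<Rightarrow> nat \<Rightarrow> nat \<Rightarrow> 'm"
  where "mat_inj B as M N i k j = snd (mat_summands B as M N i k) ! j"

definition mat_one :: "('x, 'm, 'o, 'z) bicat_scheme \<Rightarrow> 'o list \<Rightarrow> nat \<Rightarrow> nat \<Rightarrow> 'x"
  where "mat_one B as = mat (length as) (\<lambda>i j. if i = j then One B (as ! i)
    else fst (chosen_sum (hom_cat B (as ! j) (as ! i)) []))"

definition mat_ten2 ::
    "('x, 'm, 'o, 'z) bicat_scheme \<Rightarrow> 'o list \<Rightarrow> (nat \<Rightarrow> nat \<Rightarrow> 'm) \<Rightarrow> (nat \<Rightarrow> nat \<Rightarrow> 'm) \<Rightarrow>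
      nat \<Rightarrow> nat \<Rightarrow> 'm"
  where "mat_ten2 B as f g =
    (let n = length as;
         M = mat n (\<lambda>i j. Dom B (f i j)); M' = mat n (\<lambda>i j. Cod B (f i j));
         N = mat n (\<lambda>i j. Dom B (g i j)); N' = mat n (\<lambda>i j. Cod B (g i j))
     in mat n (\<lambda>i k. csum B (mat_mult B as M N i k) (mat_mult B as M' N' i k)
          (map (\<lambda>j. mat_inj B as M' N' i k j \<cdot> (g j k \<star> f i j) \<cdot> (mat_inj B as M N i k j)\<dagger>)
            [0..<n])))"
  for B (structure)

definition mat_asc ::
    "('x, 'm, 'o, 'z) bicat_scheme \<Rightarrow> 'o list \<Rightarrow> (nat \<Rightarrow> nat \<Rightarrow> 'x) \<Rightarrow> (nat \<Rightarrow> nat \<Rightarrow> 'x) \<Rightarrow>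
      (nat \<Rightarrow> nat \<Rightarrow> 'x) \<Rightarrow> nat \<Rightarrow> nat \<Rightarrow> 'm"
  where "mat_asc B as M N P =
    (let n = length as; MN = mat_mult B as M N; NP = mat_mult B as N P
     in mat n (\<lambda>i l. csum B (mat_mult B as MN P i l) (mat_mult B as M NP i l)
          [mat_inj B as M NP i l j \<cdot> (mat_inj B as N P j l k \<star> \<i>\<d> (M i j))
             \<cdot> (Asc B (P k l) (N j k) (M i j))\<dagger>
             \<cdot> (\<i>\<d> (P k l) \<star> (mat_inj B as M N i k j)\<dagger>) \<cdot> (mat_inj B as MN P i l k)\<dagger>.
           j \<leftarrow> [0..<n], k \<leftarrow> [0..<n]]))"
  for B (structure)

definition linking ::
    "('x, 'm, 'o, 'z) bicat_scheme \<Rightarrow> 'o list \<Rightarrow> (nat \<Rightarrow> nat \<Rightarrow> 'x, nat \<Rightarrow> nat \<Rightarrow> 'm, unit) bicat"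
  where "linking B as =
    (let n = length as in
     \<lparr> Obj = {M. (\<forall>i < n. \<forall>j < n. M i j \<in> hom1 B (as ! j) (as ! i)) \<and> mat n M = M},
       Arr = {f. (\<forall>i < n. \<forall>j < n. f i j \<in> Arr (hom_cat B (as ! j) (as ! i))) \<and> mat n f = f},
       Dom = (\<lambda>f. mat n (\<lambda>i j. Dom B (f i j))),
       Cod = (\<lambda>f. mat n (\<lambda>i j. Cod B (f i j))),
       Idn = (\<lambda>M. mat n (\<lambda>i j. \<i>\<d> (M i j))),
       Cmp = (\<lambda>g f. mat n (\<lambda>i j. g i j \<cdot> f i j)),
       Zer = (\<lambda>M N. mat n (\<lambda>i j. Zer B (M i j) (N i j))),
       Add = (\<lambda>f g. mat n (\<lambda>i j. f i j \<oplus> g i j)),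
       Scl = (\<lambda>r f. mat n (\<lambda>i j. r \<odot> f i j)),
       Dag = (\<lambda>f. mat n (\<lambda>i j. (f i j)\<dagger>)),
       Ob0 = {()},
       Src = (\<lambda>_. ()),
       Trg = (\<lambda>_. ()),
       One = (\<lambda>_. mat_one B as),
       Ten1 = mat_mult B as,
       Ten2 = mat_ten2 B as,
       Asc = mat_asc B as,
       Lun = (\<lambda>M. mat n (\<lambda>i k. Run B (M i k) \<cdot> (mat_inj B as (mat_one B as) M i k i)\<dagger>)),
       Run = (\<lambda>M. mat n (\<lambda>i k. Lun B (M i k) \<cdot> (mat_inj B as M (mat_one B as) i k k)\<dagger>)) \<rparr>)"
  for B (structure)

text \<open>The Drinfeld center: objects with a half-braiding \<open>\<beta>\<^sub>x : z \<otimes> x \<Rightarrow> x \<otimes> z\<close>.\<close>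

definition center_obj :: "('x, 'm, unit, 'z) bicat_scheme \<Rightarrow> ('x \<times> ('x \<Rightarrow> 'm)) set"
  where "center_obj M = {(z, \<beta>). z \<in> Obj M \<and>
    (\<forall>x \<in> Obj M. \<beta> x \<in> hom M (z \<otimes> x) (x \<otimes> z) \<and> is_iso M (\<beta> x)) \<and>
    (\<forall>x y. \<forall>f \<in> hom M x y. \<beta> y \<cdot> (\<i>\<d> z \<star> f) = (f \<star> \<i>\<d> z) \<cdot> \<beta> x) \<and>
    (\<forall>x \<in> Obj M. \<forall>y \<in> Obj M. \<beta> (x \<otimes> y) =
      (Asc M x y z)\<dagger> \<cdot> (\<i>\<d> x \<star> \<beta> y) \<cdot> Asc M x z y \<cdot> (\<beta> x \<star> \<i>\<d> y) \<cdot> (Asc M z x y)\<dagger>)}"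
  for M (structure)

definition center_hom ::
    "('x, 'm, unit, 'z) bicat_scheme \<Rightarrow> 'x \<times> ('x \<Rightarrow> 'm) \<Rightarrow> 'x \<times> ('x \<Rightarrow> 'm) \<Rightarrow> 'm set"
  where "center_hom M Z W = {f. Z \<in> center_obj M \<and> W \<in> center_obj M \<and>
    f \<in> hom M (fst Z) (fst W) \<and>
    (\<forall>x \<in> Obj M. snd W x \<cdot> (f \<star> \<i>\<d> x) = (\<i>\<d> x \<star> f) \<cdot> snd Z x)}"
  for M (structure)

definition center_unit :: "('x, 'm, unit, 'z) bicat_scheme \<Rightarrow> 'x \<times> ('x \<Rightarrow> 'm)"
  where "center_unit M = (One M (), \<lambda>x. (Run M x)\<dagger> \<cdot> Lun M x)"
  for M (structure)

text \<open>The linear subspace \<open>S\<close> of the hom space from \<open>x\<close> to \<open>y\<close> has dimension at most \<open>k\<close>.\<close>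

definition dim_le :: "('x, 'm, 'z) dcat_scheme \<Rightarrow> 'x \<Rightarrow> 'x \<Rightarrow> 'm set \<Rightarrow> nat \<Rightarrow> bool"
  where "dim_le C x y S k \<longleftrightarrow>
    (\<exists>fs. length fs \<le> k \<and> set fs \<subseteq> S \<and>
      (\<forall>g \<in> S. \<exists>rs. length rs = length fs \<and> g = csum C x y (map2 (Scl C) rs fs)))"

locale unitary_2category = cstar_2category +
  assumes linking_multitensor:
    "as \<noteq> [] \<Longrightarrow> set as \<subseteq> Ob0 B \<Longrightarrow> unitary_multitensor (linking B as)"

locale finite_unitary_2category = unitary_2category +
  assumes linking_multifusion:
    "as \<noteq> [] \<Longrightarrow> set as \<subseteq> Ob0 B \<Longrightarrow> unitary_multifusion (linking B as)"
    and center_bounded: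
    "\<exists>k. \<forall>as. as \<noteq> [] \<and> set as \<subseteq> Ob0 B \<longrightarrow>
      (let L = linking B as in
        dim_le L (One L ()) (One L ()) (center_hom L (center_unit L) (center_unit L)) k)"


section \<open>3-Hilbert spaces\<close>

record ('x, 'm, 'o) threehilb = "('x, 'm, 'o) bicat" +
  Vee :: "'x \<Rightarrow> 'x"
  Ev :: "'x \<Rightarrow> 'm"
  Coev :: "'x \<Rightarrow> 'm"
  Psi :: "'o \<Rightarrow> 'm \<Rightarrow> complex"

text \<open>The evaluation \<open>(x\<^sup>\<or> \<otimes> y\<^sup>\<or>) \<otimes> (y \<otimes> x) \<Rightarrow> 1\<close> exhibiting \<open>x\<^sup>\<or> \<otimes> y\<^sup>\<or>\<close> as a dual of \<open>y \<otimes> x\<close>.\<close>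

definition ev_ten :: "('x, 'm, 'o, 'z) threehilb_scheme \<Rightarrow> 'x \<Rightarrow> 'x \<Rightarrow> 'm"
  where "ev_ten X y x =
    Ev X x \<cdot> (\<i>\<d> (Vee X x) \<star> (Lun X x \<cdot> (Ev X y \<star> \<i>\<d> x) \<cdot> (Asc X (Vee X y) y x)\<dagger>))
      \<cdot> Asc X (Vee X x) (Vee X y) (y \<otimes> x)"
  for X (structure)

definition vee2 :: "('x, 'm, 'o, 'z) threehilb_scheme \<Rightarrow> 'm \<Rightarrow> 'm"
  where "vee2 X f =
    (let x = Dom X f; y = Cod X f
     in dual_map X (Vee X y) x (Vee X x) (Ev X y \<cdot> (\<i>\<d> (Vee X y) \<star> f)) (Coev X x))"
  for X (structure)

locale uaf = cstar_2category X
  for X :: "('x, 'm, 'o, 'z) threehilb_scheme" (structure) +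
  assumes vee_dual: "x \<in> Obj X \<Longrightarrow> is_dual X x (Vee X x) (Ev X x) (Coev X x)"
    and vee_one_unitary: "a \<in> Ob0 X \<Longrightarrow>
      unitary X (dual_map X (Vee X (One X a)) (One X a) (One X a)
        (Ev X (One X a)) ((Lun X (One X a))\<dagger>))"
    and vee_ten_unitary: "y \<in> hom1 X a b \<Longrightarrow> x \<in> hom1 X b c \<Longrightarrow>
      unitary X (dual_map X (Vee X x \<otimes> Vee X y) (y \<otimes> x) (Vee X (y \<otimes> x))
        (ev_ten X y x) (Coev X (y \<otimes> x)))"
    and vee_dag: "f \<in> Arr X \<Longrightarrow> (vee2 X f)\<dagger> = vee2 X (f\<dagger>)"

definition trace_left :: "('x, 'm, 'o, 'z) threehilb_scheme \<Rightarrow> 'x \<Rightarrow> 'm \<Rightarrow> complex"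
  where "trace_left X x f = Psi X (Src X x) ((Coev X x)\<dagger> \<cdot> (f \<star> \<i>\<d> (Vee X x)) \<cdot> Coev X x)"
  for X (structure)

definition trace_right :: "('x, 'm, 'o, 'z) threehilb_scheme \<Rightarrow> 'x \<Rightarrow> 'm \<Rightarrow> complex"
  where "trace_right X x f = Psi X (Trg X x) (Ev X x \<cdot> (\<i>\<d> (Vee X x) \<star> f) \<cdot> (Ev X x)\<dagger>)"
  for X (structure)

locale pre_three_hilbert = finite_unitary_2category X + uaf X
  for X :: "('x, 'm, 'o, 'z) threehilb_scheme" (structure) +
  assumes weight_functional: "a \<in> Ob0 X \<Longrightarrow> faithful_positive_functional X (One X a) (Psi X a)"
    and weight_spherical: "x \<in> Obj X \<Longrightarrow> f \<in> hom X x x \<Longrightarrow> trace_left X x f = trace_right X x f"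

definition isometry1 :: "('x, 'm, 'o, 'z) threehilb_scheme \<Rightarrow> 'x \<Rightarrow> bool"
  where "isometry1 X x \<longleftrightarrow> x \<in> Obj X \<and> unitary X (Coev X x) \<and> isometric X (Ev X x)"

definition hilbert_direct_sum ::
    "('x, 'm, 'o, 'z) threehilb_scheme \<Rightarrow> 'o \<Rightarrow> 'o \<Rightarrow> 'o \<Rightarrow> bool"
  where "hilbert_direct_sum X a b s \<longleftrightarrow>
    s \<in> Ob0 X \<and>
    (\<exists>I \<in> hom1 X a s. \<exists>J \<in> hom1 X b s. isometry1 X I \<and> isometry1 X J \<and>
      Ev X I \<cdot> (Ev X I)\<dagger> \<oplus> Ev X J \<cdot> (Ev X J)\<dagger> = \<i>\<d> (One X s))"
  for X (structure)

text \<open>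
  The two equations for \<open>\<mu>\<^sup>\<dagger>\<close> say that \<open>\<mu>\<^sup>\<dagger>\<close> is an \<open>A\<close>-\<open>A\<close>-bimodule map from \<open>A\<close> to \<open>A \<otimes> A\<close>.
\<close>

definition hstar_monad ::
    "('x, 'm, 'o, 'z) threehilb_scheme \<Rightarrow> 'o \<Rightarrow> 'x \<Rightarrow> 'm \<Rightarrow> 'm \<Rightarrow> bool"
  where "hstar_monad X a A \<mu> \<iota> \<longleftrightarrow>
    a \<in> Ob0 X \<and> A \<in> hom1 X a a \<and> \<mu> \<in> hom X (A \<otimes> A) A \<and> \<iota> \<in> hom X (One X a) A \<and>
    \<mu> \<cdot> (\<mu> \<star> \<i>\<d> A) = \<mu> \<cdot> (\<i>\<d> A \<star> \<mu>) \<cdot> Asc X A A A \<and>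
    \<mu> \<cdot> (\<iota> \<star> \<i>\<d> A) = Lun X A \<and> \<mu> \<cdot> (\<i>\<d> A \<star> \<iota>) = Run X A \<and>
    \<mu>\<dagger> \<cdot> \<mu> = (\<mu> \<star> \<i>\<d> A) \<cdot> (Asc X A A A)\<dagger> \<cdot> (\<i>\<d> A \<star> \<mu>\<dagger>) \<and>
    \<mu>\<dagger> \<cdot> \<mu> = (\<i>\<d> A \<star> \<mu>) \<cdot> Asc X A A A \<cdot> (\<mu>\<dagger> \<star> \<i>\<d> A) \<and>
    is_iso X (\<mu> \<cdot> \<mu>\<dagger>) \<and>
    (\<forall>f \<in> hom X A A. Psi X a (\<iota>\<dagger> \<cdot> \<mu> \<cdot> (\<i>\<d> A \<star> f) \<cdot> \<mu>\<dagger> \<cdot> \<iota>)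
                    = Psi X a (\<iota>\<dagger> \<cdot> \<mu> \<cdot> (f \<star> \<i>\<d> A) \<cdot> \<mu>\<dagger> \<cdot> \<iota>))"
  for X (structure)

text \<open>The multiplication \<open>(x \<otimes> x\<^sup>\<or>) \<otimes> (x \<otimes> x\<^sup>\<or>) \<Rightarrow> x \<otimes> x\<^sup>\<or>\<close>; the unit is \<open>Coev X x\<close>.\<close>

definition pair_mult :: "('x, 'm, 'o, 'z) threehilb_scheme \<Rightarrow> 'x \<Rightarrow> 'm"
  where "pair_mult X x =
    (let v = Vee X x
     in (\<i>\<d> x \<star> (Lun X v \<cdot> (Ev X x \<star> \<i>\<d> v) \<cdot> (Asc X v x v)\<dagger>)) \<cdot> Asc X x v (x \<otimes> v))"
  for X (structure)

definition hstar_monad_splits ::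
    "('x, 'm, 'o, 'z) threehilb_scheme \<Rightarrow> 'o \<Rightarrow> 'x \<Rightarrow> 'm \<Rightarrow> 'm \<Rightarrow> bool"
  where "hstar_monad_splits X a A \<mu> \<iota> \<longleftrightarrow>
    (\<exists>b \<in> Ob0 X. \<exists>x \<in> hom1 X a b. is_iso X (Ev X x \<cdot> (Ev X x)\<dagger>) \<and>
      (\<exists>u \<in> hom X A (x \<otimes> Vee X x). unitary X u \<and>
        u \<cdot> \<mu> = pair_mult X x \<cdot> (u \<star> u) \<and> u \<cdot> \<iota> = Coev X x))"
  for X (structure)

text \<open>Finite direct sums include the empty one, an object whose identity 1-morphism is zero.\<close>

locale three_hilbert = pre_three_hilbert +
  assumes ex_hilbert_direct_sum: "a \<in> Ob0 X \<Longrightarrow> b \<in> Ob0 X \<Longrightarrow> \<exists>s. hilbert_direct_sum X a b s"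
    and ex_zero_object: "\<exists>z \<in> Ob0 X. \<i>\<d> (One X z) = Zer X (One X z) (One X z)"
    and monads_split: "hstar_monad X a A \<mu> \<iota> \<Longrightarrow> hstar_monad_splits X a A \<mu> \<iota>"

definition op1 :: "('x, 'm, 'o) threehilb \<Rightarrow> ('x, 'm, 'o) threehilb"
  where "op1 X = X
    \<lparr> Src := Trg X, Trg := Src X,
      Ten1 := (\<lambda>x y. y \<otimes> x), Ten2 := (\<lambda>f g. g \<star> f),
      Asc := (\<lambda>x y z. (Asc X z y x)\<dagger>), Lun := Run X, Run := Lun X,
      Ev := (\<lambda>x. (Coev X x)\<dagger>), Coev := (\<lambda>x. (Ev X x)\<dagger>) \<rparr>"
  for X (structure)


section \<open>Morphisms of 3-Hilbert spaces\<close>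

record ('x, 'm, 'o, 'y, 'n, 'p) twofun =
  F0 :: "'o \<Rightarrow> 'p"
  F1 :: "'x \<Rightarrow> 'y"
  F2 :: "'m \<Rightarrow> 'n"
  Fmul :: "'x \<Rightarrow> 'x \<Rightarrow> 'n" \<comment> \<open>\<open>F x \<otimes> F y \<Rightarrow> F (x \<otimes> y)\<close>\<close>
  Funi :: "'o \<Rightarrow> 'n" \<comment> \<open>\<open>1 \<Rightarrow> F 1\<close>\<close>

locale dagger_2functor =
  fixes B :: "('x, 'm, 'o, 'z) bicat_scheme"
    and D :: "('y, 'n, 'p, 'w) bicat_scheme"
    and F :: "('x, 'm, 'o, 'y, 'n, 'p) twofun"
  assumes F0_obj: "a \<in> Ob0 B \<Longrightarrow> F0 F a \<in> Ob0 D"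
    and F1_hom1: "x \<in> hom1 B a b \<Longrightarrow> F1 F x \<in> hom1 D (F0 F a) (F0 F b)"
    and F2_hom: "f \<in> hom B x y \<Longrightarrow> F2 F f \<in> hom D (F1 F x) (F1 F y)"
    and F2_id: "x \<in> Obj B \<Longrightarrow> F2 F (Idn B x) = Idn D (F1 F x)"
    and F2_comp: "f \<in> hom B x y \<Longrightarrow> g \<in> hom B y z \<Longrightarrow>
      F2 F (g \<cdot>\<^bsub>B\<^esub> f) = F2 F g \<cdot>\<^bsub>D\<^esub> F2 F f"
    and F2_add: "f \<in> hom B x y \<Longrightarrow> g \<in> hom B x y \<Longrightarrow>
      F2 F (f \<oplus>\<^bsub>B\<^esub> g) = F2 F f \<oplus>\<^bsub>D\<^esub> F2 F g"
    and F2_scl: "f \<in> Arr B \<Longrightarrow> F2 F (r \<odot>\<^bsub>B\<^esub> f) = r \<odot>\<^bsub>D\<^esub> F2 F f"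
    and F2_dag: "f \<in> Arr B \<Longrightarrow> F2 F (Dag B f) = Dag D (F2 F f)"
    and Fmul_hom: "x \<in> hom1 B a b \<Longrightarrow> y \<in> hom1 B b c \<Longrightarrow>
      Fmul F x y \<in> hom D (F1 F x \<otimes>\<^bsub>D\<^esub> F1 F y) (F1 F (x \<otimes>\<^bsub>B\<^esub> y))"
    and Fmul_unitary: "x \<in> hom1 B a b \<Longrightarrow> y \<in> hom1 B b c \<Longrightarrow> unitary D (Fmul F x y)"
    and Fmul_natural: "f \<in> hom B x x' \<Longrightarrow> g \<in> hom B y y' \<Longrightarrow> Trg B x = Src B y \<Longrightarrow>
      Fmul F x' y' \<cdot>\<^bsub>D\<^esub> (F2 F f \<star>\<^bsub>D\<^esub> F2 F g) = F2 F (f \<star>\<^bsub>B\<^esub> g) \<cdot>\<^bsub>D\<^esub> Fmul F x y"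
    and Funi_hom: "a \<in> Ob0 B \<Longrightarrow> Funi F a \<in> hom D (One D (F0 F a)) (F1 F (One B a))"
    and Funi_unitary: "a \<in> Ob0 B \<Longrightarrow> unitary D (Funi F a)"
    and Fmul_assoc: "x \<in> hom1 B a b \<Longrightarrow> y \<in> hom1 B b c \<Longrightarrow> z \<in> hom1 B c d \<Longrightarrow>
      F2 F (Asc B x y z) \<cdot>\<^bsub>D\<^esub> Fmul F (x \<otimes>\<^bsub>B\<^esub> y) z \<cdot>\<^bsub>D\<^esub> (Fmul F x y \<star>\<^bsub>D\<^esub> Idn D (F1 F z))
      = Fmul F x (y \<otimes>\<^bsub>B\<^esub> z) \<cdot>\<^bsub>D\<^esub> (Idn D (F1 F x) \<star>\<^bsub>D\<^esub> Fmul F y z)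
          \<cdot>\<^bsub>D\<^esub> Asc D (F1 F x) (F1 F y) (F1 F z)"
    and Fmul_left_unit: "x \<in> hom1 B a b \<Longrightarrow>
      F2 F (Lun B x) \<cdot>\<^bsub>D\<^esub> Fmul F (One B a) x \<cdot>\<^bsub>D\<^esub> (Funi F a \<star>\<^bsub>D\<^esub> Idn D (F1 F x))
      = Lun D (F1 F x)"
    and Fmul_right_unit: "x \<in> hom1 B a b \<Longrightarrow>
      F2 F (Run B x) \<cdot>\<^bsub>D\<^esub> Fmul F x (One B b) \<cdot>\<^bsub>D\<^esub> (Idn D (F1 F x) \<star>\<^bsub>D\<^esub> Funi F b)
      = Run D (F1 F x)"

text \<open>
  The canonical isomorphism \<open>F (x\<^sup>\<or>) \<Rightarrow> (F x)\<^sup>\<or>\<close>, comparing \<open>F (x\<^sup>\<or>)\<close>, a dual of \<open>F x\<close> by the image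
  of the evaluation of \<open>x\<close>, with the chosen dual.
\<close>

definition vee_comparison ::
    "('x, 'm, 'o, 'z) threehilb_scheme \<Rightarrow> ('y, 'n, 'p, 'w) threehilb_scheme \<Rightarrow>
      ('x, 'm, 'o, 'y, 'n, 'p) twofun \<Rightarrow> 'x \<Rightarrow> 'n"
  where "vee_comparison X Y F x =
    dual_map Y (F1 F (Vee X x)) (F1 F x) (Vee Y (F1 F x))
      (Dag Y (Funi F (Trg X x)) \<cdot>\<^bsub>Y\<^esub> F2 F (Ev X x) \<cdot>\<^bsub>Y\<^esub> Fmul F (Vee X x) x)
      (Coev Y (F1 F x))"

locale three_hilbert_morphism = dagger_2functor X Y F
  for X :: "('x, 'm, 'o, 'z) threehilb_scheme"
    and Y :: "('y, 'n, 'p, 'w) threehilb_scheme"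
    and F +
  assumes uaf_preserving: "x \<in> Obj X \<Longrightarrow> unitary Y (vee_comparison X Y F x)"


section \<open>The 3-Hilbert space of 2-Hilbert spaces\<close>

text \<open>
  Unitary adjoints are unique only up to unique unitary isomorphism, so the UAF of the
  3-Hilbert space of 2-Hilbert spaces involves a choice of a unitary adjoint \<open>V F\<close>, with counit
  \<open>ev F\<close> and unit \<open>coev F\<close>, for every \<open>F\<close>.
\<close>

definition unitary_adjoint_choice ::
    "(('x, 'm) hfun \<Rightarrow> ('x, 'm) hfun) \<Rightarrow> (('x, 'm) hfun \<Rightarrow> ('x, 'm) hnat) \<Rightarrow>
      (('x, 'm) hfun \<Rightarrow> ('x, 'm) hnat) \<Rightarrow> bool"
  where "unitary_adjoint_choice V ev coev \<longleftrightarrow>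
    (\<forall>F. dagger_functor F \<longrightarrow> unitary_adjunction F (V F) (coev F) (ev F))"

definition Irr :: "('x, 'm) twohilb \<Rightarrow> 'x set"
  where "Irr A = (SOME S. (\<forall>s \<in> S. simple A s) \<and>
    (\<forall>s. simple A s \<longrightarrow> (\<exists>!t. t \<in> S \<and> isomorphic A s t)))"

definition hn_map ::
    "('x, 'm) hfun \<Rightarrow> ('x, 'm) hfun \<Rightarrow> ('x \<Rightarrow> 'm) \<Rightarrow> ('x, 'm) hnat"
  where "hn_map F G \<eta> = \<lparr> NDom = F, NCod = G, NC = restrict \<eta> (Obj (FDom F)) \<rparr>"

definition hn_id :: "('x, 'm) hfun \<Rightarrow> ('x, 'm) hnat"
  where "hn_id F = hn_map F F (\<lambda>x. Idn (FCod F) (FO F x))"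

definition two_Hilb ::
    "(('x, 'm) hfun \<Rightarrow> ('x, 'm) hfun) \<Rightarrow> (('x, 'm) hfun \<Rightarrow> ('x, 'm) hnat) \<Rightarrow>
      (('x, 'm) hfun \<Rightarrow> ('x, 'm) hnat) \<Rightarrow>
      (('x, 'm) hfun, ('x, 'm) hnat, ('x, 'm) twohilb) threehilb"
  where "two_Hilb V ev coev =
    \<lparr> Obj = {F. dagger_functor F},
      Arr = {\<eta>. nat_trans \<eta>},
      Dom = NDom,
      Cod = NCod,
      Idn = hn_id,
      Cmp = (\<lambda>\<theta> \<eta>. hn_map (NDom \<eta>) (NCod \<theta>)
        (\<lambda>x. NC \<theta> x \<cdot>\<^bsub>FCod (NDom \<eta>)\<^esub> NC \<eta> x)),
      Zer = (\<lambda>F G. hn_map F G (\<lambda>x. Zer (FCod F) (FO F x) (FO G x))),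
      Add = (\<lambda>\<eta> \<theta>. hn_map (NDom \<eta>) (NCod \<eta>)
        (\<lambda>x. NC \<eta> x \<oplus>\<^bsub>FCod (NDom \<eta>)\<^esub> NC \<theta> x)),
      Scl = (\<lambda>r \<eta>. hn_map (NDom \<eta>) (NCod \<eta>)
        (\<lambda>x. r \<odot>\<^bsub>FCod (NDom \<eta>)\<^esub> NC \<eta> x)),
      Dag = (\<lambda>\<eta>. hn_map (NCod \<eta>) (NDom \<eta>)
        (\<lambda>x. Dag (FCod (NDom \<eta>)) (NC \<eta> x))),
      Ob0 = {A. two_hilbert A},
      Src = FDom,
      Trg = FCod,
      One = hf_id,
      Ten1 = hf_comp,
      Ten2 = (\<lambda>\<eta> \<theta>. hn_map (hf_comp (NDom \<eta>) (NDom \<theta>)) (hf_comp (NCod \<eta>) (NCod \<theta>))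
        (\<lambda>x. NC \<theta> (FO (NCod \<eta>) x) \<cdot>\<^bsub>FCod (NDom \<theta>)\<^esub> FM (NDom \<theta>) (NC \<eta> x))),
      Asc = (\<lambda>F G H. hn_id (hf_comp F (hf_comp G H))),
      Lun = hn_id,
      Run = hn_id,
      Vee = V,
      Ev = ev,
      Coev = coev,
      Psi = (\<lambda>A \<eta>. \<Sum>a \<in> Irr A. Tr A a (Idn A a) * Tr A a (NC \<eta> a)) \<rparr>"


section \<open>Representable 2-functors\<close>

text \<open>The hom category from \<open>a\<close> to \<open>b\<close> with the traces given by the spherical weight.\<close>

definition hom_hilb :: "('x, 'm, 'o) threehilb \<Rightarrow> 'o \<Rightarrow> 'o \<Rightarrow> ('x, 'm) twohilb"
  where "hom_hilb X a b = dcat.extend (hom_cat X a b) (twohilb.fields (trace_left X))"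

definition lact :: "('x, 'm, 'o) threehilb \<Rightarrow> 'o \<Rightarrow> 'x \<Rightarrow> ('x, 'm) hfun"
  where "lact X c y =
    \<lparr> FDom = hom_hilb X (Trg X y) c, FCod = hom_hilb X (Src X y) c,
      FO = (\<lambda>w \<in> hom1 X (Trg X y) c. y \<otimes> w),
      FM = (\<lambda>f \<in> Arr (hom_cat X (Trg X y) c). \<i>\<d> y \<star> f) \<rparr>"
  for X (structure)

definition ract :: "('x, 'm, 'o) threehilb \<Rightarrow> 'o \<Rightarrow> 'x \<Rightarrow> ('x, 'm) hfun"
  where "ract X a z =
    \<lparr> FDom = hom_hilb X a (Src X z), FCod = hom_hilb X a (Trg X z),
      FO = (\<lambda>w \<in> hom1 X a (Src X z). w \<otimes> z),
      FM = (\<lambda>f \<in> Arr (hom_cat X a (Src X z)). f \<star> \<i>\<d> z) \<rparr>"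
  for X (structure)

text \<open>
  For \<open>n : 1 \<Rightarrow> p \<otimes> q\<close> and \<open>e : p \<otimes> q \<Rightarrow> 1\<close>, the transformations with components
  \<open>w \<Rightarrow> p \<otimes> (q \<otimes> w)\<close> and \<open>p \<otimes> (q \<otimes> w) \<Rightarrow> w\<close>.
\<close>

definition lact_unit ::
    "('x, 'm, 'o) threehilb \<Rightarrow> 'o \<Rightarrow> 'x \<Rightarrow> 'x \<Rightarrow> 'm \<Rightarrow> ('x, 'm) hnat"
  where "lact_unit X c p q n =
    hn_map (hf_id (hom_hilb X (Src X p) c)) (hf_comp (lact X c q) (lact X c p))
      (\<lambda>w. Asc X p q w \<cdot> (n \<star> \<i>\<d> w) \<cdot> (Lun X w)\<dagger>)"
  for X (structure)

definition lact_counit ::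
    "('x, 'm, 'o) threehilb \<Rightarrow> 'o \<Rightarrow> 'x \<Rightarrow> 'x \<Rightarrow> 'm \<Rightarrow> ('x, 'm) hnat"
  where "lact_counit X c p q e =
    hn_map (hf_comp (lact X c q) (lact X c p)) (hf_id (hom_hilb X (Src X p) c))
      (\<lambda>w. Lun X w \<cdot> (e \<star> \<i>\<d> w) \<cdot> (Asc X p q w)\<dagger>)"
  for X (structure)

text \<open>Likewise \<open>w \<Rightarrow> (w \<otimes> p) \<otimes> q\<close> and \<open>(w \<otimes> p) \<otimes> q \<Rightarrow> w\<close>.\<close>

definition ract_unit ::
    "('x, 'm, 'o) threehilb \<Rightarrow> 'o \<Rightarrow> 'x \<Rightarrow> 'x \<Rightarrow> 'm \<Rightarrow> ('x, 'm) hnat"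
  where "ract_unit X a p q n =
    hn_map (hf_id (hom_hilb X a (Src X p))) (hf_comp (ract X a p) (ract X a q))
      (\<lambda>w. (Asc X w p q)\<dagger> \<cdot> (\<i>\<d> w \<star> n) \<cdot> (Run X w)\<dagger>)"
  for X (structure)

definition ract_counit ::
    "('x, 'm, 'o) threehilb \<Rightarrow> 'o \<Rightarrow> 'x \<Rightarrow> 'x \<Rightarrow> 'm \<Rightarrow> ('x, 'm) hnat"
  where "ract_counit X a p q e =
    hn_map (hf_comp (ract X a p) (ract X a q)) (hf_id (hom_hilb X a (Src X p)))
      (\<lambda>w. Run X w \<cdot> (\<i>\<d> w \<star> e) \<cdot> Asc X w p q)"
  for X (structure)

text \<open>The 2-functor represented by \<open>c\<close> on the 1-opposite, sending \<open>y\<close> to \<open>y \<otimes> -\<close>.\<close>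

definition hom_into ::
    "('x, 'm, 'o) threehilb \<Rightarrow> 'o \<Rightarrow>
      ('x, 'm, 'o, ('x, 'm) hfun, ('x, 'm) hnat, ('x, 'm) twohilb) twofun"
  where "hom_into X c =
    \<lparr> F0 = (\<lambda>a. hom_hilb X a c),
      F1 = lact X c,
      F2 = (\<lambda>f. hn_map (lact X c (Dom X f)) (lact X c (Cod X f)) (\<lambda>w. f \<star> \<i>\<d> w)),
      Fmul = (\<lambda>x y. hn_map (hf_comp (lact X c x) (lact X c y)) (lact X c (y \<otimes> x))
        (\<lambda>w. (Asc X y x w)\<dagger>)),
      Funi = (\<lambda>a. hn_map (hf_id (hom_hilb X a c)) (lact X c (One X a)) (\<lambda>w. (Lun X w)\<dagger>)) \<rparr>"
  for X (structure)

definition hom_from ::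
    "('x, 'm, 'o) threehilb \<Rightarrow> 'o \<Rightarrow>
      ('x, 'm, 'o, ('x, 'm) hfun, ('x, 'm) hnat, ('x, 'm) twohilb) twofun"
  where "hom_from X a =
    \<lparr> F0 = (\<lambda>b. hom_hilb X a b),
      F1 = ract X a,
      F2 = (\<lambda>f. hn_map (ract X a (Dom X f)) (ract X a (Cod X f)) (\<lambda>w. \<i>\<d> w \<star> f)),
      Fmul = (\<lambda>x y. hn_map (hf_comp (ract X a x) (ract X a y)) (ract X a (x \<otimes> y))
        (\<lambda>w. Asc X w x y)),
      Funi = (\<lambda>b. hn_map (hf_id (hom_hilb X a b)) (ract X a (One X b)) (\<lambda>w. (Run X w)\<dagger>)) \<rparr>"
  for X (structure)

end

theory Submission
  imports Defs
begin

text \<open>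
  The inner product on a hom space of a 2-Hilbert space is \<open>Tr (f\<^sup>\<dagger> g)\<close>.  Hence the mates
  \<open>f \<mapsto> G(f) \<eta>\<close> of an adjunction between dagger functors \<open>F\<close> and \<open>G\<close> are isometric exactly if
  \<open>Tr (\<eta>\<^sup>\<dagger> G(h) \<eta>) = Tr h\<close> for all endomorphisms \<open>h\<close> of objects \<open>F a\<close>.  This is how the locale
  \<open>traced_adjunction\<close> describes unitary adjunctions.

  For the functors \<open>y \<otimes> -\<close> and \<open>y\<^sup>\<or> \<otimes> -\<close> the triangle identities are the zig-zag equations of \<open>y\<close>,
  tensored with the object at hand (\<open>lact_zigzag_left\<close>, \<open>lact_zigzag_right\<close>; the versions for
  \<open>- \<otimes> z\<close> hold by passing to the 1-opposite).  The condition on traces says that closing the strand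
  \<open>y\<close> and then taking the trace on \<open>w\<close> gives the trace on \<open>y \<otimes> w\<close>.  For strands that are closed on the
  left this follows from the nested evaluation \<open>w\<^sup>\<or> \<otimes> y\<^sup>\<or> \<otimes> y \<otimes> w \<Rightarrow> 1\<close>, which may replace the chosen
  evaluation of \<open>y \<otimes> w\<close> because the unitary adjoint functor is unitarily monoidal
  (\<open>partial_trace_left\<close>).  For strands closed on the right it then follows by isotopy and
  sphericality (\<open>partial_trace_right\<close>).  The adjunction in the other direction consists of the adjoints
  of unit and counit (\<open>traced_adjunction_reverse\<close>).

  For these statements to make sense, the hom categories have to be 2-Hilbert spaces.  Finite
  semisimplicity is read off from the linking category of two objects, in which the hom category is
  a block (\<open>finitely_semisimple_hom_cat\<close>).  The trace is cyclic because 2-morphisms slide around the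
  loop (\<open>trace_left_commute\<close>), and it is faithful because a 2-morphism can be recovered from its bent
  version (\<open>trace_left_positive\<close>).

  Finally, that the 2-functors represented by an object preserve the unitary adjoint functor means
  that a canonical map between two unitary adjoints of the same functor is unitary.  Here both
  adjunctions express traces on one side by traces on the other side, so for the canonical map \<open>u\<close>
  the traces of \<open>k u\<^sup>\<dagger> u\<close> and of \<open>k\<close> agree for all \<open>k\<close>, and \<open>u\<^sup>\<dagger> u\<close> is the identity
  (\<open>comparison_isometry\<close>).
\<close>

section \<open>Calculus of 2-morphisms\<close>

text \<open>
  The laws of a 2-category are given for members of hom sets, so that using one of them means
  guessing its objects.  Restated with \<open>Dom\<close> and \<open>Cod\<close>, every typing condition becomes an equation
  that rewriting decides, and composites can be computed by simplification.  Composites are kept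
  nested to the right; a lemma whose name ends in \<open>_then\<close> is the form of an equation that applies
  in front of a remaining factor \<open>k\<close>.
\<close>

lemma mem_hom [simp]: "f \<in> hom C x y \<longleftrightarrow> f \<in> Arr C \<and> Dom C f = x \<and> Cod C f = y"
  by (simp add: hom_def)

lemma mem_hom1 [simp]: "x \<in> hom1 B a b \<longleftrightarrow> x \<in> Obj B \<and> Src B x = a \<and> Trg B x = b"
  by (simp add: hom1_def)

lemma hom_cat_sel [simp]:
  "Obj (hom_cat B a b) = hom1 B a b"
  "Arr (hom_cat B a b) = {f \<in> Arr B. Dom B f \<in> hom1 B a b}"
  "Dom (hom_cat B a b) = Dom B" "Cod (hom_cat B a b) = Cod B"
  "Idn (hom_cat B a b) = Idn B" "Cmp (hom_cat B a b) = Cmp B"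
  "Zer (hom_cat B a b) = Zer B" "Add (hom_cat B a b) = Add B"
  "Scl (hom_cat B a b) = Scl B" "Dag (hom_cat B a b) = Dag B"
  by (simp_all add: hom_cat_def)

context cstar_2category
begin

lemma src_obj [simp]: "x \<in> Obj B \<Longrightarrow> Src B x \<in> Ob0 B"
  and trg_obj [simp]: "x \<in> Obj B \<Longrightarrow> Trg B x \<in> Ob0 B"
  using src_trg by auto

lemma dom_obj [simp]: "f \<in> Arr B \<Longrightarrow> Dom B f \<in> Obj B"
  and cod_obj [simp]: "f \<in> Arr B \<Longrightarrow> Cod B f \<in> Obj B"
  and src_cod [simp]: "f \<in> Arr B \<Longrightarrow> Src B (Cod B f) = Src B (Dom B f)"
  and trg_cod [simp]: "f \<in> Arr B \<Longrightarrow> Trg B (Cod B f) = Trg B (Dom B f)"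
  using arr_parallel by auto

lemma lin_dagger_hom_cat:
  "a \<in> Ob0 B \<Longrightarrow> b \<in> Ob0 B \<Longrightarrow> lin_dagger_category (hom_cat B a b)"
  using hom_cat_cstar cstar_category.axioms(1) by blast

lemma idn_arr [simp]:
  assumes "x \<in> Obj B"
  shows "\<i>\<d> x \<in> Arr B" "Dom B (\<i>\<d> x) = x" "Cod B (\<i>\<d> x) = x"
  using lin_dagger_category.id_hom[OF lin_dagger_hom_cat[of "Src B x" "Trg B x"], of x] assms by auto

lemma cmp_arr [simp]:
  assumes "f \<in> Arr B" "g \<in> Arr B" "Dom B g = Cod B f"
  shows "g \<cdot> f \<in> Arr B" "Dom B (g \<cdot> f) = Dom B f" "Cod B (g \<cdot> f) = Cod B g"
  using lin_dagger_category.comp_hom[OF lin_dagger_hom_cat[of "Src B (Dom B f)" "Trg B (Dom B f)"],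
      of f "Dom B f" "Cod B f" g "Cod B g"] assms by auto

lemma assoc [simp]:
  assumes "f \<in> Arr B" "g \<in> Arr B" "h \<in> Arr B" "Dom B g = Cod B f" "Dom B h = Cod B g"
  shows "(h \<cdot> g) \<cdot> f = h \<cdot> g \<cdot> f"
  using lin_dagger_category.comp_assoc[OF lin_dagger_hom_cat[of "Src B (Dom B f)" "Trg B (Dom B f)"],
      of f "Dom B f" "Cod B f" g "Cod B g" h "Cod B h"] assms by auto

lemma id_left [simp]: "f \<in> Arr B \<Longrightarrow> Cod B f = y \<Longrightarrow> \<i>\<d> y \<cdot> f = f"
  using lin_dagger_category.id_left[OF lin_dagger_hom_cat[of "Src B (Dom B f)" "Trg B (Dom B f)"],
      of f "Dom B f" "Cod B f"] by auto

lemma id_right [simp]: "f \<in> Arr B \<Longrightarrow> Dom B f = y \<Longrightarrow> f \<cdot> \<i>\<d> y = f"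
  using lin_dagger_category.id_right[OF lin_dagger_hom_cat[of "Src B (Dom B f)" "Trg B (Dom B f)"],
      of f "Dom B f" "Cod B f"] by auto

lemma zer_arr [simp]:
  assumes "x \<in> Obj B" "y \<in> Obj B" "Src B x = Src B y" "Trg B x = Trg B y"
  shows "Zer B x y \<in> Arr B" "Dom B (Zer B x y) = x" "Cod B (Zer B x y) = y"
  using lin_dagger_category.zero_hom[OF lin_dagger_hom_cat[of "Src B x" "Trg B x"], of x y] assms by auto

lemma add_arr [simp]:
  assumes "f \<in> Arr B" "g \<in> Arr B" "Dom B g = Dom B f" "Cod B g = Cod B f"
  shows "f \<oplus> g \<in> Arr B" "Dom B (f \<oplus> g) = Dom B f" "Cod B (f \<oplus> g) = Cod B f"
  using lin_dagger_category.add_hom[OF lin_dagger_hom_cat[of "Src B (Dom B f)" "Trg B (Dom B f)"],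
      of f "Dom B f" "Cod B f" g] assms by auto

lemma scl_arr [simp]:
  assumes "f \<in> Arr B"
  shows "r \<odot> f \<in> Arr B" "Dom B (r \<odot> f) = Dom B f" "Cod B (r \<odot> f) = Cod B f"
  using lin_dagger_category.scl_hom[OF lin_dagger_hom_cat[of "Src B (Dom B f)" "Trg B (Dom B f)"],
      of f "Dom B f" "Cod B f" r] assms by auto

lemma dag_arr [simp]:
  assumes "f \<in> Arr B"
  shows "f\<dagger> \<in> Arr B" "Dom B (f\<dagger>) = Cod B f" "Cod B (f\<dagger>) = Dom B f" "(f\<dagger>)\<dagger> = f"
  using lin_dagger_category.dag_hom[OF lin_dagger_hom_cat[of "Src B (Dom B f)" "Trg B (Dom B f)"],
      of f "Dom B f" "Cod B f"]
   lin_dagger_category.dag_dag[OF lin_dagger_hom_cat[of "Src B (Dom B f)" "Trg B (Dom B f)"],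
      of f "Dom B f" "Cod B f"] assms by auto

lemma dag_cmp [simp]:
  assumes "f \<in> Arr B" "g \<in> Arr B" "Dom B g = Cod B f"
  shows "(g \<cdot> f)\<dagger> = f\<dagger> \<cdot> g\<dagger>"
  using lin_dagger_category.dag_comp[OF lin_dagger_hom_cat[of "Src B (Dom B f)" "Trg B (Dom B f)"],
      of f "Dom B f" "Cod B f" g "Cod B g"] assms by auto

lemma dag_id [simp]:
  assumes "x \<in> Obj B"
  shows "(\<i>\<d> x)\<dagger> = \<i>\<d> x"
proof -
  have "(\<i>\<d> x \<cdot> (\<i>\<d> x)\<dagger>)\<dagger> = ((\<i>\<d> x)\<dagger>)\<dagger> \<cdot> (\<i>\<d> x)\<dagger>"
    using assms by (intro dag_cmp) simp_all
  then show ?thesis using assms by simp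
qed

lemma one_obj [simp]:
  assumes "a \<in> Ob0 B"
  shows "One B a \<in> Obj B" "Src B (One B a) = a" "Trg B (One B a) = a"
  using one_hom1[OF assms] by auto

lemma ten1_obj [simp]:
  assumes "x \<in> Obj B" "y \<in> Obj B" "Trg B x = Src B y"
  shows "x \<otimes> y \<in> Obj B" "Src B (x \<otimes> y) = Src B x" "Trg B (x \<otimes> y) = Trg B y"
  using ten_hom1[of x _ _ y] assms by auto

lemma ten2_arr [simp]:
  assumes "f \<in> Arr B" "g \<in> Arr B" "Trg B (Dom B f) = Src B (Dom B g)"
  shows "f \<star> g \<in> Arr B" "Dom B (f \<star> g) = Dom B f \<otimes> Dom B g" "Cod B (f \<star> g) = Cod B f \<otimes> Cod B g"
  using ten_hom[of f "Dom B f" "Cod B f" g "Dom B g" "Cod B g"] assms by auto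

lemma ten2_id [simp]:
  assumes "x \<in> Obj B" "y \<in> Obj B" "Trg B x = Src B y"
  shows "\<i>\<d> x \<star> \<i>\<d> y = \<i>\<d> (x \<otimes> y)"
  using ten_id assms by auto

lemma ten2_dag [simp]:
  assumes "f \<in> Arr B" "g \<in> Arr B" "Trg B (Dom B f) = Src B (Dom B g)"
  shows "(f \<star> g)\<dagger> = f\<dagger> \<star> g\<dagger>"
  using ten_dag[of f "Dom B f" "Cod B f" g "Dom B g" "Cod B g"] assms by auto

lemma exchange:
  assumes "f \<in> Arr B" "g \<in> Arr B" "f' \<in> Arr B" "g' \<in> Arr B" "Dom B f' = Cod B f" "Dom B g' = Cod B g"
    "Trg B (Dom B f) = Src B (Dom B g)"
  shows "(f' \<star> g') \<cdot> (f \<star> g) = (f' \<cdot> f) \<star> (g' \<cdot> g)"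
  using interchange[of f "Dom B f" "Cod B f" f' "Cod B f'" g "Dom B g" "Cod B g" g' "Cod B g'"] assms by auto

lemma exchange_then:
  assumes "f \<in> Arr B" "g \<in> Arr B" "f' \<in> Arr B" "g' \<in> Arr B" "Dom B f' = Cod B f" "Dom B g' = Cod B g"
    "Trg B (Dom B f) = Src B (Dom B g)" "k \<in> Arr B" "Cod B k = Dom B f \<otimes> Dom B g"
  shows "(f' \<star> g') \<cdot> (f \<star> g) \<cdot> k = ((f' \<cdot> f) \<star> (g' \<cdot> g)) \<cdot> k"
  using assms by (simp add: exchange flip: assoc)

lemma asc_arr [simp]:
  assumes "x \<in> Obj B" "y \<in> Obj B" "z \<in> Obj B" "Trg B x = Src B y" "Trg B y = Src B z"
  shows "Asc B x y z \<in> Arr B" "Dom B (Asc B x y z) = (x \<otimes> y) \<otimes> z"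
    "Cod B (Asc B x y z) = x \<otimes> y \<otimes> z"
    "(Asc B x y z)\<dagger> \<cdot> Asc B x y z = \<i>\<d> ((x \<otimes> y) \<otimes> z)"
    "Asc B x y z \<cdot> (Asc B x y z)\<dagger> = \<i>\<d> (x \<otimes> y \<otimes> z)"
  using asc_hom[of x _ _ y _ z] asc_unitary[of x _ _ y _ z] assms by (auto simp: unitary_def)

lemma asc_cancel [simp]:
  assumes "x \<in> Obj B" "y \<in> Obj B" "z \<in> Obj B" "Trg B x = Src B y" "Trg B y = Src B z" "k \<in> Arr B"
  shows "Cod B k = (x \<otimes> y) \<otimes> z \<Longrightarrow> (Asc B x y z)\<dagger> \<cdot> Asc B x y z \<cdot> k = k"
    "Cod B k = x \<otimes> y \<otimes> z \<Longrightarrow> Asc B x y z \<cdot> (Asc B x y z)\<dagger> \<cdot> k = k"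
  using assms by (simp_all flip: assoc)

lemma lun_arr [simp]:
  assumes "x \<in> Obj B"
  shows "Lun B x \<in> Arr B" "Dom B (Lun B x) = One B (Src B x) \<otimes> x" "Cod B (Lun B x) = x"
    "(Lun B x)\<dagger> \<cdot> Lun B x = \<i>\<d> (One B (Src B x) \<otimes> x)" "Lun B x \<cdot> (Lun B x)\<dagger> = \<i>\<d> x"
  using lun_hom[of x] lun_unitary[of x] assms by (auto simp: unitary_def)

lemma run_arr [simp]:
  assumes "x \<in> Obj B"
  shows "Run B x \<in> Arr B" "Dom B (Run B x) = x \<otimes> One B (Trg B x)" "Cod B (Run B x) = x"
    "(Run B x)\<dagger> \<cdot> Run B x = \<i>\<d> (x \<otimes> One B (Trg B x))" "Run B x \<cdot> (Run B x)\<dagger> = \<i>\<d> x"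
  using run_hom[of x] run_unitary[of x] assms by (auto simp: unitary_def)

lemma lun_cancel [simp]:
  assumes "x \<in> Obj B" "k \<in> Arr B"
  shows "Cod B k = One B (Src B x) \<otimes> x \<Longrightarrow> (Lun B x)\<dagger> \<cdot> Lun B x \<cdot> k = k"
    "Cod B k = x \<Longrightarrow> Lun B x \<cdot> (Lun B x)\<dagger> \<cdot> k = k"
  using assms by (simp_all flip: assoc)

lemma run_cancel [simp]:
  assumes "x \<in> Obj B" "k \<in> Arr B"
  shows "Cod B k = x \<otimes> One B (Trg B x) \<Longrightarrow> (Run B x)\<dagger> \<cdot> Run B x \<cdot> k = k"
    "Cod B k = x \<Longrightarrow> Run B x \<cdot> (Run B x)\<dagger> \<cdot> k = k"
  using assms by (simp_all flip: assoc)

lemma asc_nat: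
  assumes "f \<in> Arr B" "g \<in> Arr B" "h \<in> Arr B"
    "Trg B (Dom B f) = Src B (Dom B g)" "Trg B (Dom B g) = Src B (Dom B h)"
    "x' = Cod B f" "y' = Cod B g" "z' = Cod B h"
  shows "Asc B x' y' z' \<cdot> ((f \<star> g) \<star> h) = (f \<star> g \<star> h) \<cdot> Asc B (Dom B f) (Dom B g) (Dom B h)"
  using asc_natural[of f "Dom B f" "Cod B f" g "Dom B g" "Cod B g" h "Dom B h" "Cod B h"] assms
  by auto

lemma lun_nat:
  assumes "f \<in> Arr B"
  shows "Lun B (Cod B f) \<cdot> (\<i>\<d> (One B (Src B (Dom B f))) \<star> f) = f \<cdot> Lun B (Dom B f)"
  using lun_natural[of f "Dom B f" "Cod B f"] assms by auto

lemma run_nat: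
  assumes "f \<in> Arr B"
  shows "Run B (Cod B f) \<cdot> (f \<star> \<i>\<d> (One B (Trg B (Dom B f)))) = f \<cdot> Run B (Dom B f)"
  using run_natural[of f "Dom B f" "Cod B f"] assms by auto

lemma cmp_add_right [simp]:
  assumes "f \<in> Arr B" "g \<in> Arr B" "h \<in> Arr B" "Dom B h = Cod B f" "Dom B g = Dom B f" "Cod B g = Cod B f"
  shows "h \<cdot> (f \<oplus> g) = h \<cdot> f \<oplus> h \<cdot> g"
proof -
  interpret h: lin_dagger_category "hom_cat B (Src B (Dom B f)) (Trg B (Dom B f))"
    using assms by (intro lin_dagger_hom_cat) simp_all
  show ?thesis using h.comp_add_right[of f "Dom B f" "Cod B f" g h "Cod B h"] assms by simp
qed

lemma cmp_add_left [simp]: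
  assumes "f \<in> Arr B" "g \<in> Arr B" "h \<in> Arr B" "Dom B h = Cod B f" "Dom B g = Cod B f" "Cod B g = Cod B h"
  shows "(h \<oplus> g) \<cdot> f = h \<cdot> f \<oplus> g \<cdot> f"
proof -
  interpret h: lin_dagger_category "hom_cat B (Src B (Dom B f)) (Trg B (Dom B f))"
    using assms by (intro lin_dagger_hom_cat) simp_all
  show ?thesis using h.comp_add_left[of f "Dom B f" "Cod B f" h "Cod B h" g] assms by simp
qed

lemma cmp_scl [simp]:
  assumes "f \<in> Arr B" "h \<in> Arr B" "Dom B h = Cod B f"
  shows "h \<cdot> (r \<odot> f) = r \<odot> (h \<cdot> f)" "(r \<odot> h) \<cdot> f = r \<odot> (h \<cdot> f)"
proof -
  interpret h: lin_dagger_category "hom_cat B (Src B (Dom B f)) (Trg B (Dom B f))"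
    using assms by (intro lin_dagger_hom_cat) simp_all
  show "h \<cdot> (r \<odot> f) = r \<odot> (h \<cdot> f)"
    using h.comp_scl_right[of f "Dom B f" "Cod B f" h "Cod B h"] assms by simp
  show "(r \<odot> h) \<cdot> f = r \<odot> (h \<cdot> f)"
    using h.comp_scl_left[of f "Dom B f" "Cod B f" h "Cod B h"] assms by simp
qed

lemma ten2_add_left [simp]:
  assumes "f \<in> Arr B" "g \<in> Arr B" "h \<in> Arr B" "Dom B g = Dom B f" "Cod B g = Cod B f" "Trg B (Dom B f) = Src B (Dom B h)"
  shows "(f \<oplus> g) \<star> h = (f \<star> h) \<oplus> (g \<star> h)"
  using assms by (intro ten_add_left[of f "Dom B f" "Cod B f" g h "Dom B h" "Cod B h"]) simp_all

lemma ten2_add_right [simp]: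
  assumes "f \<in> Arr B" "g \<in> Arr B" "h \<in> Arr B" "Dom B g = Dom B f" "Cod B g = Cod B f" "Trg B (Dom B h) = Src B (Dom B f)"
  shows "h \<star> (f \<oplus> g) = (h \<star> f) \<oplus> (h \<star> g)"
  using assms by (intro ten_add_right[of h "Dom B h" "Cod B h" f "Dom B f" "Cod B f" g]) simp_all

lemma ten2_scl [simp]:
  assumes "f \<in> Arr B" "h \<in> Arr B" "Trg B (Dom B f) = Src B (Dom B h)"
  shows "(r \<odot> f) \<star> h = r \<odot> (f \<star> h)" "f \<star> (r \<odot> h) = r \<odot> (f \<star> h)"
  using assms by (intro ten_scl_left[of f "Dom B f" "Cod B f" h "Dom B h" "Cod B h"]
    ten_scl_right[of f "Dom B f" "Cod B f" h "Dom B h" "Cod B h"]; simp)+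

text \<open>
  Zero 2-morphisms are scalar multiples by \<open>0\<close>, so linearity shows that they absorb both
  compositions.
\<close>

lemma zero_scl:
  assumes "f \<in> Arr B"
  shows "0 \<odot> f = Zer B (Dom B f) (Cod B f)"
proof -
  interpret h: lin_dagger_category "hom_cat B (Src B (Dom B f)) (Trg B (Dom B f))"
    using assms by (intro lin_dagger_hom_cat) simp_all
  have "(1 + - 1) \<odot> f = f \<oplus> (- 1) \<odot> f"
    using assms h.scl_add_left[of f "Dom B f" "Cod B f" 1 "- 1"] h.scl_one[of f "Dom B f" "Cod B f"] by simp
  then show ?thesis using assms h.add_minus[of f "Dom B f" "Cod B f"] by simp
qed

lemma zero_cmp:
  assumes "f \<in> Arr B" "y \<in> Obj B" "Cod B f = x" "Src B x = Src B y" "Trg B x = Trg B y"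
  shows "Zer B x y \<cdot> f = Zer B (Dom B f) y"
proof -
  have x: "x \<in> Obj B" using assms by auto
  have "Zer B x y \<cdot> f = (0 \<odot> Zer B x y) \<cdot> f" using assms x by (simp add: zero_scl)
  also have "\<dots> = 0 \<odot> (Zer B x y \<cdot> f)" using assms x by simp
  also have "\<dots> = Zer B (Dom B f) y" using assms x by (simp add: zero_scl)
  finally show ?thesis .
qed

lemma cmp_zero:
  assumes "f \<in> Arr B" "x \<in> Obj B" "Dom B f = y" "Src B x = Src B y" "Trg B x = Trg B y"
  shows "f \<cdot> Zer B x y = Zer B x (Cod B f)"
proof -
  have y: "y \<in> Obj B" using assms by auto
  have "f \<cdot> Zer B x y = f \<cdot> (0 \<odot> Zer B x y)" using assms y by (simp add: zero_scl)
  also have "\<dots> = 0 \<odot> (f \<cdot> Zer B x y)" using assms y by simp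
  also have "\<dots> = Zer B x (Cod B f)" using assms y by (simp add: zero_scl)
  finally show ?thesis .
qed

lemma zero_ten2:
  assumes "f \<in> Arr B" "x \<in> Obj B" "y \<in> Obj B" "Trg B x = Src B (Dom B f)" "Src B x = Src B y" "Trg B x = Trg B y"
  shows "Zer B x y \<star> f = Zer B (x \<otimes> Dom B f) (y \<otimes> Cod B f)"
proof -
  have "Zer B x y \<star> f = (0 \<odot> Zer B x y) \<star> f" using assms by (simp add: zero_scl)
  also have "\<dots> = 0 \<odot> (Zer B x y \<star> f)" using assms by simp
  also have "\<dots> = Zer B (x \<otimes> Dom B f) (y \<otimes> Cod B f)" using assms by (simp add: zero_scl)
  finally show ?thesis .
qed

text \<open>
  Positivity lets an arbitrary \<open>f\<^sup>\<dagger> f\<close> be written with an endomorphism \<open>h\<close>, the only form on which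
  a faithful positive functional is assumed to be positive.
\<close>

lemma dag_positive:
  assumes "f \<in> Arr B"
  obtains h where "h \<in> Arr B" "Dom B h = Dom B f" "Cod B h = Dom B f" "f\<dagger> \<cdot> f = h\<dagger> \<cdot> h"
  using assms cstar_category.dag_positive[OF hom_cat_cstar[of "Src B (Dom B f)" "Trg B (Dom B f)"], of f "Dom B f" "Cod B f"]
  by auto

text \<open>By the \<open>C\<^sup>*\<close>-identity \<open>\<parallel>f\<^sup>\<dagger> f\<parallel> = \<parallel>f\<parallel>\<^sup>2\<close>.\<close>

lemma dag_cmp_zero:
  assumes "f \<in> Arr B" "f\<dagger> \<cdot> f = Zer B (Dom B f) (Dom B f)"
  shows "f = Zer B (Dom B f) (Cod B f)"
proof -
  let ?C = "hom_cat B (Src B (Dom B f)) (Trg B (Dom B f))"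
  obtain N where "cstar_norm ?C N"
    using assms cstar_category.ex_cstar_norm[OF hom_cat_cstar[of "Src B (Dom B f)" "Trg B (Dom B f)"]] by auto
  then have N: "\<And>x y g. x \<in> Obj ?C \<Longrightarrow> y \<in> Obj ?C \<Longrightarrow> g \<in> hom ?C x y \<Longrightarrow> N g = 0 \<longleftrightarrow> g = Zer B x y"
    "\<And>x y g. x \<in> Obj ?C \<Longrightarrow> y \<in> Obj ?C \<Longrightarrow> g \<in> hom ?C x y \<Longrightarrow> N (g\<dagger> \<cdot> g) = (N g)\<^sup>2"
    unfolding cstar_norm_def by (simp_all)
  have "N (f\<dagger> \<cdot> f) = 0" using assms N(1)[of "Dom B f" "Dom B f" "f\<dagger> \<cdot> f"] by simp
  then show ?thesis using assms N[of "Dom B f" "Cod B f" f] by simp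
qed

end

section \<open>Unit coherence and the 1-opposite\<close>

context cstar_2category
begin

lemma whisker_left:
  assumes "f \<in> Arr B" "g \<in> Arr B" "Dom B g = Cod B f" "x \<in> Obj B" "Trg B x = Src B (Dom B f)"
  shows "\<i>\<d> x \<star> (g \<cdot> f) = (\<i>\<d> x \<star> g) \<cdot> (\<i>\<d> x \<star> f)"
  using assms by (simp add: exchange)

lemma whisker_right:
  assumes "f \<in> Arr B" "g \<in> Arr B" "Dom B g = Cod B f" "x \<in> Obj B" "Trg B (Dom B f) = Src B x"
  shows "(g \<cdot> f) \<star> \<i>\<d> x = (g \<star> \<i>\<d> x) \<cdot> (f \<star> \<i>\<d> x)"
  using assms by (simp add: exchange)

lemma epi_cancel:
  assumes "f \<cdot> q = g \<cdot> q" "q \<cdot> q' = \<i>\<d> (Dom B f)" "f \<in> Arr B" "g \<in> Arr B" "q \<in> Arr B" "q' \<in> Arr B"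
    "Cod B q = Dom B f" "Dom B g = Dom B f" "Cod B q' = Dom B q"
  shows "f = g"
proof -
  have "f = (f \<cdot> q) \<cdot> q'" using assms(2-) by simp
  also have "\<dots> = (g \<cdot> q) \<cdot> q'" using assms(1) by (rule arg_cong)
  also have "\<dots> = g" using assms(2-) by simp
  finally show ?thesis .
qed

text \<open>
  The unitors make whiskering with a unit naturally isomorphic to the identity functor, hence
  faithful.
\<close>

lemma whisker_one_left_inj:
  assumes "\<i>\<d> (One B (Src B (Dom B f))) \<star> f = \<i>\<d> (One B (Src B (Dom B f))) \<star> g"
    "f \<in> Arr B" "g \<in> Arr B" "Dom B g = Dom B f" "Cod B g = Cod B f"
  shows "f = g"
  using assms lun_nat[of f] lun_nat[of g]
  by - (rule epi_cancel[of f "Lun B (Dom B f)" g "(Lun B (Dom B f))\<dagger>"]; simp)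

lemma whisker_one_right_inj:
  assumes "f \<star> \<i>\<d> (One B (Trg B (Dom B f))) = g \<star> \<i>\<d> (One B (Trg B (Dom B f)))"
    "f \<in> Arr B" "g \<in> Arr B" "Dom B g = Dom B f" "Cod B g = Cod B f"
  shows "f = g"
  using assms run_nat[of f] run_nat[of g]
  by - (rule epi_cancel[of f "Run B (Dom B f)" g "(Run B (Dom B f))\<dagger>"]; simp)

lemma pentagon_eq:
  assumes "w \<in> Obj B" "x \<in> Obj B" "y \<in> Obj B" "z \<in> Obj B"
   "Trg B w = Src B x" "Trg B x = Src B y" "Trg B y = Src B z"
  shows "(\<i>\<d> w \<star> Asc B x y z) \<cdot> Asc B w (x \<otimes> y) z \<cdot> (Asc B w x y \<star> \<i>\<d> z)
      = Asc B w x (y \<otimes> z) \<cdot> Asc B (w \<otimes> x) y z"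
  using pentagon[of w _ _ x _ y _ z] assms by simp

lemma triangle_eq:
  assumes "x \<in> Obj B" "y \<in> Obj B" "Trg B x = Src B y"
  shows "(\<i>\<d> x \<star> Lun B y) \<cdot> Asc B x (One B (Src B y)) y = Run B x \<star> \<i>\<d> y"
  using triangle[of x _ _ y] assms by simp

lemma triangle_then:
  assumes "x \<in> Obj B" "y \<in> Obj B" "Trg B x = Src B y" "k \<in> Arr B" "Cod B k = (x \<otimes> One B (Src B y)) \<otimes> y"
  shows "(\<i>\<d> x \<star> Lun B y) \<cdot> Asc B x (One B (Src B y)) y \<cdot> k = (Run B x \<star> \<i>\<d> y) \<cdot> k"
  using assms by (simp flip: triangle_eq)

lemma asc_nat_then:
  assumes "f \<in> Arr B" "g \<in> Arr B" "h \<in> Arr B"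
    "Trg B (Dom B f) = Src B (Dom B g)" "Trg B (Dom B g) = Src B (Dom B h)"
    "k \<in> Arr B" "Cod B k = (Dom B f \<otimes> Dom B g) \<otimes> Dom B h"
    "x' = Cod B f" "y' = Cod B g" "z' = Cod B h"
  shows "Asc B x' y' z' \<cdot> ((f \<star> g) \<star> h) \<cdot> k = (f \<star> g \<star> h) \<cdot> Asc B (Dom B f) (Dom B g) (Dom B h) \<cdot> k"
  using assms asc_nat[of f g h x' y' z'] by (simp flip: assoc)

text \<open>
  Kelly's redundancy of one of the unit axioms.  Since whiskering with the unit is faithful, it is
  enough to compare both sides after whiskering.  Precomposed with the isomorphism \<open>?q\<close>, which is
  two of the five sides of a pentagon, both become equal: the left side by the pentagon and a
  triangle at \<open>x \<otimes> y\<close>, the right side by naturality and a triangle at \<open>x\<close>.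
\<close>

lemma lun_ten:
  assumes "x \<in> Obj B" "y \<in> Obj B" "Trg B x = Src B y"
  shows "Lun B (x \<otimes> y) \<cdot> Asc B (One B (Src B x)) x y = Lun B x \<star> \<i>\<d> y"
proof -
  let ?I = "One B (Src B x)"
  let ?q = "Asc B ?I (?I \<otimes> x) y \<cdot> (Asc B ?I ?I x \<star> \<i>\<d> y)"
  have 1: "(\<i>\<d> ?I \<star> (Lun B (x \<otimes> y) \<cdot> Asc B ?I x y)) \<cdot> ?q = (Run B ?I \<star> \<i>\<d> x \<star> \<i>\<d> y) \<cdot> Asc B (?I \<otimes> ?I) x y"
    using assms arg_cong[OF pentagon_eq[of ?I ?I x y], of "\<lambda>t. (\<i>\<d> ?I \<star> Lun B (x \<otimes> y)) \<cdot> t"] triangle_eq[of ?I "x \<otimes> y"]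
      triangle_then[of ?I "x \<otimes> y" "Asc B (?I \<otimes> ?I) x y"]
    by (simp add: whisker_left)
  have "(\<i>\<d> ?I \<star> (Lun B x \<star> \<i>\<d> y)) \<cdot> ?q = Asc B ?I x y \<cdot> (((\<i>\<d> ?I \<star> Lun B x) \<cdot> Asc B ?I ?I x) \<star> \<i>\<d> y)"
    using assms asc_nat_then[of "\<i>\<d> ?I" "Lun B x" "\<i>\<d> y" "Asc B ?I ?I x \<star> \<i>\<d> y" ?I x y]
    by (simp add: whisker_right)
  also have "\<dots> = (Run B ?I \<star> \<i>\<d> x \<star> \<i>\<d> y) \<cdot> Asc B (?I \<otimes> ?I) x y"
    using assms triangle_eq[of ?I x] asc_nat[of "Run B ?I" "\<i>\<d> x" "\<i>\<d> y" ?I x y] by simp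
  finally have 2: "(\<i>\<d> ?I \<star> (Lun B (x \<otimes> y) \<cdot> Asc B ?I x y)) \<cdot> ?q = (\<i>\<d> ?I \<star> (Lun B x \<star> \<i>\<d> y)) \<cdot> ?q"
    using 1 by simp
  have 3: "?q \<cdot> ?q\<dagger> = \<i>\<d> (?I \<otimes> (?I \<otimes> x) \<otimes> y)"
    using assms by (simp add: exchange_then)
  have "\<i>\<d> ?I \<star> (Lun B (x \<otimes> y) \<cdot> Asc B ?I x y) = \<i>\<d> ?I \<star> (Lun B x \<star> \<i>\<d> y)"
  proof (rule epi_cancel[OF 2, of "?q\<dagger>"])
    show "?q \<cdot> ?q\<dagger> = \<i>\<d> (Dom B (\<i>\<d> ?I \<star> (Lun B (x \<otimes> y) \<cdot> Asc B ?I x y)))"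
      unfolding 3 using assms by simp
  qed (use assms in simp_all)
  then show ?thesis
    using assms by - (rule whisker_one_left_inj, simp_all)
qed

text \<open>
  Both become equal after tensoring with the unit: the triangle gives one side and \<open>lun_ten\<close> the
  other.
\<close>

lemma lun_one_run_one: "a \<in> Ob0 B \<Longrightarrow> Lun B (One B a) = Run B (One B a)"
proof (rule whisker_one_right_inj)
  assume a: "a \<in> Ob0 B"
  let ?I = "One B a"
  have "Lun B (?I \<otimes> ?I) = \<i>\<d> ?I \<star> Lun B ?I"
  proof -
    have "Lun B ?I \<cdot> (\<i>\<d> ?I \<star> Lun B ?I) = Lun B ?I \<cdot> Lun B (?I \<otimes> ?I)"
      using a lun_nat[of "Lun B ?I"] by simp
    then have "(Lun B ?I)\<dagger> \<cdot> Lun B ?I \<cdot> (\<i>\<d> ?I \<star> Lun B ?I) = (Lun B ?I)\<dagger> \<cdot> Lun B ?I \<cdot> Lun B (?I \<otimes> ?I)"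
      by simp
    then show ?thesis using a by simp
  qed
  then show "Lun B ?I \<star> \<i>\<d> (One B (Trg B (Dom B (Lun B ?I)))) = Run B ?I \<star> \<i>\<d> (One B (Trg B (Dom B (Lun B ?I))))"
    using a lun_ten[of ?I ?I] triangle_eq[of ?I ?I] by simp
qed simp_all

end

lemma op1_sel [simp]:
  "Obj (op1 X) = Obj X" "Arr (op1 X) = Arr X" "Dom (op1 X) = Dom X" "Cod (op1 X) = Cod X"
  "Idn (op1 X) = Idn X" "Cmp (op1 X) = Cmp X" "Zer (op1 X) = Zer X" "Add (op1 X) = Add X"
  "Scl (op1 X) = Scl X" "Dag (op1 X) = Dag X" "Ob0 (op1 X) = Ob0 X" "Src (op1 X) = Trg X"
  "Trg (op1 X) = Src X" "One (op1 X) = One X" "Ten1 (op1 X) x y = Ten1 X y x" "Ten2 (op1 X) f g = Ten2 X g f"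
  "Asc (op1 X) x y z = Dag X (Asc X z y x)" "Lun (op1 X) = Run X" "Run (op1 X) = Lun X"
  "Vee (op1 X) = Vee X" "Ev (op1 X) x = Dag X (Coev X x)" "Coev (op1 X) x = Dag X (Ev X x)" "Psi (op1 X) = Psi X"
  by (simp_all add: op1_def)

lemma hom_cat_op1: "hom_cat (op1 X) a b = hom_cat X b a"
  by (auto simp: hom_cat_def)

text \<open>
  Reversing 1-morphisms exchanges tensoring on the left with tensoring on the right, so that every
  coherence statement proved for one side holds for the other.
\<close>

lemma cstar_2category_op1:
  fixes X :: "('x, 'm, 'o) threehilb" (structure)
  assumes "cstar_2category X"
  shows "cstar_2category (op1 X)"
proof -
  interpret cstar_2category X by fact
  show ?thesis
  proof (rule cstar_2category.intro, goal_cases)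
    case (16 f x x' g y y' h z z')
    have "Dag X (Asc X z' y' x') \<cdot>\<^bsub>X\<^esub> (Asc X z' y' x' \<cdot>\<^bsub>X\<^esub> ((h \<star>\<^bsub>X\<^esub> g) \<star>\<^bsub>X\<^esub> f)) \<cdot>\<^bsub>X\<^esub> Dag X (Asc X z y x)
       = Dag X (Asc X z' y' x') \<cdot>\<^bsub>X\<^esub> ((h \<star>\<^bsub>X\<^esub> g \<star>\<^bsub>X\<^esub> f) \<cdot>\<^bsub>X\<^esub> Asc X z y x) \<cdot>\<^bsub>X\<^esub> Dag X (Asc X z y x)"
      using 16 asc_nat[of h g f z' y' x'] by auto
    then show ?case using 16 by auto
  next
    case (23 w a b x c y d z e)
    have "Dag X ((\<i>\<d> z \<star> Asc X y x w) \<cdot> Asc X z (y \<otimes> x) w \<cdot> (Asc X z y x \<star> \<i>\<d> w)) =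
      Dag X (Asc X z y (x \<otimes> w) \<cdot> Asc X (z \<otimes> y) x w)"
      using 23 by (subst pentagon_eq) simp_all
    then show ?case using 23 by simp
  next
    case (24 x a b y c)
    then have o: "x \<in> Obj X" "y \<in> Obj X" "Trg X y = Src X x" "b = Src X x" by auto
    let ?a = "Asc X y (One X (Src X x)) x"
    have "(Run X y \<star> \<i>\<d> x) \<cdot> Dag X ?a = ((\<i>\<d> y \<star> Lun X x) \<cdot> ?a) \<cdot> Dag X ?a"
      using o triangle_eq[of y x] by simp
    also have "\<dots> = \<i>\<d> y \<star> Lun X x" using o by simp
    finally show ?case using o by simp
  qed (auto simp: hom_cat_op1 hom_cat_cstar exchange ten_add_left ten_add_right ten_scl_left ten_scl_right unitary_def
     lun_nat run_nat)
qed

section \<open>Duals\<close>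

context cstar_2category
begin

lemma cmp_then:
  assumes "g \<cdot> f = g' \<cdot> f'" "f \<in> Arr B" "g \<in> Arr B" "f' \<in> Arr B" "g' \<in> Arr B"
    "Dom B g = Cod B f" "Dom B g' = Cod B f'" "Dom B f' = Dom B f" "k \<in> Arr B" "Cod B k = Dom B f"
  shows "g \<cdot> f \<cdot> k = g' \<cdot> f' \<cdot> k"
proof -
  have "g \<cdot> f \<cdot> k = (g \<cdot> f) \<cdot> k" using assms(2-) by simp
  also have "\<dots> = (g' \<cdot> f') \<cdot> k" by (simp only: assms(1))
  also have "\<dots> = g' \<cdot> f' \<cdot> k" using assms(2-) by simp
  finally show ?thesis .
qed

text \<open>
  Naturality of the associator with two identity factors.  As rewriting rules, these equations
  collect associators at the left of a composite and inverse associators at its right, where the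
  pentagon and the triangle can act on them.
\<close>

lemma asc_out:
  assumes "f \<in> Arr B"
  shows "\<lbrakk>Dom B f = x; y \<in> Obj B; z \<in> Obj B; Trg B x = Src B y; Trg B y = Src B z\<rbrakk> \<Longrightarrow>
     (f \<star> \<i>\<d> (y \<otimes> z)) \<cdot> Asc B x y z = Asc B (Cod B f) y z \<cdot> ((f \<star> \<i>\<d> y) \<star> \<i>\<d> z)"
    "\<lbrakk>x \<in> Obj B; Dom B f = y; z \<in> Obj B; Trg B x = Src B y; Trg B y = Src B z\<rbrakk> \<Longrightarrow>
     (\<i>\<d> x \<star> f \<star> \<i>\<d> z) \<cdot> Asc B x y z = Asc B x (Cod B f) z \<cdot> ((\<i>\<d> x \<star> f) \<star> \<i>\<d> z)"
    "\<lbrakk>x \<in> Obj B; y \<in> Obj B; Dom B f = z; Trg B x = Src B y; Trg B y = Src B z\<rbrakk> \<Longrightarrow>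
     (\<i>\<d> x \<star> \<i>\<d> y \<star> f) \<cdot> Asc B x y z = Asc B x y (Cod B f) \<cdot> (\<i>\<d> (x \<otimes> y) \<star> f)"
  using assms asc_nat[of f "\<i>\<d> y" "\<i>\<d> z"] asc_nat[of "\<i>\<d> x" f "\<i>\<d> z"] asc_nat[of "\<i>\<d> x" "\<i>\<d> y" f]
  by (auto)

lemma asc_dag_nat:
  assumes "f \<in> Arr B" "g \<in> Arr B" "h \<in> Arr B"
    "Trg B (Dom B f) = Src B (Dom B g)" "Trg B (Dom B g) = Src B (Dom B h)"
  shows "(Asc B (Cod B f) (Cod B g) (Cod B h))\<dagger> \<cdot> (f \<star> g \<star> h) =
    ((f \<star> g) \<star> h) \<cdot> (Asc B (Dom B f) (Dom B g) (Dom B h))\<dagger>"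
proof -
  have "Asc B (Dom B f) (Dom B g) (Dom B h) \<cdot> ((f\<dagger> \<star> g\<dagger>) \<star> h\<dagger>)
    = (f\<dagger> \<star> g\<dagger> \<star> h\<dagger>) \<cdot> Asc B (Cod B f) (Cod B g) (Cod B h)"
    using assms by (simp add: asc_nat)
  from arg_cong[OF this, of "Dag B"] show ?thesis using assms by simp
qed

lemma asc_dag_in:
  assumes "f \<in> Arr B"
  shows "\<lbrakk>Cod B f = x; y \<in> Obj B; z \<in> Obj B; Trg B x = Src B y; Trg B y = Src B z\<rbrakk> \<Longrightarrow>
     (Asc B x y z)\<dagger> \<cdot> (f \<star> \<i>\<d> (y \<otimes> z)) = ((f \<star> \<i>\<d> y) \<star> \<i>\<d> z) \<cdot> (Asc B (Dom B f) y z)\<dagger>"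
    "\<lbrakk>x \<in> Obj B; Cod B f = y; z \<in> Obj B; Trg B x = Src B y; Trg B y = Src B z\<rbrakk> \<Longrightarrow>
     (Asc B x y z)\<dagger> \<cdot> (\<i>\<d> x \<star> f \<star> \<i>\<d> z) = ((\<i>\<d> x \<star> f) \<star> \<i>\<d> z) \<cdot> (Asc B x (Dom B f) z)\<dagger>"
    "\<lbrakk>x \<in> Obj B; y \<in> Obj B; Cod B f = z; Trg B x = Src B y; Trg B y = Src B z\<rbrakk> \<Longrightarrow>
     (Asc B x y z)\<dagger> \<cdot> (\<i>\<d> x \<star> \<i>\<d> y \<star> f) = (\<i>\<d> (x \<otimes> y) \<star> f) \<cdot> (Asc B x y (Dom B f))\<dagger>"
  using assms asc_dag_nat[of f "\<i>\<d> y" "\<i>\<d> z"] asc_dag_nat[of "\<i>\<d> x" f "\<i>\<d> z"] asc_dag_nat[of "\<i>\<d> x" "\<i>\<d> y" f]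
  by (auto)

lemma asc_out_then:
  assumes "f \<in> Arr B" "k \<in> Arr B"
  shows "\<lbrakk>Dom B f = x; y \<in> Obj B; z \<in> Obj B; Trg B x = Src B y; Trg B y = Src B z; Cod B k = (x \<otimes> y) \<otimes> z\<rbrakk> \<Longrightarrow>
     (f \<star> \<i>\<d> (y \<otimes> z)) \<cdot> Asc B x y z \<cdot> k = Asc B (Cod B f) y z \<cdot> ((f \<star> \<i>\<d> y) \<star> \<i>\<d> z) \<cdot> k"
    "\<lbrakk>x \<in> Obj B; Dom B f = y; z \<in> Obj B; Trg B x = Src B y; Trg B y = Src B z; Cod B k = (x \<otimes> y) \<otimes> z\<rbrakk> \<Longrightarrow>
     (\<i>\<d> x \<star> f \<star> \<i>\<d> z) \<cdot> Asc B x y z \<cdot> k = Asc B x (Cod B f) z \<cdot> ((\<i>\<d> x \<star> f) \<star> \<i>\<d> z) \<cdot> k"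
    "\<lbrakk>x \<in> Obj B; y \<in> Obj B; Dom B f = z; Trg B x = Src B y; Trg B y = Src B z; Cod B k = (x \<otimes> y) \<otimes> z\<rbrakk> \<Longrightarrow>
     (\<i>\<d> x \<star> \<i>\<d> y \<star> f) \<cdot> Asc B x y z \<cdot> k = Asc B x y (Cod B f) \<cdot> (\<i>\<d> (x \<otimes> y) \<star> f) \<cdot> k"
  using assms by (auto intro!: cmp_then asc_out)

lemma asc_dag_in_then:
  assumes "f \<in> Arr B" "k \<in> Arr B"
  shows "\<lbrakk>Cod B f = x; y \<in> Obj B; z \<in> Obj B; Trg B x = Src B y; Trg B y = Src B z; Cod B k = Dom B f \<otimes> y \<otimes> z\<rbrakk> \<Longrightarrow>
     (Asc B x y z)\<dagger> \<cdot> (f \<star> \<i>\<d> (y \<otimes> z)) \<cdot> k = ((f \<star> \<i>\<d> y) \<star> \<i>\<d> z) \<cdot> (Asc B (Dom B f) y z)\<dagger> \<cdot> k"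
    "\<lbrakk>x \<in> Obj B; Cod B f = y; z \<in> Obj B; Trg B x = Src B y; Trg B y = Src B z; Cod B k = x \<otimes> Dom B f \<otimes> z\<rbrakk> \<Longrightarrow>
     (Asc B x y z)\<dagger> \<cdot> (\<i>\<d> x \<star> f \<star> \<i>\<d> z) \<cdot> k = ((\<i>\<d> x \<star> f) \<star> \<i>\<d> z) \<cdot> (Asc B x (Dom B f) z)\<dagger> \<cdot> k"
    "\<lbrakk>x \<in> Obj B; y \<in> Obj B; Cod B f = z; Trg B x = Src B y; Trg B y = Src B z; Cod B k = x \<otimes> y \<otimes> Dom B f\<rbrakk> \<Longrightarrow>
     (Asc B x y z)\<dagger> \<cdot> (\<i>\<d> x \<star> \<i>\<d> y \<star> f) \<cdot> k = (\<i>\<d> (x \<otimes> y) \<star> f) \<cdot> (Asc B x y (Dom B f))\<dagger> \<cdot> k"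
  using assms by (auto intro!: cmp_then asc_dag_in)

text \<open>
  The pentagon, solved for the composites of two neighbouring associators of opposite direction
  that occur in zig-zags.
\<close>

lemma pentagon_right:
  assumes "w \<in> Obj B" "x \<in> Obj B" "y \<in> Obj B" "z \<in> Obj B"
   "Trg B w = Src B x" "Trg B x = Src B y" "Trg B y = Src B z"
  shows "(Asc B w x (y \<otimes> z))\<dagger> \<cdot> (\<i>\<d> w \<star> Asc B x y z)
    = Asc B (w \<otimes> x) y z \<cdot> ((Asc B w x y)\<dagger> \<star> \<i>\<d> z) \<cdot> (Asc B w (x \<otimes> y) z)\<dagger>"
proof -
  have "(Asc B w x (y \<otimes> z))\<dagger> \<cdot> ((\<i>\<d> w \<star> Asc B x y z) \<cdot> Asc B w (x \<otimes> y) z \<cdot> (Asc B w x y \<star> \<i>\<d> z)) \<cdot>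
     ((Asc B w x y)\<dagger> \<star> \<i>\<d> z) \<cdot> (Asc B w (x \<otimes> y) z)\<dagger>
    = (Asc B w x (y \<otimes> z))\<dagger> \<cdot> (Asc B w x (y \<otimes> z) \<cdot> Asc B (w \<otimes> x) y z) \<cdot>
     ((Asc B w x y)\<dagger> \<star> \<i>\<d> z) \<cdot> (Asc B w (x \<otimes> y) z)\<dagger>"
    by (simp only: pentagon_eq[OF assms])
  then show ?thesis using assms by (simp add: exchange_then)
qed

lemma pentagon_left:
  assumes "w \<in> Obj B" "x \<in> Obj B" "y \<in> Obj B" "z \<in> Obj B"
   "Trg B w = Src B x" "Trg B x = Src B y" "Trg B y = Src B z"
  shows "(\<i>\<d> w \<star> (Asc B x y z)\<dagger>) \<cdot> Asc B w x (y \<otimes> z)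
    = Asc B w (x \<otimes> y) z \<cdot> (Asc B w x y \<star> \<i>\<d> z) \<cdot> (Asc B (w \<otimes> x) y z)\<dagger>"
proof -
  have "(\<i>\<d> w \<star> (Asc B x y z)\<dagger>) \<cdot> ((\<i>\<d> w \<star> Asc B x y z) \<cdot> Asc B w (x \<otimes> y) z \<cdot> (Asc B w x y \<star> \<i>\<d> z)) \<cdot>
     (Asc B (w \<otimes> x) y z)\<dagger>
    = (\<i>\<d> w \<star> (Asc B x y z)\<dagger>) \<cdot> (Asc B w x (y \<otimes> z) \<cdot> Asc B (w \<otimes> x) y z) \<cdot>
     (Asc B (w \<otimes> x) y z)\<dagger>"
    by (simp only: pentagon_eq[OF assms])
  then show ?thesis using assms by (simp add: exchange_then)
qed

lemma pentagon_then:
  assumes "w \<in> Obj B" "x \<in> Obj B" "y \<in> Obj B" "z \<in> Obj B"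
   "Trg B w = Src B x" "Trg B x = Src B y" "Trg B y = Src B z" "k \<in> Arr B"
  shows "Cod B k = w \<otimes> (x \<otimes> y) \<otimes> z \<Longrightarrow> (Asc B w x (y \<otimes> z))\<dagger> \<cdot> (\<i>\<d> w \<star> Asc B x y z) \<cdot> k
    = Asc B (w \<otimes> x) y z \<cdot> ((Asc B w x y)\<dagger> \<star> \<i>\<d> z) \<cdot> (Asc B w (x \<otimes> y) z)\<dagger> \<cdot> k"
   "Cod B k = (w \<otimes> x) \<otimes> (y \<otimes> z) \<Longrightarrow> (\<i>\<d> w \<star> (Asc B x y z)\<dagger>) \<cdot> Asc B w x (y \<otimes> z) \<cdot> k
    = Asc B w (x \<otimes> y) z \<cdot> (Asc B w x y \<star> \<i>\<d> z) \<cdot> (Asc B (w \<otimes> x) y z)\<dagger> \<cdot> k"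
  using assms cmp_then[OF pentagon_left[of w x y z], of k] cmp_then[OF pentagon_right[of w x y z], of k] by simp_all

lemma lun_ten_then:
  assumes "x \<in> Obj B" "y \<in> Obj B" "Trg B x = Src B y" "k \<in> Arr B" "Cod B k = (One B (Src B x) \<otimes> x) \<otimes> y"
    "a = Src B x"
  shows "Lun B (x \<otimes> y) \<cdot> Asc B (One B a) x y \<cdot> k = (Lun B x \<star> \<i>\<d> y) \<cdot> k"
  using assms by (simp flip: lun_ten)

lemma triangle_dag:
  assumes "x \<in> Obj B" "y \<in> Obj B" "Trg B x = Src B y" "b = Src B y"
  shows "(Asc B x (One B b) y)\<dagger> \<cdot> (\<i>\<d> x \<star> (Lun B y)\<dagger>) = (Run B x)\<dagger> \<star> \<i>\<d> y"
  using arg_cong[OF triangle_eq[OF assms(1-3)], of "Dag B"] assms by simp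

lemma lun_ten_dag:
  assumes "x \<in> Obj B" "y \<in> Obj B" "Trg B x = Src B y" "a = Src B x"
  shows "(Asc B (One B a) x y)\<dagger> \<cdot> (Lun B (x \<otimes> y))\<dagger> = (Lun B x)\<dagger> \<star> \<i>\<d> y"
  using arg_cong[OF lun_ten[OF assms(1-3)], of "Dag B"] assms by simp

lemma lun_dag_nat:
  assumes "f \<in> Arr B" "Dom B f = x" "a = Src B x"
  shows "(\<i>\<d> (One B a) \<star> f) \<cdot> (Lun B x)\<dagger> = (Lun B (Cod B f))\<dagger> \<cdot> f"
proof -
  have "(Lun B (Cod B f))\<dagger> \<cdot> (Lun B (Cod B f) \<cdot> (\<i>\<d> (One B (Src B (Dom B f))) \<star> f)) \<cdot> (Lun B x)\<dagger>
    = (Lun B (Cod B f))\<dagger> \<cdot> (f \<cdot> Lun B (Dom B f)) \<cdot> (Lun B x)\<dagger>"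
    by (simp only: lun_nat[OF assms(1)])
  then show ?thesis using assms dom_obj[OF assms(1)] by simp
qed

lemma run_dag_nat:
  assumes "f \<in> Arr B" "Dom B f = x" "b = Trg B x"
  shows "(f \<star> \<i>\<d> (One B b)) \<cdot> (Run B x)\<dagger> = (Run B (Cod B f))\<dagger> \<cdot> f"
proof -
  have "(Run B (Cod B f))\<dagger> \<cdot> (Run B (Cod B f) \<cdot> (f \<star> \<i>\<d> (One B (Trg B (Dom B f))))) \<cdot> (Run B x)\<dagger>
    = (Run B (Cod B f))\<dagger> \<cdot> (f \<cdot> Run B (Dom B f)) \<cdot> (Run B x)\<dagger>"
    by (simp only: run_nat[OF assms(1)])
  then show ?thesis using assms dom_obj[OF assms(1)] by simp
qed

lemma is_dualD:
  assumes "is_dual B x v e c"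
  shows "x \<in> Obj B" "v \<in> Obj B" "Src B v = Trg B x" "Trg B v = Src B x"
    "e \<in> Arr B" "Dom B e = v \<otimes> x" "Cod B e = One B (Trg B x)"
    "c \<in> Arr B" "Dom B c = One B (Src B x)" "Cod B c = x \<otimes> v"
  using assms by (simp_all add: is_dual_def)

text \<open>
  The functors \<open>v \<otimes> -\<close> and \<open>x \<otimes> -\<close> inherit the zig-zag equations of \<open>x\<close> and \<open>v\<close>: once the pentagon
  has moved the associators out of the way, the composite is the zig-zag equation of \<open>v\<close>
  whiskered with \<open>w\<close>.
\<close>

lemma lact_zigzag_left:
  assumes "is_dual B x v e c" "w \<in> Obj B" "Src B x = Src B w"
  shows "Lun B (v \<otimes> w) \<cdot> (e \<star> \<i>\<d> (v \<otimes> w)) \<cdot> (Asc B v x (v \<otimes> w))\<dagger>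
    \<cdot> (\<i>\<d> v \<star> (Asc B x v w \<cdot> (c \<star> \<i>\<d> w) \<cdot> (Lun B w)\<dagger>)) = \<i>\<d> (v \<otimes> w)"
proof -
  have t: "x \<in> Obj B" "v \<in> Obj B" "Src B v = Trg B x" "Trg B v = Src B x"
    "e \<in> Arr B" "Dom B e = v \<otimes> x" "Cod B e = One B (Trg B x)"
    "c \<in> Arr B" "Dom B c = One B (Src B x)" "Cod B c = x \<otimes> v"
    and z: "Lun B v \<cdot> (e \<star> \<i>\<d> v) \<cdot> (Asc B v x v)\<dagger> \<cdot> (\<i>\<d> v \<star> c) \<cdot> (Run B v)\<dagger> = \<i>\<d> v"
    using assms(1) by (simp_all add: is_dual_def)
  have "(Lun B v \<cdot> (e \<star> \<i>\<d> v) \<cdot> (Asc B v x v)\<dagger> \<cdot> (\<i>\<d> v \<star> c) \<cdot> (Run B v)\<dagger>) \<star> \<i>\<d> w = \<i>\<d> (v \<otimes> w)"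
    using t assms by (simp add: z)
  then show ?thesis using t assms(2-)
    by (simp add: whisker_left whisker_right pentagon_then asc_out_then lun_ten_then asc_dag_in_then triangle_dag)
qed

lemma lact_zigzag_right:
  assumes "is_dual B x v e c" "w \<in> Obj B" "Trg B x = Src B w"
  shows "(\<i>\<d> x \<star> (Lun B w \<cdot> (e \<star> \<i>\<d> w) \<cdot> (Asc B v x w)\<dagger>)) \<cdot> Asc B x v (x \<otimes> w) \<cdot> (c \<star> \<i>\<d> (x \<otimes> w)) \<cdot> (Lun B (x \<otimes> w))\<dagger>
    = \<i>\<d> (x \<otimes> w)"
proof -
  have t: "x \<in> Obj B" "v \<in> Obj B" "Src B v = Trg B x" "Trg B v = Src B x"
    "e \<in> Arr B" "Dom B e = v \<otimes> x" "Cod B e = One B (Trg B x)"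
    "c \<in> Arr B" "Dom B c = One B (Src B x)" "Cod B c = x \<otimes> v"
    and z: "Run B x \<cdot> (\<i>\<d> x \<star> e) \<cdot> Asc B x v x \<cdot> (c \<star> \<i>\<d> x) \<cdot> (Lun B x)\<dagger> = \<i>\<d> x"
    using assms(1) by (simp_all add: is_dual_def)
  have "(Run B x \<cdot> (\<i>\<d> x \<star> e) \<cdot> Asc B x v x \<cdot> (c \<star> \<i>\<d> x) \<cdot> (Lun B x)\<dagger>) \<star> \<i>\<d> w = \<i>\<d> (x \<otimes> w)"
    using t assms by (simp add: z)
  then show ?thesis using t assms(2-)
    by (simp add: whisker_left whisker_right pentagon_then asc_out_then lun_ten_dag asc_dag_in_then triangle_then)
qed

text \<open>
  Bending the dual strand back recovers \<open>f\<close>, so \<open>f\<close> is determined by \<open>(f \<otimes> 1) coev\<close>.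
\<close>

lemma transpose_coev:
  assumes "is_dual B x v e c" "f \<in> Arr B" "Dom B f = x"
  shows "Run B (Cod B f) \<cdot> (\<i>\<d> (Cod B f) \<star> e) \<cdot> Asc B (Cod B f) v x \<cdot> (((f \<star> \<i>\<d> v) \<cdot> c) \<star> \<i>\<d> x) \<cdot> (Lun B x)\<dagger> = f"
proof -
  note t = is_dualD[OF assms(1)]
  have z: "Run B x \<cdot> (\<i>\<d> x \<star> e) \<cdot> Asc B x v x \<cdot> (c \<star> \<i>\<d> x) \<cdot> (Lun B x)\<dagger> = \<i>\<d> x"
    using assms(1) by (simp add: is_dual_def)
  have s: "Src B (Cod B f) = Src B x" "Trg B (Cod B f) = Trg B x" using assms by auto
  let ?k = "(c \<star> \<i>\<d> x) \<cdot> (Lun B x)\<dagger>"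
  have "Run B (Cod B f) \<cdot> (\<i>\<d> (Cod B f) \<star> e) \<cdot> Asc B (Cod B f) v x \<cdot> (((f \<star> \<i>\<d> v) \<cdot> c) \<star> \<i>\<d> x) \<cdot> (Lun B x)\<dagger>
    = Run B (Cod B f) \<cdot> (\<i>\<d> (Cod B f) \<star> e) \<cdot> (f \<star> \<i>\<d> (v \<otimes> x)) \<cdot> Asc B x v x \<cdot> ?k"
    using t s assms(2-) by (simp add: whisker_right asc_out_then)
  also have "\<dots> = (Run B (Cod B f) \<cdot> (f \<star> \<i>\<d> (One B (Trg B (Dom B f))))) \<cdot> (\<i>\<d> x \<star> e) \<cdot> Asc B x v x \<cdot> ?k"
    using t s assms(2-) by (simp add: exchange_then)
  also have "\<dots> = f \<cdot> (Run B x \<cdot> (\<i>\<d> x \<star> e) \<cdot> Asc B x v x \<cdot> ?k)"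
    unfolding run_nat[OF assms(2)] using t s assms(2-) by simp
  finally show ?thesis using z assms by simp
qed

end

context
  fixes X :: "('x, 'm, 'o) threehilb" (structure)
  assumes two_category: "cstar_2category X"
begin

interpretation cstar_2category X by (rule two_category)

lemma run_ten:
  assumes "x \<in> Obj X" "y \<in> Obj X" "Trg X x = Src X y"
  shows "Run X (x \<otimes> y) \<cdot> (Asc X x y (One X (Trg X y)))\<dagger> = \<i>\<d> x \<star> Run X y"
  using cstar_2category.lun_ten[OF cstar_2category_op1[OF two_category], of y x] assms by simp

lemma run_ten_dag:
  assumes "x \<in> Obj X" "y \<in> Obj X" "Trg X x = Src X y"
  shows "\<i>\<d> x \<star> (Run X y)\<dagger> = Asc X x y (One X (Trg X y)) \<cdot> (Run X (x \<otimes> y))\<dagger>"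
  using arg_cong[OF run_ten[OF assms], of "Dag X"] assms by simp

text \<open>
  In the 1-opposite the same evaluation and coevaluation exhibit \<open>x\<close> as a dual of \<open>v\<close>, because the
  two zig-zag equations change places.
\<close>

lemma is_dual_op1: "is_dual X x v e c \<Longrightarrow> is_dual (op1 X) v x e c"
  by (auto simp: is_dual_def)

lemma ract_zigzag_left:
  assumes "is_dual X x v e c" "w \<in> Obj X" "Trg X w = Src X x"
  shows "Run X (w \<otimes> x) \<cdot> (\<i>\<d> (w \<otimes> x) \<star> e) \<cdot> Asc X (w \<otimes> x) v x
    \<cdot> (((Asc X w x v)\<dagger> \<cdot> (\<i>\<d> w \<star> c) \<cdot> (Run X w)\<dagger>) \<star> \<i>\<d> x) = \<i>\<d> (w \<otimes> x)"
  using cstar_2category.lact_zigzag_left[OF cstar_2category_op1[OF two_category] is_dual_op1[OF assms(1)], of w]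
   is_dualD[OF assms(1)] assms(2-) by simp

lemma ract_zigzag_right:
  assumes "is_dual X x v e c" "w \<in> Obj X" "Trg X w = Trg X x"
  shows "((Run X w \<cdot> (\<i>\<d> w \<star> e) \<cdot> Asc X w v x) \<star> \<i>\<d> v) \<cdot> (Asc X (w \<otimes> v) x v)\<dagger> \<cdot> (\<i>\<d> (w \<otimes> v) \<star> c) \<cdot> (Run X (w \<otimes> v))\<dagger>
    = \<i>\<d> (w \<otimes> v)"
  using cstar_2category.lact_zigzag_right[OF cstar_2category_op1[OF two_category] is_dual_op1[OF assms(1)], of w]
   is_dualD[OF assms(1)] assms(2-) by simp

lemma dual_map_arr:
  assumes "is_dual X x v ev c" "w \<in> Obj X" "Trg X w = Src X x" "e \<in> Arr X" "Dom X e = w \<otimes> x" "Cod X e = One X (Trg X x)"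
  shows "dual_map X w x v e c \<in> Arr X" "Dom X (dual_map X w x v e c) = w" "Cod X (dual_map X w x v e c) = v"
  using assms is_dualD[OF assms(1)] arr_parallel[of e] by (auto simp: dual_map_def)

text \<open>
  The map \<open>dual_map X w x v e c\<close> is the transpose of \<open>e\<close> under the adjunction between \<open>- \<otimes> x\<close> and
  \<open>- \<otimes> v\<close>; this lemma transposes it back.  For two duals of \<open>x\<close>, it says that the canonical map
  between them intertwines their evaluations.
\<close>

lemma ev_dual_map:
  assumes "is_dual X x v ev c" "w \<in> Obj X" "Trg X w = Src X x" "e \<in> Arr X" "Dom X e = w \<otimes> x" "Cod X e = One X (Trg X x)"
  shows "ev \<cdot> (dual_map X w x v e c \<star> \<i>\<d> x) = e"
proof -
  note t = is_dualD[OF assms(1)]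
  have s: "Src X w = Trg X x" using src_cod[OF assms(4)] assms t by simp
  let ?I = "One X (Trg X x)"
  let ?k = "(Asc X w x v)\<dagger> \<cdot> (\<i>\<d> w \<star> c) \<cdot> (Run X w)\<dagger>"
  have 1: "ev \<cdot> (Lun X v \<star> \<i>\<d> x) = Run X ?I \<cdot> (\<i>\<d> ?I \<star> ev) \<cdot> Asc X ?I v x"
  proof -
    have "ev \<cdot> (Lun X v \<star> \<i>\<d> x) = (ev \<cdot> Lun X (v \<otimes> x)) \<cdot> Asc X ?I v x"
      using t s by (simp flip: lun_ten)
    also have "\<dots> = (Lun X ?I \<cdot> (\<i>\<d> ?I \<star> ev)) \<cdot> Asc X ?I v x"
      using lun_nat[of ev] t s by simp
    finally show ?thesis using t s by (simp add: lun_one_run_one)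
  qed
  have 2: "(\<i>\<d> ?I \<star> ev) \<cdot> Asc X ?I v x \<cdot> ((e \<star> \<i>\<d> v) \<star> \<i>\<d> x)
    = (e \<star> \<i>\<d> ?I) \<cdot> (\<i>\<d> (w \<otimes> x) \<star> ev) \<cdot> Asc X (w \<otimes> x) v x"
  proof -
    have "(\<i>\<d> ?I \<star> ev) \<cdot> Asc X ?I v x \<cdot> ((e \<star> \<i>\<d> v) \<star> \<i>\<d> x) = (\<i>\<d> ?I \<star> ev) \<cdot> (e \<star> \<i>\<d> (v \<otimes> x)) \<cdot> Asc X (w \<otimes> x) v x"
      using t s assms(2-) by (simp add: asc_out)
    then show ?thesis using t s assms(2-) by (simp add: exchange_then)
  qed
  have "ev \<cdot> (dual_map X w x v e c \<star> \<i>\<d> x) = (ev \<cdot> (Lun X v \<star> \<i>\<d> x)) \<cdot> ((e \<star> \<i>\<d> v) \<star> \<i>\<d> x) \<cdot> (?k \<star> \<i>\<d> x)"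
    using t s assms(2-) by (simp add: dual_map_def whisker_right)
  also have "\<dots> = Run X ?I \<cdot> ((\<i>\<d> ?I \<star> ev) \<cdot> Asc X ?I v x \<cdot> ((e \<star> \<i>\<d> v) \<star> \<i>\<d> x)) \<cdot> (?k \<star> \<i>\<d> x)"
    unfolding 1 using t s assms(2-) by simp
  also have "\<dots> = (Run X ?I \<cdot> (e \<star> \<i>\<d> ?I)) \<cdot> (\<i>\<d> (w \<otimes> x) \<star> ev) \<cdot> Asc X (w \<otimes> x) v x \<cdot> (?k \<star> \<i>\<d> x)"
    unfolding 2 using t s assms(2-) by simp
  also have "\<dots> = e \<cdot> (Run X (w \<otimes> x) \<cdot> (\<i>\<d> (w \<otimes> x) \<star> ev) \<cdot> Asc X (w \<otimes> x) v x \<cdot> (?k \<star> \<i>\<d> x))"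
    using run_nat[of e] t s assms(2-) by simp
  also have "\<dots> = e"
    using ract_zigzag_left[OF assms(1-3)] assms(2-) by simp
  finally show ?thesis .
qed

text \<open>
  A 2-morphism can be moved around the cup to the dual strand.  The cup \<open>c2\<close> is pulled through \<open>f\<close>
  and \<open>c\<close>, and the zig-zag equation of \<open>y\<close> and \<open>u\<close>, tensored with \<open>v\<close>, then removes it together with
  \<open>e2\<close>.
\<close>

lemma slide_coev:
  assumes "is_dual X x v e c" "is_dual X y u e2 c2" "f \<in> Arr X" "Dom X f = x" "Cod X f = y"
  shows "(\<i>\<d> y \<star> dual_map X u x v (e2 \<cdot> (\<i>\<d> u \<star> f)) c) \<cdot> c2 = (f \<star> \<i>\<d> v) \<cdot> c"
proof -
  note t = is_dualD[OF assms(1)] is_dualD[OF assms(2)]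
  have s: "Src X y = Src X x" "Trg X y = Trg X x" using arr_parallel[OF assms(3)] assms by auto
  let ?F = "(f \<star> \<i>\<d> v) \<cdot> c"
  let ?I = "One X (Src X x)"
  have 1: "dual_map X u x v (e2 \<cdot> (\<i>\<d> u \<star> f)) c = Lun X v \<cdot> (e2 \<star> \<i>\<d> v) \<cdot> (Asc X u y v)\<dagger> \<cdot> (\<i>\<d> u \<star> ?F) \<cdot> (Run X u)\<dagger>"
    using t s assms(3-) by (simp add: dual_map_def whisker_left whisker_right asc_dag_in_then)
  have 2: "(\<i>\<d> y \<star> \<i>\<d> u \<star> ?F) \<cdot> (\<i>\<d> y \<star> (Run X u)\<dagger>) \<cdot> c2
    = Asc X y u (y \<otimes> v) \<cdot> (c2 \<star> \<i>\<d> (y \<otimes> v)) \<cdot> (Lun X (y \<otimes> v))\<dagger> \<cdot> ?F"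
  proof -
    have "(\<i>\<d> y \<star> \<i>\<d> u \<star> ?F) \<cdot> (\<i>\<d> y \<star> (Run X u)\<dagger>) \<cdot> c2 =
      ((\<i>\<d> y \<star> \<i>\<d> u \<star> ?F) \<cdot> Asc X y u ?I) \<cdot> (Run X (y \<otimes> u))\<dagger> \<cdot> c2"
      using t s assms(3-) by (simp add: run_ten_dag)
    also have "\<dots> = (Asc X y u (y \<otimes> v) \<cdot> (\<i>\<d> (y \<otimes> u) \<star> ?F)) \<cdot> (Run X (y \<otimes> u))\<dagger> \<cdot> c2"
      using t s assms(3-) by (subst asc_out(3)) simp_all
    also have "\<dots> = Asc X y u (y \<otimes> v) \<cdot> (\<i>\<d> (y \<otimes> u) \<star> ?F) \<cdot> (c2 \<star> \<i>\<d> ?I) \<cdot> (Lun X ?I)\<dagger>"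
      using t s assms(3-) run_dag_nat[of c2 ?I] by (simp add: lun_one_run_one)
    also have "\<dots> = Asc X y u (y \<otimes> v) \<cdot> (c2 \<star> \<i>\<d> (y \<otimes> v)) \<cdot> (\<i>\<d> ?I \<star> ?F) \<cdot> (Lun X ?I)\<dagger>"
      using t s assms(3-) by (simp add: exchange_then)
    also have "\<dots> = Asc X y u (y \<otimes> v) \<cdot> (c2 \<star> \<i>\<d> (y \<otimes> v)) \<cdot> (Lun X (y \<otimes> v))\<dagger> \<cdot> ?F"
      using t s assms(3-) by (subst lun_dag_nat) simp_all
    finally show ?thesis .
  qed
  have "(\<i>\<d> y \<star> dual_map X u x v (e2 \<cdot> (\<i>\<d> u \<star> f)) c) \<cdot> c2 =
    (\<i>\<d> y \<star> (Lun X v \<cdot> (e2 \<star> \<i>\<d> v) \<cdot> (Asc X u y v)\<dagger>)) \<cdot> ((\<i>\<d> y \<star> \<i>\<d> u \<star> ?F) \<cdot> (\<i>\<d> y \<star> (Run X u)\<dagger>) \<cdot> c2)"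
    unfolding 1 using t s assms(3-) by (simp add: whisker_left)
  also have "\<dots> = ((\<i>\<d> y \<star> (Lun X v \<cdot> (e2 \<star> \<i>\<d> v) \<cdot> (Asc X u y v)\<dagger>)) \<cdot>
    Asc X y u (y \<otimes> v) \<cdot> (c2 \<star> \<i>\<d> (y \<otimes> v)) \<cdot> (Lun X (y \<otimes> v))\<dagger>) \<cdot> ?F"
    unfolding 2 using t s assms(3-) by simp
  also have "\<dots> = ?F"
    using lact_zigzag_right[OF assms(2), of v] t s assms(3-) by simp
  finally show ?thesis .
qed

text \<open>
  On four neighbouring strands \<open>v\<close>, \<open>w\<close>, \<open>z\<close>, \<open>u\<close>, capping off \<open>z\<close>, \<open>u\<close> first and then \<open>v\<close>, \<open>w\<close> is the
  same as capping off \<open>v\<close>, \<open>w\<close> first.  Up to associators both are \<open>e \<otimes> n\<close>, followed by the right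
  unitor of the unit in one case and by the left unitor in the other, and these two agree.
\<close>

lemma isotopy:
  assumes o: "v \<in> Obj X" "w \<in> Obj X" "z \<in> Obj X" "u \<in> Obj X" "Trg X v = Src X w" "Trg X w = Src X z" "Trg X z = Src X u"
    and e: "e \<in> Arr X" "Dom X e = v \<otimes> w" "Cod X e = One X (Src X z)"
    and n: "n \<in> Arr X" "Dom X n = z \<otimes> u" "Cod X n = One X (Src X z)"
  shows "e \<cdot> (\<i>\<d> v \<star> (Run X w \<cdot> (\<i>\<d> w \<star> n) \<cdot> Asc X w z u))
    = n \<cdot> ((Lun X z \<cdot> (e \<star> \<i>\<d> z) \<cdot> (Asc X v w z)\<dagger>) \<star> \<i>\<d> u) \<cdot> (Asc X v (w \<otimes> z) u)\<dagger>"
proof -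
  have s: "Src X v = Src X z" "Trg X u = Src X z" using arr_parallel[OF e(1)] arr_parallel[OF n(1)] o e n by auto
  note t = o s e n
  let ?I = "One X (Src X z)"
  let ?r = "(Asc X v w (z \<otimes> u))\<dagger> \<cdot> (\<i>\<d> v \<star> Asc X w z u)"
  have "e \<cdot> (\<i>\<d> v \<star> Run X w) = (e \<cdot> Run X (v \<otimes> w)) \<cdot> (Asc X v w ?I)\<dagger>"
    using t by (simp flip: run_ten)
  also have "\<dots> = Run X ?I \<cdot> (e \<star> \<i>\<d> ?I) \<cdot> (Asc X v w ?I)\<dagger>"
    using t run_nat[of e, symmetric] by simp
  finally have 1: "e \<cdot> (\<i>\<d> v \<star> Run X w) = Run X ?I \<cdot> (e \<star> \<i>\<d> ?I) \<cdot> (Asc X v w ?I)\<dagger>" .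
  have "e \<cdot> (\<i>\<d> v \<star> (Run X w \<cdot> (\<i>\<d> w \<star> n) \<cdot> Asc X w z u))
    = (e \<cdot> (\<i>\<d> v \<star> Run X w)) \<cdot> (\<i>\<d> v \<star> (\<i>\<d> w \<star> n)) \<cdot> (\<i>\<d> v \<star> Asc X w z u)"
    using t by (simp add: whisker_left)
  also have "\<dots> = Run X ?I \<cdot> (e \<star> \<i>\<d> ?I) \<cdot> (\<i>\<d> (v \<otimes> w) \<star> n) \<cdot> ?r"
    unfolding 1 using t by (simp add: asc_dag_in_then)
  also have "\<dots> = Lun X ?I \<cdot> (\<i>\<d> ?I \<star> n) \<cdot> (e \<star> \<i>\<d> (z \<otimes> u)) \<cdot> ?r"
    using t by (simp add: exchange_then lun_one_run_one)
  also have "\<dots> = (Lun X ?I \<cdot> (\<i>\<d> ?I \<star> n)) \<cdot> (e \<star> \<i>\<d> (z \<otimes> u)) \<cdot> ?r"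
    using t by simp
  also have "\<dots> = (n \<cdot> Lun X (z \<otimes> u)) \<cdot> (e \<star> \<i>\<d> (z \<otimes> u)) \<cdot> ?r"
    using t lun_nat[of n] by simp
  also have "\<dots> = n \<cdot> ((Lun X z \<cdot> (e \<star> \<i>\<d> z) \<cdot> (Asc X v w z)\<dagger>) \<star> \<i>\<d> u) \<cdot> (Asc X v (w \<otimes> z) u)\<dagger>"
    using t by (simp add: pentagon_right asc_out_then lun_ten_then whisker_right)
  finally show ?thesis .
qed

end

section \<open>Traces\<close>

text \<open>
  The traced hom categories and the 1-opposite are formed from a record without additional fields.
\<close>

locale weighted_2category = pre_three_hilbert X
  for X :: "('x, 'm, 'o) threehilb" (structure)
begin

lemma vee_arr [simp]:
  assumes "x \<in> Obj X"
  shows "Vee X x \<in> Obj X" "Src X (Vee X x) = Trg X x" "Trg X (Vee X x) = Src X x"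
    "Ev X x \<in> Arr X" "Dom X (Ev X x) = Vee X x \<otimes> x" "Cod X (Ev X x) = One X (Trg X x)"
    "Coev X x \<in> Arr X" "Dom X (Coev X x) = One X (Src X x)" "Cod X (Coev X x) = x \<otimes> Vee X x"
  using is_dualD[OF vee_dual[OF assms]] assms by simp_all

lemma vee2_arr [simp]:
  assumes "f \<in> Arr X"
  shows "vee2 X f \<in> Arr X" "Dom X (vee2 X f) = Vee X (Cod X f)" "Cod X (vee2 X f) = Vee X (Dom X f)"
  using assms dual_map_arr[OF cstar_2category_axioms vee_dual[of "Dom X f"], of "Vee X (Cod X f)" "Ev X (Cod X f) \<cdot> (\<i>\<d> (Vee X (Cod X f)) \<star> f)"]
  by (simp_all add: vee2_def Let_def)

lemma coev_slide:
  assumes "f \<in> Arr X"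
  shows "(\<i>\<d> (Cod X f) \<star> vee2 X f) \<cdot> Coev X (Cod X f) = (f \<star> \<i>\<d> (Vee X (Dom X f))) \<cdot> Coev X (Dom X f)"
  using slide_coev[OF cstar_2category_axioms vee_dual[of "Dom X f"] vee_dual[of "Cod X f"], of f] assms by (simp add: vee2_def Let_def)

text \<open>
  The mirror image of \<open>coev_slide\<close>; reflecting it needs \<open>(f\<^sup>\<or>)\<^sup>\<dagger> = (f\<^sup>\<dagger>)\<^sup>\<or>\<close>.
\<close>

lemma coev_dag_slide:
  assumes "f \<in> Arr X"
  shows "(Coev X (Dom X f))\<dagger> \<cdot> (\<i>\<d> (Dom X f) \<star> vee2 X f) = (Coev X (Cod X f))\<dagger> \<cdot> (f \<star> \<i>\<d> (Vee X (Cod X f)))"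
  using arg_cong[OF coev_slide[of "f\<dagger>"], of "Dag X"] assms by (simp add: vee_dag)

text \<open>
  On the loop that computes the trace, \<open>f\<close> slides through the cup to the dual strand, passes \<open>g\<close> on
  the other strand, and slides back through the cap.
\<close>

lemma trace_left_commute:
  assumes "f \<in> Arr X" "g \<in> Arr X" "Dom X g = Cod X f" "Cod X g = Dom X f"
  shows "trace_left X (Dom X f) (g \<cdot> f) = trace_left X (Dom X g) (f \<cdot> g)"
proof -
  let ?x = "Dom X f" and ?y = "Cod X f"
  have "(Coev X ?x)\<dagger> \<cdot> ((g \<cdot> f) \<star> \<i>\<d> (Vee X ?x)) \<cdot> Coev X ?x
     = (Coev X ?x)\<dagger> \<cdot> (g \<star> \<i>\<d> (Vee X ?x)) \<cdot> ((f \<star> \<i>\<d> (Vee X ?x)) \<cdot> Coev X ?x)"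
    using assms by (simp add: whisker_right)
  also have "\<dots> = (Coev X ?x)\<dagger> \<cdot> (g \<star> \<i>\<d> (Vee X ?x)) \<cdot> ((\<i>\<d> ?y \<star> vee2 X f) \<cdot> Coev X ?y)"
    using assms by (simp add: coev_slide)
  also have "\<dots> = ((Coev X ?x)\<dagger> \<cdot> (\<i>\<d> ?x \<star> vee2 X f)) \<cdot> (g \<star> \<i>\<d> (Vee X ?y)) \<cdot> Coev X ?y"
    using assms by (simp add: exchange_then)
  also have "\<dots> = (Coev X ?y)\<dagger> \<cdot> ((f \<cdot> g) \<star> \<i>\<d> (Vee X ?y)) \<cdot> Coev X ?y"
    unfolding coev_dag_slide[OF assms(1)] using assms by (simp add: whisker_right)
  finally show ?thesis using assms by (simp add: trace_left_def)
qed

lemma trace_left_linear: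
  assumes "f \<in> Arr X" "Dom X f = x" "Cod X f = x"
  shows "g \<in> Arr X \<Longrightarrow> Dom X g = x \<Longrightarrow> Cod X g = x \<Longrightarrow> trace_left X x (f \<oplus> g) = trace_left X x f + trace_left X x g"
    and "trace_left X x (r \<odot> f) = r * trace_left X x f"
proof -
  have x: "x \<in> Obj X" using assms by auto
  note p = weight_functional[of "Src X x", unfolded faithful_positive_functional_def]
  show "g \<in> Arr X \<Longrightarrow> Dom X g = x \<Longrightarrow> Cod X g = x \<Longrightarrow> trace_left X x (f \<oplus> g) = trace_left X x f + trace_left X x g"
    using assms x p by (simp add: trace_left_def)
  show "trace_left X x (r \<odot> f) = r * trace_left X x f"
    using assms x p by (simp add: trace_left_def)
qed

text \<open>
  The trace of \<open>f\<^sup>\<dagger> f\<close> is the weight of \<open>k\<^sup>\<dagger> k\<close> for \<open>k = (f \<otimes> 1) coev\<close>, and \<open>k\<close> determines \<open>f\<close>.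
\<close>

lemma trace_left_positive:
  assumes "f \<in> Arr X" "Dom X f = x"
  shows "trace_left X x (f\<dagger> \<cdot> f) \<in> \<real>" "0 \<le> Re (trace_left X x (f\<dagger> \<cdot> f))"
    "trace_left X x (f\<dagger> \<cdot> f) = 0 \<Longrightarrow> f = Zer X x (Cod X f)"
proof -
  have x: "x \<in> Obj X" using assms by auto
  have s: "Src X (Cod X f) = Src X x" "Trg X (Cod X f) = Trg X x" using assms by auto
  let ?v = "Vee X x" and ?I = "One X (Src X x)"
  let ?k = "(f \<star> \<i>\<d> ?v) \<cdot> Coev X x"
  have k: "?k \<in> Arr X" "Dom X ?k = ?I" "Cod X ?k = Cod X f \<otimes> ?v" using assms x s by simp_all
  obtain h where h: "h \<in> Arr X" "Dom X h = ?I" "Cod X h = ?I" "?k\<dagger> \<cdot> ?k = h\<dagger> \<cdot> h"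
    using dag_positive[OF k(1)] k(2) by metis
  have tr: "trace_left X x (f\<dagger> \<cdot> f) = Psi X (Src X x) (h\<dagger> \<cdot> h)"
    using assms x s h(4) by (simp add: trace_left_def whisker_right)
  note p = weight_functional[of "Src X x", unfolded faithful_positive_functional_def]
  show "trace_left X x (f\<dagger> \<cdot> f) \<in> \<real>" "0 \<le> Re (trace_left X x (f\<dagger> \<cdot> f))"
    using p x h(1-3) unfolding tr by simp_all
  assume "trace_left X x (f\<dagger> \<cdot> f) = 0"
  then have "h = Zer X ?I ?I" using p x h(1-3) unfolding tr by simp
  then have "?k\<dagger> \<cdot> ?k = Zer X ?I ?I" using h x cmp_zero[of "h\<dagger>" ?I ?I] by simp
  then have k0: "?k = Zer X ?I (Cod X f \<otimes> ?v)" using dag_cmp_zero[OF k(1)] k(2,3) by simp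
  have "f = Run X (Cod X f) \<cdot> (\<i>\<d> (Cod X f) \<star> Ev X x) \<cdot> Asc X (Cod X f) ?v x \<cdot> (?k \<star> \<i>\<d> x) \<cdot> (Lun X x)\<dagger>"
    using transpose_coev[OF vee_dual[OF x] assms] by simp
  also have "\<dots> = Zer X x (Cod X f)"
    unfolding k0 using assms x s by (simp add: zero_ten2 zero_cmp cmp_zero)
  finally show "f = Zer X x (Cod X f)" .
qed

text \<open>
  The nested evaluation of \<open>w\<^sup>\<or> \<otimes> y\<^sup>\<or>\<close> computes the same traces as the chosen evaluation of
  \<open>y \<otimes> w\<close>, since it differs from it by a unitary on the dual strand.
\<close>

lemma ev_ten_eq:
  assumes "y \<in> Obj X" "w \<in> Obj X" "Trg X y = Src X w"
  obtains \<theta> where "\<theta> \<in> Arr X" "Dom X \<theta> = Vee X w \<otimes> Vee X y" "Cod X \<theta> = Vee X (y \<otimes> w)"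
    "\<theta>\<dagger> \<cdot> \<theta> = \<i>\<d> (Vee X w \<otimes> Vee X y)" "Ev X (y \<otimes> w) = ev_ten X y w \<cdot> (\<theta>\<dagger> \<star> \<i>\<d> (y \<otimes> w))"
proof -
  let ?\<theta> = "dual_map X (Vee X w \<otimes> Vee X y) (y \<otimes> w) (Vee X (y \<otimes> w)) (ev_ten X y w) (Coev X (y \<otimes> w))"
  have e: "ev_ten X y w \<in> Arr X" "Dom X (ev_ten X y w) = (Vee X w \<otimes> Vee X y) \<otimes> y \<otimes> w"
    "Cod X (ev_ten X y w) = One X (Trg X (y \<otimes> w))"
    using assms by (simp_all add: ev_ten_def)
  have d: "is_dual X (y \<otimes> w) (Vee X (y \<otimes> w)) (Ev X (y \<otimes> w)) (Coev X (y \<otimes> w))"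
    using assms by (intro vee_dual) simp
  have t: "?\<theta> \<in> Arr X" "Dom X ?\<theta> = Vee X w \<otimes> Vee X y" "Cod X ?\<theta> = Vee X (y \<otimes> w)"
    using dual_map_arr[OF cstar_2category_axioms d _ _ e] assms by simp_all
  have u: "?\<theta>\<dagger> \<cdot> ?\<theta> = \<i>\<d> (Vee X w \<otimes> Vee X y)" "?\<theta> \<cdot> ?\<theta>\<dagger> = \<i>\<d> (Vee X (y \<otimes> w))"
    using vee_ten_unitary[of y _ _ w] assms t by (simp_all add: unitary_def)
  have "Ev X (y \<otimes> w) \<cdot> (?\<theta> \<star> \<i>\<d> (y \<otimes> w)) = ev_ten X y w"
    using ev_dual_map[OF cstar_2category_axioms d _ _ e] assms by simp
  then have "ev_ten X y w \<cdot> (?\<theta>\<dagger> \<star> \<i>\<d> (y \<otimes> w)) = (Ev X (y \<otimes> w) \<cdot> (?\<theta> \<star> \<i>\<d> (y \<otimes> w))) \<cdot> (?\<theta>\<dagger> \<star> \<i>\<d> (y \<otimes> w))"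
    by simp
  also have "\<dots> = Ev X (y \<otimes> w)"
    using t u assms by (simp add: exchange)
  finally show thesis using that t u by simp
qed

text \<open>
  Closing the strand \<open>y\<close> on the left and then taking the trace on \<open>w\<close> is the trace on \<open>y \<otimes> w\<close>.  For
  the trace that closes strands on the left, this is the nesting of the evaluation of \<open>y \<otimes> w\<close>.
\<close>

lemma partial_trace_left:
  assumes o: "y \<in> Obj X" "w \<in> Obj X" "Trg X y = Src X w"
    and h: "h \<in> Arr X" "Dom X h = y \<otimes> w" "Cod X h = y \<otimes> w"
    and E: "E = Lun X w \<cdot> (Ev X y \<star> \<i>\<d> w) \<cdot> (Asc X (Vee X y) y w)\<dagger>"
  shows "trace_left X w (E \<cdot> (\<i>\<d> (Vee X y) \<star> h) \<cdot> E\<dagger>) = trace_left X (y \<otimes> w) h"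
proof -
  let ?V = "Vee X y" and ?W = "Vee X w" and ?x = "y \<otimes> w"
  obtain \<theta> where \<theta>: "\<theta> \<in> Arr X" "Dom X \<theta> = ?W \<otimes> ?V" "Cod X \<theta> = Vee X ?x"
    "\<theta>\<dagger> \<cdot> \<theta> = \<i>\<d> (?W \<otimes> ?V)" "Ev X ?x = ev_ten X y w \<cdot> (\<theta>\<dagger> \<star> \<i>\<d> ?x)"
    using ev_ten_eq[OF o] .
  have tE: "E \<in> Arr X" "Dom X E = ?V \<otimes> y \<otimes> w" "Cod X E = w"
    using o by (simp_all add: E)
  have e: "ev_ten X y w = Ev X w \<cdot> (\<i>\<d> ?W \<star> E) \<cdot> Asc X ?W ?V ?x"
    by (simp add: ev_ten_def E)
  have te: "ev_ten X y w \<in> Arr X" "Dom X (ev_ten X y w) = (?W \<otimes> ?V) \<otimes> ?x"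
    "Cod X (ev_ten X y w) = One X (Trg X w)"
    using o tE by (simp_all add: e)
  have "Ev X ?x \<cdot> (\<i>\<d> (Vee X ?x) \<star> h) \<cdot> (Ev X ?x)\<dagger>
    = ev_ten X y w \<cdot> ((\<theta>\<dagger> \<star> \<i>\<d> ?x) \<cdot> (\<i>\<d> (Vee X ?x) \<star> h) \<cdot> (\<theta> \<star> \<i>\<d> ?x)) \<cdot> (ev_ten X y w)\<dagger>"
    unfolding \<theta>(5) using \<theta>(1-3) te o h by simp
  also have "(\<theta>\<dagger> \<star> \<i>\<d> ?x) \<cdot> (\<i>\<d> (Vee X ?x) \<star> h) \<cdot> (\<theta> \<star> \<i>\<d> ?x) = \<i>\<d> (?W \<otimes> ?V) \<star> h"
    using \<theta>(1-4) o h by (simp add: exchange)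
  also have "ev_ten X y w \<cdot> (\<i>\<d> (?W \<otimes> ?V) \<star> h) \<cdot> (ev_ten X y w)\<dagger>
    = Ev X w \<cdot> (\<i>\<d> ?W \<star> E) \<cdot> (Asc X ?W ?V ?x \<cdot> (\<i>\<d> (?W \<otimes> ?V) \<star> h)) \<cdot> (Asc X ?W ?V ?x)\<dagger> \<cdot> (\<i>\<d> ?W \<star> E\<dagger>) \<cdot> (Ev X w)\<dagger>"
    unfolding e using tE o h by simp
  also have "Asc X ?W ?V ?x \<cdot> (\<i>\<d> (?W \<otimes> ?V) \<star> h) = (\<i>\<d> ?W \<star> \<i>\<d> ?V \<star> h) \<cdot> Asc X ?W ?V ?x"
    using o h by (simp add: asc_out)
  also have "Ev X w \<cdot> (\<i>\<d> ?W \<star> E) \<cdot> ((\<i>\<d> ?W \<star> \<i>\<d> ?V \<star> h) \<cdot> Asc X ?W ?V ?x) \<cdot> (Asc X ?W ?V ?x)\<dagger> \<cdot> (\<i>\<d> ?W \<star> E\<dagger>) \<cdot> (Ev X w)\<dagger>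
    = Ev X w \<cdot> (\<i>\<d> ?W \<star> (E \<cdot> (\<i>\<d> ?V \<star> h) \<cdot> E\<dagger>)) \<cdot> (Ev X w)\<dagger>"
    using tE o h by (simp add: whisker_left)
  finally have "trace_right X ?x h = trace_right X w (E \<cdot> (\<i>\<d> ?V \<star> h) \<cdot> E\<dagger>)"
    using o by (simp add: trace_right_def)
  then show ?thesis using o h tE by (simp add: weight_spherical)
qed

text \<open>
  By sphericality \<open>w\<close> may be closed on the left.  By isotopy it may then be closed before \<open>z\<close> is
  closed on the right, which leaves the trace on \<open>z\<close> of a partial trace over \<open>w\<close> as in
  \<open>partial_trace_left\<close>.
\<close>

lemma partial_trace_right:
  assumes o: "w \<in> Obj X" "z \<in> Obj X" "Trg X w = Src X z"
    and h: "h \<in> Arr X" "Dom X h = w \<otimes> z" "Cod X h = w \<otimes> z"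
    and P: "P = Run X w \<cdot> (\<i>\<d> w \<star> (Coev X z)\<dagger>) \<cdot> Asc X w z (Vee X z)"
  shows "trace_left X w (P \<cdot> (h \<star> \<i>\<d> (Vee X z)) \<cdot> P\<dagger>) = trace_left X (w \<otimes> z) h"
proof -
  let ?V = "Vee X w" and ?U = "Vee X z" and ?x = "w \<otimes> z"
  define E where "E = Lun X z \<cdot> (Ev X w \<star> \<i>\<d> z) \<cdot> (Asc X ?V w z)\<dagger>"
  have tE: "E \<in> Arr X" "Dom X E = ?V \<otimes> w \<otimes> z" "Cod X E = z"
    using o by (simp_all add: E_def)
  have tP: "P \<in> Arr X" "Dom X P = (w \<otimes> z) \<otimes> ?U" "Cod X P = w"
    using o by (simp_all add: P)
  let ?n = "(Coev X z)\<dagger>" and ?a = "Asc X ?V (w \<otimes> z) ?U"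
  have i: "Ev X w \<cdot> (\<i>\<d> ?V \<star> P) = ?n \<cdot> (E \<star> \<i>\<d> ?U) \<cdot> ?a\<dagger>"
    unfolding P E_def using o by (intro isotopy[OF cstar_2category_axioms]) simp_all
  have j: "(\<i>\<d> ?V \<star> P\<dagger>) \<cdot> (Ev X w)\<dagger> = ?a \<cdot> (E\<dagger> \<star> \<i>\<d> ?U) \<cdot> Coev X z"
    using arg_cong[OF i, of "Dag X"] tE tP o by simp
  have "Ev X w \<cdot> (\<i>\<d> ?V \<star> (P \<cdot> (h \<star> \<i>\<d> ?U) \<cdot> P\<dagger>)) \<cdot> (Ev X w)\<dagger>
    = (Ev X w \<cdot> (\<i>\<d> ?V \<star> P)) \<cdot> (\<i>\<d> ?V \<star> h \<star> \<i>\<d> ?U) \<cdot> ((\<i>\<d> ?V \<star> P\<dagger>) \<cdot> (Ev X w)\<dagger>)"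
    using tE tP o h by (simp add: whisker_left)
  also have "\<dots> = ?n \<cdot> ((E \<cdot> (\<i>\<d> ?V \<star> h) \<cdot> E\<dagger>) \<star> \<i>\<d> ?U) \<cdot> Coev X z"
    unfolding i j using tE tP o h by (simp add: whisker_right asc_out_then)
  finally have "trace_right X w (P \<cdot> (h \<star> \<i>\<d> ?U) \<cdot> P\<dagger>) = trace_left X z (E \<cdot> (\<i>\<d> ?V \<star> h) \<cdot> E\<dagger>)"
    using o by (simp add: trace_right_def trace_left_def)
  also have "\<dots> = trace_left X (w \<otimes> z) h"
    using partial_trace_left[OF o h E_def] .
  finally show ?thesis using o h tP by (simp add: weight_spherical)
qed

end

section \<open>Hom categories as 2-Hilbert spaces\<close>

lemma hom_hilb_sel [simp]:
  "Obj (hom_hilb X a b) = hom1 X a b"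
  "Arr (hom_hilb X a b) = {f \<in> Arr X. Dom X f \<in> hom1 X a b}"
  "Dom (hom_hilb X a b) = Dom X" "Cod (hom_hilb X a b) = Cod X"
  "Idn (hom_hilb X a b) = Idn X" "Cmp (hom_hilb X a b) = Cmp X"
  "Zer (hom_hilb X a b) = Zer X" "Add (hom_hilb X a b) = Add X"
  "Scl (hom_hilb X a b) = Scl X" "Dag (hom_hilb X a b) = Dag X"
  "Tr (hom_hilb X a b) = trace_left X"
  by (simp_all add: hom_hilb_def hom_cat_def dcat.defs twohilb.defs)

text \<open>Semisimplicity is a property of the underlying linear dagger category.\<close>

lemma finitely_semisimple_hom_hilb:
  "finitely_semisimple_cstar_category (hom_hilb X a b) \<longleftrightarrow> finitely_semisimple_cstar_category (hom_cat X a b)"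
  unfolding finitely_semisimple_cstar_category_def finitely_semisimple_cstar_category_axioms_def
    semisimple_cstar_category_def semisimple_cstar_category_axioms_def
    cstar_category_def cstar_category_axioms_def lin_dagger_category_def
    cstar_norm_def orth_sum_def simple_def isomorphic_def is_iso_def csum_def hom_def
  by (simp only: hom_hilb_sel hom_cat_sel)

lemma mat_apply [simp]: "i < n \<Longrightarrow> j < n \<Longrightarrow> mat n f i j = f i j"
  by (simp add: mat_def)

lemma mat_mat [simp]: "mat n (mat n f) = mat n f"
  by (simp add: mat_def fun_eq_iff)

lemma mat_eqI:
  assumes "mat n f = f" "mat n g = g" "\<And>i j. i < n \<Longrightarrow> j < n \<Longrightarrow> f i j = g i j"
  shows "f = g"
proof -
  have "mat n f = mat n g" using assms(3) by (simp add: mat_def fun_eq_iff)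
  then show ?thesis unfolding assms(1,2) .
qed

context finite_unitary_2category
begin

text \<open>
  With the objects in this order, the \<open>(1, 0)\<close>-entry of a matrix is a 1-morphism from \<open>a\<close> to \<open>b\<close>.
\<close>

definition link2 :: "'c \<Rightarrow> 'c \<Rightarrow> (nat \<Rightarrow> nat \<Rightarrow> 'a, nat \<Rightarrow> nat \<Rightarrow> 'b) dcat"
  where "link2 a b = hom_cat (linking B [a, b]) () ()"

lemma link2_sel [simp]:
  "Idn (link2 a b) M = mat 2 (\<lambda>i j. \<i>\<d> (M i j))"
  "Cmp (link2 a b) g f = mat 2 (\<lambda>i j. g i j \<cdot> f i j)"
  "Zer (link2 a b) M N = mat 2 (\<lambda>i j. Zer B (M i j) (N i j))"
  "Add (link2 a b) f g = mat 2 (\<lambda>i j. f i j \<oplus> g i j)"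
  "Scl (link2 a b) r f = mat 2 (\<lambda>i j. r \<odot> f i j)"
  "Dag (link2 a b) f = mat 2 (\<lambda>i j. (f i j)\<dagger>)"
  "Dom (link2 a b) f = mat 2 (\<lambda>i j. Dom B (f i j))"
  "Cod (link2 a b) f = mat 2 (\<lambda>i j. Cod B (f i j))"
  by (simp_all add: link2_def linking_def Let_def numeral_2_eq_2)

lemma link2_Obj:
  "M \<in> Obj (link2 a b) \<longleftrightarrow> (\<forall>i < 2. \<forall>j < 2. M i j \<in> hom1 B ([a, b] ! j) ([a, b] ! i)) \<and> mat 2 M = M"
  by (simp add: link2_def linking_def Let_def numeral_2_eq_2)

lemma link2_hom:
  assumes "M \<in> Obj (link2 a b)" "N \<in> Obj (link2 a b)"
  shows "f \<in> hom (link2 a b) M N \<longleftrightarrow> (\<forall>i < 2. \<forall>j < 2. f i j \<in> hom B (M i j) (N i j)) \<and> mat 2 f = f"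
proof
  assume f: "f \<in> hom (link2 a b) M N"
  then have "mat 2 f = f" by (simp add: link2_def linking_def Let_def numeral_2_eq_2)
  moreover have "f i j \<in> hom B (M i j) (N i j)" if "i < 2" "j < 2" for i j
  proof -
    have "M i j = mat 2 (\<lambda>i j. Dom B (f i j)) i j" "N i j = mat 2 (\<lambda>i j. Cod B (f i j)) i j"
      using f by (auto simp del: mat_apply)
    moreover have "f i j \<in> Arr B" using f that by (simp add: link2_def linking_def Let_def numeral_2_eq_2)
    ultimately show ?thesis using that by simp
  qed
  ultimately show "(\<forall>i < 2. \<forall>j < 2. f i j \<in> hom B (M i j) (N i j)) \<and> mat 2 f = f" by blast
next
  assume f: "(\<forall>i < 2. \<forall>j < 2. f i j \<in> hom B (M i j) (N i j)) \<and> mat 2 f = f"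
  have "mat 2 (\<lambda>i j. Dom B (f i j)) = M"
    by (rule mat_eqI[of 2]) (use f assms in \<open>auto simp: link2_Obj\<close>)
  moreover have "mat 2 (\<lambda>i j. Cod B (f i j)) = N"
    by (rule mat_eqI[of 2]) (use f assms in \<open>auto simp: link2_Obj\<close>)
  ultimately show "f \<in> hom (link2 a b) M N"
    using f assms by (simp add: link2_Obj) (simp add: link2_def linking_def Let_def numeral_2_eq_2)
qed

lemma link2_csum:
  "i < 2 \<Longrightarrow> j < 2 \<Longrightarrow> csum (link2 a b) M N fs i j = csum B (M i j) (N i j) (map (\<lambda>f. f i j) fs)"
  by (induction fs) (simp_all add: csum_def)

lemma link2_finitely_semisimple:
  "a \<in> Ob0 B \<Longrightarrow> b \<in> Ob0 B \<Longrightarrow> finitely_semisimple_cstar_category (link2 a b)"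
  using unitary_multifusion.finitely_semisimple[OF linking_multifusion[of "[a, b]"]] by (simp add: link2_def)

lemma zero_object_hom:
  assumes "f \<in> Arr B" "\<i>\<d> (Cod B f) = Zer B (Cod B f) (Cod B f)"
  shows "f = Zer B (Dom B f) (Cod B f)"
proof -
  have "f = \<i>\<d> (Cod B f) \<cdot> f" using assms(1) by simp
  also have "\<dots> = Zer B (Dom B f) (Cod B f)"
    unfolding assms(2) using assms(1) by (intro zero_cmp) simp_all
  finally show ?thesis .
qed

text \<open>
  The hom category from \<open>a\<close> to \<open>b\<close> is a block of the linking category of \<open>a\<close> and \<open>b\<close>.  Taking the
  \<open>(1, 0)\<close>-entry preserves composition, adjoints, identities and sums, and a 1-morphism is extended
  to a matrix by zero objects, which are the empty orthogonal sums.  Direct sums, splittings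
  of projections and decompositions are formed for the extended matrices and then restricted
  to the entry.  Simple objects correspond because all 2-morphisms into a zero object
  vanish.
\<close>

lemma finitely_semisimple_hom_cat:
  assumes ab: "a \<in> Ob0 B" "b \<in> Ob0 B"
  shows "finitely_semisimple_cstar_category (hom_cat B a b)"
proof -
  let ?H = "link2 a b" and ?C = "hom_cat B a b"
  \<comment> \<open>the index \<open>1\<close> of the entry has to keep the form in which the facts about \<open>?p\<close> mention it\<close>
  note One_nat_def [simp del]
  interpret H: finitely_semisimple_cstar_category ?H by (rule link2_finitely_semisimple[OF ab])
  interpret C: cstar_category ?C by (rule hom_cat_cstar[OF ab])
  let ?p = "\<lambda>M. M (1::nat) (0::nat)"
  obtain Z where Z: "Z \<in> Obj ?H" "Idn ?H Z = Zer ?H Z Z"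
    using H.ex_orth_sum[of "[]"] by (auto simp: orth_sum_def csum_def)
  have Zid: "\<i>\<d> (Z i j) = Zer B (Z i j) (Z i j)" if "i < 2" "j < 2" for i j
    using fun_cong[OF fun_cong[OF Z(2)], of i j] that by simp
  have Zobj: "Z i j \<in> Obj B" "Src B (Z i j) = [a, b] ! j" "Trg B (Z i j) = [a, b] ! i" if "i < 2" "j < 2" for i j
    using Z(1) that by (simp_all add: link2_Obj)
  \<comment> \<open>extension of 1-morphisms and of 2-morphisms by the zero objects \<open>Z i j\<close>\<close>
  define E where "E x = mat 2 (\<lambda>i j. if i = 1 \<and> j = 0 then x else Z i j)" for x
  define E2 where "E2 f = mat 2 (\<lambda>i j. if i = 1 \<and> j = 0 then f else \<i>\<d> (Z i j))" for f
  have E: "E x \<in> Obj ?H" if "x \<in> Obj ?C" for x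
    using that Zobj by (auto simp: link2_Obj E_def)
  have E2: "E2 f \<in> hom ?H (E x) (E y)" if "x \<in> Obj ?C" "y \<in> Obj ?C" "f \<in> hom B x y" for f x y
    using that Zobj unfolding link2_hom[OF E[OF that(1)] E[OF that(2)]] by (auto simp: E_def E2_def)
  have pE [simp]: "?p (E x) = x" "?p (E2 x') = x'" for x x' by (simp_all add: E_def E2_def)
  have pObj: "?p M \<in> Obj ?C" if "M \<in> Obj ?H" for M using that by (simp add: link2_Obj)
  have phom: "?p f \<in> hom B (?p M) (?p N)" if "M \<in> Obj ?H" "N \<in> Obj ?H" "f \<in> hom ?H M N" for f M N
    using that(3) unfolding link2_hom[OF that(1,2)] by simp
  have homC: "f \<in> hom ?C x y \<longleftrightarrow> f \<in> hom B x y" if "x \<in> Obj ?C" for f x y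
    using that by auto
  have porth: "orth_sum ?C (map ?p xs) (?p s) (map ?p vs)"
    if o: "orth_sum ?H xs s vs" and xs: "set xs \<subseteq> Obj ?H" for xs s vs
  proof -
    have s: "s \<in> Obj ?H" and l: "length vs = length xs" using o by (auto simp: orth_sum_def)
    have v: "vs ! j \<in> hom ?H (xs ! j) s" if "j < length xs" for j
      using o that unfolding orth_sum_def by blast
    have xo: "xs ! j \<in> Obj ?H" if "j < length xs" for j using xs that by auto
    have 1: "?p (vs ! j) \<in> hom ?C (?p (xs ! j)) (?p s)" if "j < length xs" for j
      using phom[OF xo s v] homC[OF pObj[OF xo]] that by blast
    have 2: "Dag B (?p (vs ! j)) \<cdot> ?p (vs ! k) =
      (if j = k then \<i>\<d> (?p (xs ! j)) else Zer B (?p (xs ! k)) (?p (xs ! j)))"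
      if jk: "j < length xs" "k < length xs" for j k
    proof -
      have "Cmp ?H (Dag ?H (vs ! j)) (vs ! k) = (if j = k then Idn ?H (xs ! j) else Zer ?H (xs ! k) (xs ! j))"
        using o that unfolding orth_sum_def by blast
      from fun_cong[OF fun_cong[OF this], of 1 0] show ?thesis by (cases "j = k") simp_all
    qed
    have "csum ?H s s (map (\<lambda>v. Cmp ?H v (Dag ?H v)) vs) = Idn ?H s"
      using o unfolding orth_sum_def by blast
    from fun_cong[OF fun_cong[OF this], of 1 0]
    have 3: "csum B (?p s) (?p s) (map (\<lambda>v. v \<cdot> v\<dagger>) (map ?p vs)) = \<i>\<d> (?p s)"
      by (simp add: link2_csum comp_def)
    have 4: "csum ?C = csum B" by (simp add: csum_def fun_eq_iff)
    have 5: "\<forall>j < length xs. ?p (xs ! j) \<in> Obj ?C" using pObj[OF xo] by blast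
    show ?thesis unfolding orth_sum_def
      using pObj[OF s] l 1 2 3 4 5 by simp
  qed
  have zent: "v i j = Zer B (Dom B (v i j)) (Cod B (v i j))"
    if "v \<in> hom ?H M (E x)" "M \<in> Obj ?H" "x \<in> Obj ?C" "i < 2" "j < 2" "(i, j) \<noteq> (1, 0)" for v M x i j
  proof -
    have v: "v i j \<in> hom B (M i j) (Z i j)"
      using that link2_hom[OF that(2) E[OF that(3)], of v] by (auto simp: E_def)
    then show ?thesis using Zid[OF that(4,5)] by (intro zero_object_hom) simp_all
  qed
  show ?thesis
  proof (unfold_locales, goal_cases)
    case (1 xs)
    have s: "set (map E xs) \<subseteq> Obj ?H" using 1 E by fastforce
    obtain s vs where "orth_sum ?H (map E xs) s vs" using H.ex_orth_sum[OF s] by blast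
    then have "orth_sum ?C (map ?p (map E xs)) (?p s) (map ?p vs)" using s by (intro porth)
    then show ?case by (auto simp: comp_def)
  next
    case (2 p x)
    then have x: "x \<in> Obj ?C" by auto
    have Ep: "E2 p \<in> hom ?H (E x) (E x)" using 2 x by (intro E2) simp_all
    moreover have "Cmp ?H (E2 p) (E2 p) = E2 p"
      by (rule mat_eqI[of 2]) (use 2 Zobj in \<open>auto simp: E2_def\<close>)
    moreover have "Dag ?H (E2 p) = E2 p"
      by (rule mat_eqI[of 2]) (use 2 Zobj in \<open>auto simp: E2_def\<close>)
    ultimately obtain Y V where Y: "Y \<in> Obj ?H" "V \<in> hom ?H Y (E x)"
       "Cmp ?H (Dag ?H V) V = Idn ?H Y" "Cmp ?H V (Dag ?H V) = E2 p"
      using H.projection_splits[of "E2 p" "E x"] by blast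
    have "?p V \<in> hom ?C (?p Y) x" using phom[OF Y(1) E[OF x] Y(2)] pObj[OF Y(1)] by simp
    moreover have "Dag B (?p V) \<cdot> ?p V = \<i>\<d> (?p Y)" "?p V \<cdot> Dag B (?p V) = p"
      using fun_cong[OF fun_cong[OF Y(3)], of 1 0] fun_cong[OF fun_cong[OF Y(4)], of 1 0] by simp_all
    ultimately show ?case using pObj[OF Y(1)] unfolding hom_cat_sel by blast
  next
    case (3 x)
    obtain ss vs where ss: "\<forall>s \<in> set ss. simple ?H s" "orth_sum ?H ss (E x) vs"
      using H.ex_simple_decomposition[OF E[OF 3]] by blast
    have so: "set ss \<subseteq> Obj ?H" using ss(1) by (auto simp: simple_def)
    have "simple ?C (?p S)" if S: "S \<in> set ss" for S
    proof -
      obtain k where k: "k < length ss" "S = ss ! k" using S by (auto simp: in_set_conv_nth)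
      have V: "vs ! k \<in> hom ?H S (E x)" "Cmp ?H (Dag ?H (vs ! k)) (vs ! k) = Idn ?H S"
        using ss(2) k unfolding orth_sum_def by auto
      have sS: "simple ?H S" and oS: "S \<in> Obj ?H" using ss(1) S by (auto simp: simple_def)
      have Sij: "S i j \<in> Obj B" if "i < 2" "j < 2" for i j using oS that by (simp add: link2_Obj)
      \<comment> \<open>a summand of an extended matrix vanishes off the entry, since it embeds into a zero object\<close>
      have off: "\<i>\<d> (S i j) = Zer B (S i j) (S i j)" if ij: "i < 2" "j < 2" "(i, j) \<noteq> (1, 0)" for i j
      proof -
        let ?v = "(vs ! k) i j"
        have v: "?v \<in> hom B (S i j) (Z i j)"
          using ij V link2_hom[OF oS E[OF 3], of "vs ! k"] by (auto simp: E_def)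
        have "\<i>\<d> (S i j) = ?v\<dagger> \<cdot> ?v"
          using fun_cong[OF fun_cong[OF V(2)], of i j] ij by simp
        also have "\<dots> = ?v\<dagger> \<cdot> Zer B (S i j) (Z i j)"
          using zent[OF V(1) oS 3 ij] v by simp
        also have "\<dots> = Zer B (S i j) (S i j)"
          using v Zobj[OF ij(1,2)] Sij[OF ij(1,2)] src_cod[of ?v] trg_cod[of ?v] by (subst cmp_zero) auto
        finally show ?thesis .
      qed
      have ne: "\<i>\<d> (?p S) \<noteq> Zer B (?p S) (?p S)"
      proof
        assume z: "\<i>\<d> (?p S) = Zer B (?p S) (?p S)"
        have "Idn ?H S = Zer ?H S S"
        proof (rule mat_eqI[of 2])
          fix i j :: nat assume "i < 2" "j < 2"
          then show "Idn ?H S i j = Zer ?H S S i j" using z off[of i j] by (cases "(i, j) = (1, 0)") simp_all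
        qed simp_all
        then show False using sS by (simp add: simple_def)
      qed
      have sub: "f \<in> {r \<odot> \<i>\<d> (?p S) | r. True}" if f: "f \<in> hom B (?p S) (?p S)" for f
      proof -
        let ?F = "mat 2 (\<lambda>i j. if i = 1 \<and> j = 0 then f else \<i>\<d> (S i j))"
        have "?F \<in> hom ?H S S" using f Sij unfolding link2_hom[OF oS oS] by auto
        then obtain r where "?F = Scl ?H r (Idn ?H S)" using sS unfolding simple_def by blast
        from fun_cong[OF fun_cong[OF this], of 1 0] show ?thesis by auto
      qed
      have pS: "?p S \<in> Obj ?C" using pObj[OF oS] .
      have "hom ?C (?p S) (?p S) = {r \<odot> \<i>\<d> (?p S) | r. True}"
        using sub pS unfolding set_eq_iff homC[OF pS] by auto
      then show ?thesis using ne pS by (simp add: simple_def)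
    qed
    moreover have "orth_sum ?C (map ?p ss) x (map ?p vs)" using porth[OF ss(2) so] by simp
    ultimately show ?case by (intro exI[of _ "map ?p ss"] exI[of _ "map ?p vs"]) auto
  next
    case 4
    obtain T where T: "finite T" "\<And>s. simple ?H s \<Longrightarrow> \<exists>t \<in> T. isomorphic ?H s t"
      using H.finitely_many_simples by blast
    have "\<exists>t \<in> ?p ` T. isomorphic ?C s t" if s: "simple ?C s" for s
    proof -
      have so: "s \<in> Obj ?C" and sid: "\<i>\<d> s \<noteq> Zer B s s"
        and sh: "hom ?C s s = {r \<odot> \<i>\<d> s | r. True}" using s by (auto simp: simple_def)
      have Es: "E s \<in> Obj ?H" by (rule E[OF so])
      have "Idn ?H (E s) \<noteq> Zer ?H (E s) (E s)"
      proof
        assume "Idn ?H (E s) = Zer ?H (E s) (E s)"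
        from fun_cong[OF fun_cong[OF this], of 1 0] show False using sid by simp
      qed
      moreover have "\<exists>r. f = Scl ?H r (Idn ?H (E s))" if f: "f \<in> hom ?H (E s) (E s)" for f
      proof -
        have "?p f \<in> hom ?C s s" using phom[OF Es Es f] so by simp
        then obtain r where r: "?p f = r \<odot> \<i>\<d> s" unfolding sh by blast
        have "f = Scl ?H r (Idn ?H (E s))"
        proof (rule mat_eqI[of 2])
          show "mat 2 f = f" using f unfolding link2_hom[OF Es Es] by blast
          fix i j :: nat assume ij: "i < 2" "j < 2"
          have fij: "f i j \<in> hom B (E s i j) (E s i j)" using f ij unfolding link2_hom[OF Es Es] by blast
          show "f i j = Scl ?H r (Idn ?H (E s)) i j"
          proof (cases "(i, j) = (1, 0)")
            case False
            then have Eij: "E s i j = Z i j" using ij by (auto simp: E_def)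
            have "f i j = Zer B (Z i j) (Z i j)" using zent[OF f Es so ij False] fij Eij by simp
            moreover have "r \<odot> \<i>\<d> (Z i j) = Zer B (Z i j) (Z i j)"
              using zero_object_hom[of "r \<odot> \<i>\<d> (Z i j)"] Zobj[OF ij] Zid[OF ij] by simp
            ultimately show ?thesis using ij Eij by simp
          qed (use r in simp)
        qed simp
        then show ?thesis by blast
      qed
      moreover have "Scl ?H r (Idn ?H (E s)) \<in> hom ?H (E s) (E s)" for r
        using H.scl_hom[OF H.id_hom[OF Es]] .
      ultimately have "simple ?H (E s)" using Es unfolding simple_def by blast
      then obtain t f where t: "t \<in> T" "f \<in> hom ?H (E s) t" "is_iso ?H f"
        using T(2) unfolding isomorphic_def by blast
      then obtain g where g: "g \<in> hom ?H (Cod ?H f) (Dom ?H f)" "Cmp ?H g f = Idn ?H (Dom ?H f)"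
        "Cmp ?H f g = Idn ?H (Cod ?H f)" unfolding is_iso_def by blast
      have df: "Dom ?H f = E s" "Cod ?H f = t" and to: "t \<in> Obj ?H"
        using t(2) H.arr_obj[of f] by (auto simp: hom_def)
      note g = g[unfolded df]
      have pf: "?p f \<in> hom B s (?p t)" using phom[OF Es to t(2)] by simp
      have pg: "?p g \<in> hom B (?p t) s" using phom[OF to Es g(1)] by simp
      have pt: "?p t \<in> Obj ?C" by (rule pObj[OF to])
      have "?p g \<cdot> ?p f = \<i>\<d> s" "?p f \<cdot> ?p g = \<i>\<d> (?p t)"
        using fun_cong[OF fun_cong[OF g(2)], of 1 0] fun_cong[OF fun_cong[OF g(3)], of 1 0] by simp_all
      then have "is_iso ?C (?p f)" using pf pg so pt unfolding is_iso_def by auto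
      then have "isomorphic ?C s (?p t)" using pf so unfolding isomorphic_def by auto
      then show ?thesis using t(1) by blast
    qed
    then show ?case using T(1) by (intro exI[of _ "?p ` T"]) auto
  qed
qed

end

context weighted_2category
begin

lemma two_hilbert_hom_hilb:
  assumes "a \<in> Ob0 X" "b \<in> Ob0 X"
  shows "two_hilbert (hom_hilb X a b)"
proof -
  interpret finitely_semisimple_cstar_category "hom_hilb X a b"
    using finitely_semisimple_hom_cat[OF assms] by (simp only: finitely_semisimple_hom_hilb)
  show ?thesis
  proof (unfold_locales, goal_cases)
    case (1 c)
    then show ?case
      unfolding faithful_positive_functional_def
    proof (intro conjI ballI allI impI, goal_cases)
      case (5 f)
      then show ?case using trace_left_positive(3)[of f c] by simp
    qed (simp_all add: trace_left_linear trace_left_positive(1,2))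
  next
    case (2 f x y g)
    then show ?case using trace_left_commute[of f g] by auto
  qed
qed

end

section \<open>Unitary adjunctions of dagger functors\<close>

context lin_dagger_category
begin

lemma dom_obj [simp]: "f \<in> Arr C \<Longrightarrow> Dom C f \<in> Obj C"
  and cod_obj [simp]: "f \<in> Arr C \<Longrightarrow> Cod C f \<in> Obj C"
  using arr_obj by auto

lemma idn_arr [simp]: "x \<in> Obj C \<Longrightarrow> \<i>\<d> x \<in> Arr C" "x \<in> Obj C \<Longrightarrow> Dom C (\<i>\<d> x) = x" "x \<in> Obj C \<Longrightarrow> Cod C (\<i>\<d> x) = x"
  using id_hom[of x] by simp_all

lemma cmp_arr [simp]:
  assumes "f \<in> Arr C" "g \<in> Arr C" "Dom C g = Cod C f"
  shows "g \<cdot> f \<in> Arr C" "Dom C (g \<cdot> f) = Dom C f" "Cod C (g \<cdot> f) = Cod C g"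
  using comp_hom[of f "Dom C f" "Cod C f" g "Cod C g"] assms by auto

lemma assoc [simp]:
  assumes "f \<in> Arr C" "g \<in> Arr C" "h \<in> Arr C" "Dom C g = Cod C f" "Dom C h = Cod C g"
  shows "(h \<cdot> g) \<cdot> f = h \<cdot> g \<cdot> f"
  using comp_assoc[of f "Dom C f" "Cod C f" g "Cod C g" h "Cod C h"] assms by auto

lemma cmp_id [simp]: "f \<in> Arr C \<Longrightarrow> Cod C f = x \<Longrightarrow> \<i>\<d> x \<cdot> f = f" "f \<in> Arr C \<Longrightarrow> Dom C f = x \<Longrightarrow> f \<cdot> \<i>\<d> x = f"
  using id_left[of f] id_right[of f] by auto

lemma dag_arr [simp]:
  assumes "f \<in> Arr C"
  shows "f\<dagger> \<in> Arr C" "Dom C (f\<dagger>) = Cod C f" "Cod C (f\<dagger>) = Dom C f" "(f\<dagger>)\<dagger> = f"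
  using dag_hom[of f "Dom C f" "Cod C f"] dag_dag[of f "Dom C f" "Cod C f"] assms by auto

lemma dag_cmp [simp]:
  assumes "f \<in> Arr C" "g \<in> Arr C" "Dom C g = Cod C f"
  shows "(g \<cdot> f)\<dagger> = f\<dagger> \<cdot> g\<dagger>"
  using dag_comp[of f "Dom C f" "Cod C f" g "Cod C g"] assms by auto

lemma dag_id [simp]:
  assumes "x \<in> Obj C"
  shows "(\<i>\<d> x)\<dagger> = \<i>\<d> x"
proof -
  have "(\<i>\<d> x \<cdot> (\<i>\<d> x)\<dagger>)\<dagger> = ((\<i>\<d> x)\<dagger>)\<dagger> \<cdot> (\<i>\<d> x)\<dagger>"
    using assms by (intro dag_cmp) simp_all
  then show ?thesis using assms by simp
qed

end

text \<open>With \<open>k = (u - 1)\<^sup>\<dagger>\<close>, the hypothesis says that \<open>Tr ((u - 1)\<^sup>\<dagger> (u - 1)) = 0\<close>.\<close>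

lemma (in two_hilbert) trace_nondegenerate:
  assumes u: "u \<in> Arr C" "Dom C u = x" "Cod C u = x"
    and tr: "\<And>k. k \<in> Arr C \<Longrightarrow> Dom C k = x \<Longrightarrow> Cod C k = x \<Longrightarrow> Tr C x (k \<cdot> u) = Tr C x k"
  shows "u = \<i>\<d> x"
proof -
  have x: "x \<in> Obj C" using u by auto
  note p = trace_functional[OF x, unfolded faithful_positive_functional_def]
  let ?n = "(- 1) \<odot> \<i>\<d> x"
  have i: "\<i>\<d> x \<in> hom C x x" and n: "?n \<in> hom C x x" and u': "u \<in> hom C x x"
    using id_hom[OF x] scl_hom u by simp_all
  define D where "D = u \<oplus> ?n"
  have D: "D \<in> hom C x x" unfolding D_def by (rule add_hom[OF u' n])
  have d: "D\<dagger> \<in> hom C x x" using dag_hom[OF D] .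
  have "D\<dagger> \<cdot> D = D\<dagger> \<cdot> u \<oplus> (- 1) \<odot> D\<dagger>"
    using comp_add_right[OF u' n d] comp_scl_right[OF i d, of "- 1"] id_right[OF d] by (simp add: D_def)
  moreover have "D\<dagger> \<cdot> u \<in> hom C x x" "(- 1) \<odot> D\<dagger> \<in> hom C x x"
    using comp_hom[OF u' d] scl_hom[OF d] by auto
  ultimately have "Tr C x (D\<dagger> \<cdot> D) = Tr C x (D\<dagger> \<cdot> u) - Tr C x (D\<dagger>)"
    using p d by simp
  then have "Tr C x (D\<dagger> \<cdot> D) = 0" using tr[of "D\<dagger>"] d by simp
  then have "D = Zer C x x" using p D by blast
  then have "(u \<oplus> ?n) \<oplus> \<i>\<d> x = Zer C x x \<oplus> \<i>\<d> x" by (simp add: D_def)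
  moreover have "(u \<oplus> ?n) \<oplus> \<i>\<d> x = u"
    using add_assoc[OF u' n i] add_commute[OF n i] add_minus[OF i] add_zero[OF u'] by simp
  moreover have "Zer C x x \<oplus> \<i>\<d> x = \<i>\<d> x"
    using add_commute[OF zero_hom[OF x x] i] add_zero[OF i] by simp
  ultimately show ?thesis by simp
qed

text \<open>
  As in the calculus of 2-morphisms, the rules below replace membership in hom sets by equations
  for \<open>Dom\<close> and \<open>Cod\<close>.
\<close>

lemma dagger_functorD:
  assumes "dagger_functor F" "FDom F = A" "FCod F = B"
  shows "two_hilbert A" "two_hilbert B" "FO F \<in> extensional (Obj A)" "FM F \<in> extensional (Arr A)"
    "\<And>x. x \<in> Obj A \<Longrightarrow> FO F x \<in> Obj B"
    "\<And>f. f \<in> Arr A \<Longrightarrow> FM F f \<in> Arr B" "\<And>f. f \<in> Arr A \<Longrightarrow> Dom B (FM F f) = FO F (Dom A f)"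
    "\<And>f. f \<in> Arr A \<Longrightarrow> Cod B (FM F f) = FO F (Cod A f)"
    "\<And>x. x \<in> Obj A \<Longrightarrow> FM F (Idn A x) = Idn B (FO F x)"
    "\<And>f g. f \<in> Arr A \<Longrightarrow> g \<in> Arr A \<Longrightarrow> Dom A g = Cod A f \<Longrightarrow> FM F (Cmp A g f) = Cmp B (FM F g) (FM F f)"
    "\<And>f g. f \<in> Arr A \<Longrightarrow> g \<in> Arr A \<Longrightarrow> Dom A g = Dom A f \<Longrightarrow> Cod A g = Cod A f \<Longrightarrow> FM F (Add A f g) = Add B (FM F f) (FM F g)"
    "\<And>f r. f \<in> Arr A \<Longrightarrow> FM F (Scl A r f) = Scl B r (FM F f)"
    "\<And>f. f \<in> Arr A \<Longrightarrow> FM F (Dag A f) = Dag B (FM F f)"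
  using assms unfolding dagger_functor_def Let_def by (auto simp: PiE_def)

lemma dagger_functorI:
  assumes "FDom F = A" "FCod F = B"
   "two_hilbert A" "two_hilbert B" "FO F \<in> extensional (Obj A)" "FM F \<in> extensional (Arr A)"
    "\<And>x. x \<in> Obj A \<Longrightarrow> FO F x \<in> Obj B"
    "\<And>f. f \<in> Arr A \<Longrightarrow> FM F f \<in> Arr B \<and> Dom B (FM F f) = FO F (Dom A f) \<and> Cod B (FM F f) = FO F (Cod A f)"
    "\<And>x. x \<in> Obj A \<Longrightarrow> FM F (Idn A x) = Idn B (FO F x)"
    "\<And>f g. f \<in> Arr A \<Longrightarrow> g \<in> Arr A \<Longrightarrow> Dom A g = Cod A f \<Longrightarrow> FM F (Cmp A g f) = Cmp B (FM F g) (FM F f)"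
    "\<And>f g. f \<in> Arr A \<Longrightarrow> g \<in> Arr A \<Longrightarrow> Dom A g = Dom A f \<Longrightarrow> Cod A g = Cod A f \<Longrightarrow> FM F (Add A f g) = Add B (FM F f) (FM F g)"
    "\<And>f r. f \<in> Arr A \<Longrightarrow> FM F (Scl A r f) = Scl B r (FM F f)"
    "\<And>f. f \<in> Arr A \<Longrightarrow> FM F (Dag A f) = Dag B (FM F f)"
  shows "dagger_functor F"
  using assms unfolding dagger_functor_def Let_def by (simp add: PiE_def Pi_def)

lemma hf_id_sel [simp]:
  "FDom (hf_id A) = A" "FCod (hf_id A) = A" "x \<in> Obj A \<Longrightarrow> FO (hf_id A) x = x"
  "f \<in> Arr A \<Longrightarrow> FM (hf_id A) f = f"
  by (simp_all add: hf_id_def)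

lemma hf_comp_sel [simp]:
  "FDom (hf_comp F G) = FDom F" "FCod (hf_comp F G) = FCod G"
  "x \<in> Obj (FDom F) \<Longrightarrow> FO (hf_comp F G) x = FO G (FO F x)"
  "f \<in> Arr (FDom F) \<Longrightarrow> FM (hf_comp F G) f = FM G (FM F f)"
  by (simp_all add: hf_comp_def)

lemma hn_map_sel [simp]:
  "NDom (hn_map F G t) = F" "NCod (hn_map F G t) = G" "x \<in> Obj (FDom F) \<Longrightarrow> NC (hn_map F G t) x = t x"
  by (simp_all add: hn_map_def)

lemma hn_id_sel [simp]:
  "NDom (hn_id F) = F" "NCod (hn_id F) = F" "x \<in> Obj (FDom F) \<Longrightarrow> NC (hn_id F) x = Idn (FCod F) (FO F x)"
  by (simp_all add: hn_id_def)

lemma dagger_functor_hf_id: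
  assumes "two_hilbert A"
  shows "dagger_functor (hf_id A)"
proof -
  interpret two_hilbert A by fact
  show ?thesis
    by (rule dagger_functorI[of _ A A]) (use assms add_hom scl_hom in \<open>auto simp: hf_id_def\<close>)
qed

lemma dagger_functor_hf_comp:
  assumes "dagger_functor F" "dagger_functor G" "FCod F = FDom G"
  shows "dagger_functor (hf_comp F G)"
proof -
  note F = dagger_functorD[OF assms(1) refl refl] and G = dagger_functorD[OF assms(2) refl refl]
  interpret A: two_hilbert "FDom F" by (rule F)
  interpret B: two_hilbert "FDom G" by (rule G)
  show ?thesis
    by (rule dagger_functorI[of _ "FDom F" "FCod G"])
      (use F G assms(3) A.add_hom A.scl_hom in \<open>auto simp: hf_comp_def\<close>)
qed

lemma hf_comp_assoc:
  assumes "dagger_functor F" "FCod F = FDom G"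
  shows "hf_comp (hf_comp F G) H = hf_comp F (hf_comp G H)"
  using dagger_functorD[OF assms(1) refl assms(2)] by (auto simp: hf_comp_def fun_eq_iff restrict_def)

lemma hf_comp_id:
  assumes "dagger_functor F"
  shows "FDom F = A \<Longrightarrow> hf_comp (hf_id A) F = F" "FCod F = B \<Longrightarrow> hf_comp F (hf_id B) = F"
  using dagger_functorD[OF assms refl refl]
  by (auto intro!: hfun.equality simp: hf_comp_def hf_id_def fun_eq_iff restrict_def extensional_def)

lemma nat_transI:
  assumes "dagger_functor F" "dagger_functor G" "FDom F = A" "FCod F = B" "FDom G = A" "FCod G = B"
    "\<And>x. x \<in> Obj A \<Longrightarrow> t x \<in> Arr B \<and> Dom B (t x) = FO F x \<and> Cod B (t x) = FO G x"
    "\<And>f. f \<in> Arr A \<Longrightarrow> Cmp B (t (Cod A f)) (FM F f) = Cmp B (FM G f) (t (Dom A f))"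
  shows "nat_trans (hn_map F G t)"
proof -
  interpret two_hilbert A using dagger_functorD[OF assms(1,3,4)] by simp
  show ?thesis by (auto simp: nat_trans_def Let_def hn_map_def assms)
qed

lemma nat_transD:
  assumes "nat_trans \<eta>" "NDom \<eta> = F" "NCod \<eta> = G" "FDom F = A" "FCod F = B"
  shows "dagger_functor F" "dagger_functor G" "FDom G = A" "FCod G = B" "NC \<eta> \<in> extensional (Obj A)"
    "\<And>x. x \<in> Obj A \<Longrightarrow> NC \<eta> x \<in> Arr B" "\<And>x. x \<in> Obj A \<Longrightarrow> Dom B (NC \<eta> x) = FO F x"
    "\<And>x. x \<in> Obj A \<Longrightarrow> Cod B (NC \<eta> x) = FO G x"
    "\<And>f. f \<in> Arr A \<Longrightarrow> Cmp B (NC \<eta> (Cod A f)) (FM F f) = Cmp B (FM G f) (NC \<eta> (Dom A f))"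
  using assms unfolding nat_trans_def Let_def by auto

lemma hn_map_eqI:
  assumes "F = F'" "G = G'" "\<And>x. x \<in> Obj (FDom F) \<Longrightarrow> s x = t x"
  shows "hn_map F G s = hn_map F' G' t"
  using assms by (auto simp: hn_map_def restrict_def fun_eq_iff)

text \<open>
  An adjunction of dagger functors between 2-Hilbert spaces, without compatibility between the
  traces of the two sides.
\<close>

locale dagger_adjunction = A: two_hilbert A + B: two_hilbert B
  for A B :: "('x, 'm) twohilb" +
  fixes F G :: "('x, 'm) hfun" and \<eta> \<epsilon> :: "('x, 'm) hnat"
  assumes F: "dagger_functor F" "FDom F = A" "FCod F = B"
    and G: "dagger_functor G" "FDom G = B" "FCod G = A"
    and \<eta>: "nat_trans \<eta>" "NDom \<eta> = hf_id A" "NCod \<eta> = hf_comp F G"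
    and \<epsilon>: "nat_trans \<epsilon>" "NDom \<epsilon> = hf_comp G F" "NCod \<epsilon> = hf_id B"
    and triangle_F: "a \<in> Obj A \<Longrightarrow> NC \<epsilon> (FO F a) \<cdot>\<^bsub>B\<^esub> FM F (NC \<eta> a) = Idn B (FO F a)"
    and triangle_G: "b \<in> Obj B \<Longrightarrow> FM G (NC \<epsilon> b) \<cdot>\<^bsub>A\<^esub> NC \<eta> (FO G b) = Idn A (FO G b)"
begin

lemmas F_simps [simp] = F(2,3) dagger_functorD(5-)[OF F]
lemmas G_simps [simp] = G(2,3) dagger_functorD(5-)[OF G]

lemma eta_arr [simp]:
  assumes "a \<in> Obj A"
  shows "NC \<eta> a \<in> Arr A" "Dom A (NC \<eta> a) = a" "Cod A (NC \<eta> a) = FO G (FO F a)"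
  using nat_transD(6-8)[OF \<eta>, of A A] assms by simp_all

lemma eps_arr [simp]:
  assumes "b \<in> Obj B"
  shows "NC \<epsilon> b \<in> Arr B" "Dom B (NC \<epsilon> b) = FO F (FO G b)" "Cod B (NC \<epsilon> b) = b"
  using nat_transD(6-8)[OF \<epsilon>, of B B] assms by simp_all

lemma eta_nat:
  assumes "f \<in> Arr A"
  shows "FM G (FM F f) \<cdot>\<^bsub>A\<^esub> NC \<eta> (Dom A f) = NC \<eta> (Cod A f) \<cdot>\<^bsub>A\<^esub> f"
  using nat_transD(9)[OF \<eta>, of A A f] assms by simp

lemma eps_nat:
  assumes "f \<in> Arr B"
  shows "NC \<epsilon> (Cod B f) \<cdot>\<^bsub>B\<^esub> FM F (FM G f) = f \<cdot>\<^bsub>B\<^esub> NC \<epsilon> (Dom B f)"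
  using nat_transD(9)[OF \<epsilon>, of B B f] assms by simp

lemma transpose_F:
  assumes "f \<in> Arr B" "Dom B f = FO F a" "a \<in> Obj A"
  shows "NC \<epsilon> (Cod B f) \<cdot>\<^bsub>B\<^esub> FM F (FM G f \<cdot>\<^bsub>A\<^esub> NC \<eta> a) = f"
proof -
  have "NC \<epsilon> (Cod B f) \<cdot>\<^bsub>B\<^esub> FM F (FM G f \<cdot>\<^bsub>A\<^esub> NC \<eta> a) = (NC \<epsilon> (Cod B f) \<cdot>\<^bsub>B\<^esub> FM F (FM G f)) \<cdot>\<^bsub>B\<^esub> FM F (NC \<eta> a)"
    using assms by simp
  also have "\<dots> = f \<cdot>\<^bsub>B\<^esub> (NC \<epsilon> (FO F a) \<cdot>\<^bsub>B\<^esub> FM F (NC \<eta> a))"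
    unfolding eps_nat[OF assms(1)] using assms by simp
  finally show ?thesis using assms by (simp add: triangle_F)
qed

lemma transpose_G:
  assumes "g \<in> Arr A" "Cod A g = FO G b" "b \<in> Obj B"
  shows "FM G (NC \<epsilon> b \<cdot>\<^bsub>B\<^esub> FM F g) \<cdot>\<^bsub>A\<^esub> NC \<eta> (Dom A g) = g"
proof -
  have "FM G (NC \<epsilon> b \<cdot>\<^bsub>B\<^esub> FM F g) \<cdot>\<^bsub>A\<^esub> NC \<eta> (Dom A g) = FM G (NC \<epsilon> b) \<cdot>\<^bsub>A\<^esub> (FM G (FM F g) \<cdot>\<^bsub>A\<^esub> NC \<eta> (Dom A g))"
    using assms by simp
  also have "\<dots> = (FM G (NC \<epsilon> b) \<cdot>\<^bsub>A\<^esub> NC \<eta> (FO G b)) \<cdot>\<^bsub>A\<^esub> g"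
    unfolding eta_nat[OF assms(1)] using assms by simp
  finally show ?thesis using assms by (simp add: triangle_G)
qed

end

text \<open>
  The mate of \<open>f\<close> is \<open>G(f) \<eta>\<close>, so the inner product of the mates of \<open>f\<close> and \<open>g\<close> is the trace of
  \<open>\<eta>\<^sup>\<dagger> G(f\<^sup>\<dagger> g) \<eta>\<close>.  Hence the mates are isometric if and only if compressing \<open>G(h)\<close> by the unit
  preserves the trace of \<open>h\<close>.
\<close>

locale traced_adjunction = dagger_adjunction +
  assumes trace_F: "a \<in> Obj A \<Longrightarrow> h \<in> Arr B \<Longrightarrow> Dom B h = FO F a \<Longrightarrow> Cod B h = FO F a \<Longrightarrow>
    Tr A a (Dag A (NC \<eta> a) \<cdot>\<^bsub>A\<^esub> FM G h \<cdot>\<^bsub>A\<^esub> NC \<eta> a) = Tr B (FO F a) h"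
begin

lemma unitary_adjunction: "unitary_adjunction F G \<eta> \<epsilon>"
proof -
  let ?\<phi> = "\<lambda>a b f. FM G f \<cdot>\<^bsub>A\<^esub> NC \<eta> a"
  have 1: "bij_betw (?\<phi> a b) (hom B (FO F a) b) (hom A a (FO G b))" if "a \<in> Obj A" "b \<in> Obj B" for a b
  proof (rule bij_betw_byWitness[where f' = "\<lambda>g. NC \<epsilon> b \<cdot>\<^bsub>B\<^esub> FM F g"])
    show "\<forall>f \<in> hom B (FO F a) b. NC \<epsilon> b \<cdot>\<^bsub>B\<^esub> FM F (?\<phi> a b f) = f"
      using transpose_F[of _ a] that by auto
    show "\<forall>g \<in> hom A a (FO G b). ?\<phi> a b (NC \<epsilon> b \<cdot>\<^bsub>B\<^esub> FM F g) = g"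
      using transpose_G[of _ b] that by auto
  qed (use that in auto)
  have 2: "?\<phi> a b (Add B f g) = Add A (?\<phi> a b f) (?\<phi> a b g)"
    if "a \<in> Obj A" "f \<in> hom B (FO F a) b" "g \<in> hom B (FO F a) b" for a b f g
    using that A.comp_add_left[of "NC \<eta> a" a "FO G (FO F a)" "FM G f" "FO G b" "FM G g"] by simp
  have 3: "?\<phi> a b (Scl B r f) = Scl A r (?\<phi> a b f)"
    if "a \<in> Obj A" "f \<in> hom B (FO F a) b" for a b f r
    using that A.comp_scl_left[of "NC \<eta> a" a "FO G (FO F a)" "FM G f" "FO G b" r] by simp
  have 4: "inner_hom A (?\<phi> a b f) (?\<phi> a b g) = inner_hom B f g"
    if "a \<in> Obj A" "f \<in> hom B (FO F a) b" "g \<in> hom B (FO F a) b" for a b f g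
    using that trace_F[of a "Dag B f \<cdot>\<^bsub>B\<^esub> g"] by (simp add: inner_hom_def)
  have 5: "?\<phi> a' b' (h \<cdot>\<^bsub>B\<^esub> f \<cdot>\<^bsub>B\<^esub> FM F k) = FM G h \<cdot>\<^bsub>A\<^esub> ?\<phi> a b f \<cdot>\<^bsub>A\<^esub> k"
    if "k \<in> hom A a' a" "h \<in> hom B b b'" "f \<in> hom B (FO F a) b" for a a' b b' k h f
    using that eta_nat[of k] by auto
  have "natural_unitary_iso F G ?\<phi>"
    unfolding natural_unitary_iso_def Let_def F(2,3)
    by (intro conjI ballI allI) (rule 1 2 3 4 5; assumption)+
  then show ?thesis
    unfolding unitary_adjunction_def Let_def F(2,3)
    using F G \<eta> \<epsilon> triangle_F triangle_G by simp
qed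

text \<open>
  Moving \<open>\<epsilon>\<close> around the trace leaves an endomorphism of \<open>F (G b)\<close>, on which \<open>trace_F\<close> applies; naturality
  of \<open>\<eta>\<close> and a triangle identity then remove everything except \<open>h\<close>.
\<close>

lemma trace_G:
  assumes "b \<in> Obj B" "h \<in> Arr A" "Dom A h = FO G b" "Cod A h = FO G b"
  shows "Tr B b (NC \<epsilon> b \<cdot>\<^bsub>B\<^esub> FM F h \<cdot>\<^bsub>B\<^esub> Dag B (NC \<epsilon> b)) = Tr A (FO G b) h"
proof -
  let ?e = "NC \<epsilon> b" and ?n = "NC \<eta> (FO G b)"
  have "FM G (FM F (Dag A h)) \<cdot>\<^bsub>A\<^esub> ?n = ?n \<cdot>\<^bsub>A\<^esub> Dag A h"
    using eta_nat[of "Dag A h"] assms by simp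
  from arg_cong[OF this, of "Dag A"] have n: "Dag A ?n \<cdot>\<^bsub>A\<^esub> FM G (FM F h) = h \<cdot>\<^bsub>A\<^esub> Dag A ?n"
    using assms by simp
  have t: "Dag A ?n \<cdot>\<^bsub>A\<^esub> Dag A (FM G ?e) = Idn A (FO G b)"
    using arg_cong[OF triangle_G[OF assms(1)], of "Dag A"] assms by simp
  have "Tr B b (?e \<cdot>\<^bsub>B\<^esub> FM F h \<cdot>\<^bsub>B\<^esub> Dag B ?e) = Tr B (FO F (FO G b)) ((FM F h \<cdot>\<^bsub>B\<^esub> Dag B ?e) \<cdot>\<^bsub>B\<^esub> ?e)"
    using assms by (intro B.trace_commute[symmetric]) simp_all
  also have "\<dots> = Tr A (FO G b) (Dag A ?n \<cdot>\<^bsub>A\<^esub> FM G ((FM F h \<cdot>\<^bsub>B\<^esub> Dag B ?e) \<cdot>\<^bsub>B\<^esub> ?e) \<cdot>\<^bsub>A\<^esub> ?n)"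
    using assms by (intro trace_F[symmetric]) simp_all
  also have "Dag A ?n \<cdot>\<^bsub>A\<^esub> FM G ((FM F h \<cdot>\<^bsub>B\<^esub> Dag B ?e) \<cdot>\<^bsub>B\<^esub> ?e) \<cdot>\<^bsub>A\<^esub> ?n
    = (Dag A ?n \<cdot>\<^bsub>A\<^esub> FM G (FM F h)) \<cdot>\<^bsub>A\<^esub> Dag A (FM G ?e) \<cdot>\<^bsub>A\<^esub> (FM G ?e \<cdot>\<^bsub>A\<^esub> ?n)"
    using assms by simp
  also have "\<dots> = h \<cdot>\<^bsub>A\<^esub> (Dag A ?n \<cdot>\<^bsub>A\<^esub> Dag A (FM G ?e))"
    unfolding n triangle_G[OF assms(1)] using assms by simp
  finally show ?thesis unfolding t using assms by simp
qed

text \<open>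
  For dagger functors the adjoints of unit and counit exhibit a left adjoint also as a right
  adjoint, and \<open>trace_G\<close> is the condition on traces for the reversed adjunction.
\<close>

lemma traced_adjunction_reverse:
  "traced_adjunction B A G F (hn_map (hf_id B) (hf_comp G F) (\<lambda>b. Dag B (NC \<epsilon> b)))
    (hn_map (hf_comp F G) (hf_id A) (\<lambda>a. Dag A (NC \<eta> a)))"
proof unfold_locales
  show "nat_trans (hn_map (hf_id B) (hf_comp G F) (\<lambda>b. Dag B (NC \<epsilon> b)))"
  proof (rule nat_transI[of _ _ B B])
    fix f assume f: "f \<in> Arr B"
    from arg_cong[OF eps_nat[of "Dag B f"], of "Dag B"]
    show "Dag B (NC \<epsilon> (Cod B f)) \<cdot>\<^bsub>B\<^esub> FM (hf_id B) f = FM (hf_comp G F) f \<cdot>\<^bsub>B\<^esub> Dag B (NC \<epsilon> (Dom B f))"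
      using f by simp
  qed (use F G B.two_hilbert_axioms in \<open>simp_all add: dagger_functor_hf_id dagger_functor_hf_comp\<close>)
  show "nat_trans (hn_map (hf_comp F G) (hf_id A) (\<lambda>a. Dag A (NC \<eta> a)))"
  proof (rule nat_transI[of _ _ A A])
    fix f assume f: "f \<in> Arr A"
    from arg_cong[OF eta_nat[of "Dag A f"], of "Dag A"]
    show "Dag A (NC \<eta> (Cod A f)) \<cdot>\<^bsub>A\<^esub> FM (hf_comp F G) f = FM (hf_id A) f \<cdot>\<^bsub>A\<^esub> Dag A (NC \<eta> (Dom A f))"
      using f by simp
  qed (use F G A.two_hilbert_axioms in \<open>simp_all add: dagger_functor_hf_id dagger_functor_hf_comp\<close>)
next
  fix b assume b: "b \<in> Obj B"
  show "NC (hn_map (hf_comp F G) (hf_id A) (\<lambda>a. Dag A (NC \<eta> a))) (FO G b) \<cdot>\<^bsub>A\<^esub>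
    FM G (NC (hn_map (hf_id B) (hf_comp G F) (\<lambda>b. Dag B (NC \<epsilon> b))) b) = Idn A (FO G b)"
    using b arg_cong[OF triangle_G[OF b], of "Dag A"] by simp
next
  fix a assume a: "a \<in> Obj A"
  show "FM F (NC (hn_map (hf_comp F G) (hf_id A) (\<lambda>a. Dag A (NC \<eta> a))) a) \<cdot>\<^bsub>B\<^esub>
    NC (hn_map (hf_id B) (hf_comp G F) (\<lambda>b. Dag B (NC \<epsilon> b))) (FO F a) = Idn B (FO F a)"
    using a arg_cong[OF triangle_F[OF a], of "Dag B"] by simp
next
  fix b h assume "b \<in> Obj B" "h \<in> Arr A" "Dom A h = FO G b" "Cod A h = FO G b"
  then show "Tr B b (Dag B (NC (hn_map (hf_id B) (hf_comp G F) (\<lambda>b. Dag B (NC \<epsilon> b))) b) \<cdot>\<^bsub>B\<^esub> FM F h \<cdot>\<^bsub>B\<^esub>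
       NC (hn_map (hf_id B) (hf_comp G F) (\<lambda>b. Dag B (NC \<epsilon> b))) b) = Tr A (FO G b) h"
    using trace_G by simp
qed (use F G in simp_all)

end

lemma traced_adjunction_of_unitary:
  assumes "unitary_adjunction F G \<eta> \<epsilon>" and AB: "FDom F = A" "FCod F = B"
  shows "traced_adjunction A B F G \<eta> \<epsilon>"
proof -
  note a = assms(1)[unfolded unitary_adjunction_def Let_def AB]
  have F: "dagger_functor F" and G: "dagger_functor G" "FDom G = B" "FCod G = A"
    and \<eta>: "nat_trans \<eta>" "NDom \<eta> = hf_id A" "NCod \<eta> = hf_comp F G"
    and \<epsilon>: "nat_trans \<epsilon>" "NDom \<epsilon> = hf_comp G F" "NCod \<epsilon> = hf_id B"
    and t: "\<forall>a \<in> Obj A. NC \<epsilon> (FO F a) \<cdot>\<^bsub>B\<^esub> FM F (NC \<eta> a) = Idn B (FO F a)"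
      "\<forall>b \<in> Obj B. FM G (NC \<epsilon> b) \<cdot>\<^bsub>A\<^esub> NC \<eta> (FO G b) = Idn A (FO G b)"
    and n: "natural_unitary_iso F G (\<lambda>a b f. FM G f \<cdot>\<^bsub>A\<^esub> NC \<eta> a)"
    using a by - (elim conjE, assumption)+
  interpret A: two_hilbert A by (rule dagger_functorD(1)[OF F AB])
  interpret B: two_hilbert B by (rule dagger_functorD(2)[OF F AB])
  interpret dagger_adjunction A B F G \<eta> \<epsilon>
    by (intro dagger_adjunction.intro dagger_adjunction_axioms.intro A.two_hilbert_axioms B.two_hilbert_axioms
        F AB G \<eta> \<epsilon> bspec[OF t(1)] bspec[OF t(2)])
  show ?thesis
  proof unfold_locales
    fix x h assume h: "x \<in> Obj A" "h \<in> Arr B" "Dom B h = FO F x" "Cod B h = FO F x"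
    have o: "FO F x \<in> Obj B" and i: "Idn B (FO F x) \<in> hom B (FO F x) (FO F x)" and h': "h \<in> hom B (FO F x) (FO F x)"
      using h by simp_all
    note n' = bspec[OF bspec[OF conjunct1[OF n[unfolded natural_unitary_iso_def Let_def AB]] h(1)] o]
    have "inner_hom A (FM G (Idn B (FO F x)) \<cdot>\<^bsub>A\<^esub> NC \<eta> x) (FM G h \<cdot>\<^bsub>A\<^esub> NC \<eta> x) = inner_hom B (Idn B (FO F x)) h"
      by (rule conjunct2[OF bspec[OF bspec[OF conjunct1[OF conjunct2[OF n']] i] h']])
    then show "Tr A x (Dag A (NC \<eta> x) \<cdot>\<^bsub>A\<^esub> FM G h \<cdot>\<^bsub>A\<^esub> NC \<eta> x) = Tr B (FO F x) h"
      using h by (simp add: inner_hom_def)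
  qed
qed

text \<open>
  Two unitary adjoints \<open>G\<close> and \<open>V\<close> of the same functor; the component at \<open>b\<close> of the canonical
  isomorphism \<open>G \<Rightarrow> V\<close> is the mate, for \<open>V\<close>, of the counit of \<open>G\<close>.
\<close>

locale two_adjoints = G: traced_adjunction A B F G \<eta> \<epsilon> + V: traced_adjunction A B F V c e
  for A B F G \<eta> \<epsilon> V c e
begin

definition comparison :: "'a \<Rightarrow> 'b"
  where "comparison b = FM V (NC \<epsilon> b) \<cdot>\<^bsub>A\<^esub> NC c (FO G b)"

lemma comparison_arr [simp]:
  assumes "b \<in> Obj B"
  shows "comparison b \<in> Arr A" "Dom A (comparison b) = FO G b" "Cod A (comparison b) = FO V b"
  using assms by (simp_all add: comparison_def)

lemma comparison_nat:
  assumes "f \<in> Arr B"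
  shows "comparison (Cod B f) \<cdot>\<^bsub>A\<^esub> FM G f = FM V f \<cdot>\<^bsub>A\<^esub> comparison (Dom B f)"
proof -
  have "comparison (Cod B f) \<cdot>\<^bsub>A\<^esub> FM G f = FM V (NC \<epsilon> (Cod B f)) \<cdot>\<^bsub>A\<^esub> (FM V (FM F (FM G f)) \<cdot>\<^bsub>A\<^esub> NC c (Dom A (FM G f)))"
    unfolding comparison_def using assms V.eta_nat[of "FM G f"] by simp
  also have "\<dots> = FM V (NC \<epsilon> (Cod B f) \<cdot>\<^bsub>B\<^esub> FM F (FM G f)) \<cdot>\<^bsub>A\<^esub> NC c (FO G (Dom B f))"
    using assms by simp
  also have "\<dots> = FM V f \<cdot>\<^bsub>A\<^esub> comparison (Dom B f)"
    unfolding G.eps_nat[OF assms] comparison_def using assms by simp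
  finally show ?thesis .
qed

text \<open>
  The trace of \<open>k u\<^sup>\<dagger> u\<close>, where \<open>u\<close> is the comparison, is by the trace condition for \<open>V\<close> a trace of an
  endomorphism \<open>?h\<close> of \<open>F (G b)\<close>.  The trace condition for \<open>G\<close> turns it back into the trace of \<open>k\<close>,
  so \<open>u\<^sup>\<dagger> u\<close> is the identity by nondegeneracy.
\<close>

lemma comparison_isometry:
  assumes b: "b \<in> Obj B"
  shows "Dag A (comparison b) \<cdot>\<^bsub>A\<^esub> comparison b = Idn A (FO G b)"
proof (rule G.A.trace_nondegenerate)
  let ?e = "NC \<epsilon> b" and ?n = "NC \<eta> (FO G b)" and ?c = "NC c (FO G b)"
  fix k assume k: "k \<in> Arr A" "Dom A k = FO G b" "Cod A k = FO G b"
  \<comment> \<open>naturality of the two units, with the adjoint taken\<close>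
  have kn: "Dag A ?n \<cdot>\<^bsub>A\<^esub> FM G (FM F k) = k \<cdot>\<^bsub>A\<^esub> Dag A ?n"
    using arg_cong[OF G.eta_nat[of "Dag A k"], of "Dag A"] k b by simp
  have kc: "k \<cdot>\<^bsub>A\<^esub> Dag A ?c = Dag A ?c \<cdot>\<^bsub>A\<^esub> FM V (FM F k)"
    using arg_cong[OF V.eta_nat[of "Dag A k"], of "Dag A"] k b by simp
  have t: "Dag A ?n \<cdot>\<^bsub>A\<^esub> Dag A (FM G ?e) = Idn A (FO G b)"
    using arg_cong[OF G.triangle_G[OF b], of "Dag A"] b by simp
  let ?h = "FM F k \<cdot>\<^bsub>B\<^esub> Dag B ?e \<cdot>\<^bsub>B\<^esub> ?e"
  have "k \<cdot>\<^bsub>A\<^esub> Dag A (comparison b) \<cdot>\<^bsub>A\<^esub> comparison b = (k \<cdot>\<^bsub>A\<^esub> Dag A ?c) \<cdot>\<^bsub>A\<^esub> Dag A (FM V ?e) \<cdot>\<^bsub>A\<^esub> FM V ?e \<cdot>\<^bsub>A\<^esub> ?c"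
    using k b by (simp add: comparison_def)
  also have "\<dots> = Dag A ?c \<cdot>\<^bsub>A\<^esub> FM V ?h \<cdot>\<^bsub>A\<^esub> ?c"
    unfolding kc using k b by simp
  finally have "Tr A (FO G b) (k \<cdot>\<^bsub>A\<^esub> Dag A (comparison b) \<cdot>\<^bsub>A\<^esub> comparison b) = Tr B (FO F (FO G b)) ?h"
    using V.trace_F[of "FO G b" ?h] k b by simp
  also have "\<dots> = Tr A (FO G b) (Dag A ?n \<cdot>\<^bsub>A\<^esub> FM G ?h \<cdot>\<^bsub>A\<^esub> ?n)"
    using G.trace_F[of "FO G b" ?h] k b by simp
  also have "Dag A ?n \<cdot>\<^bsub>A\<^esub> FM G ?h \<cdot>\<^bsub>A\<^esub> ?n = (Dag A ?n \<cdot>\<^bsub>A\<^esub> FM G (FM F k)) \<cdot>\<^bsub>A\<^esub> Dag A (FM G ?e) \<cdot>\<^bsub>A\<^esub> (FM G ?e \<cdot>\<^bsub>A\<^esub> ?n)"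
    using k b by simp
  also have "\<dots> = k \<cdot>\<^bsub>A\<^esub> (Dag A ?n \<cdot>\<^bsub>A\<^esub> Dag A (FM G ?e))"
    unfolding kn G.triangle_G[OF b] using k b by simp
  finally show "Tr A (FO G b) (k \<cdot>\<^bsub>A\<^esub> Dag A (comparison b) \<cdot>\<^bsub>A\<^esub> comparison b) = Tr A (FO G b) k"
    unfolding t using k b by simp
qed (use b in simp_all)

lemma comparison_right_inverse:
  assumes b: "b \<in> Obj B"
  shows "comparison b \<cdot>\<^bsub>A\<^esub> FM G (NC e b) \<cdot>\<^bsub>A\<^esub> NC \<eta> (FO V b) = Idn A (FO V b)"
proof -
  let ?g = "FM G (NC e b) \<cdot>\<^bsub>A\<^esub> NC \<eta> (FO V b)"
  have "comparison b \<cdot>\<^bsub>A\<^esub> ?g = FM V (NC \<epsilon> b) \<cdot>\<^bsub>A\<^esub> (FM V (FM F ?g) \<cdot>\<^bsub>A\<^esub> NC c (Dom A ?g))"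
    using b V.eta_nat[of ?g] by (simp add: comparison_def)
  also have "\<dots> = FM V (NC \<epsilon> b \<cdot>\<^bsub>B\<^esub> FM F ?g) \<cdot>\<^bsub>A\<^esub> NC c (FO V b)"
    using b by simp
  also have "NC \<epsilon> b \<cdot>\<^bsub>B\<^esub> FM F ?g = NC e b"
    using G.transpose_F[of "NC e b" "FO V b"] b by simp
  also have "FM V (NC e b) \<cdot>\<^bsub>A\<^esub> NC c (FO V b) = Idn A (FO V b)"
    by (rule V.triangle_G[OF b])
  finally show ?thesis .
qed

text \<open>An isometry with a right inverse is unitary.\<close>

lemma comparison_coisometry:
  assumes b: "b \<in> Obj B"
  shows "comparison b \<cdot>\<^bsub>A\<^esub> Dag A (comparison b) = Idn A (FO V b)"
proof -
  let ?g = "FM G (NC e b) \<cdot>\<^bsub>A\<^esub> NC \<eta> (FO V b)" and ?u = "comparison b"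
  have "Dag A ?u = Dag A ?u \<cdot>\<^bsub>A\<^esub> (?u \<cdot>\<^bsub>A\<^esub> ?g)"
    unfolding comparison_right_inverse[OF b] using b by simp
  also have "\<dots> = (Dag A ?u \<cdot>\<^bsub>A\<^esub> ?u) \<cdot>\<^bsub>A\<^esub> ?g" using b by simp
  also have "\<dots> = ?g" unfolding comparison_isometry[OF b] using b by simp
  finally have "Dag A ?u = ?g" .
  then show ?thesis using comparison_right_inverse[OF b] by simp
qed

end

lemma two_Hilb_sel [simp]:
  "Obj (two_Hilb V ev coev) = {F. dagger_functor F}"
  "Arr (two_Hilb V ev coev) = {\<eta>. nat_trans \<eta>}"
  "Dom (two_Hilb V ev coev) = NDom" "Cod (two_Hilb V ev coev) = NCod"
  "Idn (two_Hilb V ev coev) = hn_id"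
  "Cmp (two_Hilb V ev coev) \<theta> \<eta> = hn_map (NDom \<eta>) (NCod \<theta>) (\<lambda>x. NC \<theta> x \<cdot>\<^bsub>FCod (NDom \<eta>)\<^esub> NC \<eta> x)"
  "Add (two_Hilb V ev coev) \<eta> \<theta> = hn_map (NDom \<eta>) (NCod \<eta>) (\<lambda>x. NC \<eta> x \<oplus>\<^bsub>FCod (NDom \<eta>)\<^esub> NC \<theta> x)"
  "Scl (two_Hilb V ev coev) r \<eta> = hn_map (NDom \<eta>) (NCod \<eta>) (\<lambda>x. r \<odot>\<^bsub>FCod (NDom \<eta>)\<^esub> NC \<eta> x)"
  "Dag (two_Hilb V ev coev) \<eta> = hn_map (NCod \<eta>) (NDom \<eta>) (\<lambda>x. Dag (FCod (NDom \<eta>)) (NC \<eta> x))"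
  "Ob0 (two_Hilb V ev coev) = {A. two_hilbert A}"
  "Src (two_Hilb V ev coev) = FDom" "Trg (two_Hilb V ev coev) = FCod"
  "One (two_Hilb V ev coev) = hf_id" "Ten1 (two_Hilb V ev coev) = hf_comp"
  "Ten2 (two_Hilb V ev coev) \<eta> \<theta> = hn_map (hf_comp (NDom \<eta>) (NDom \<theta>)) (hf_comp (NCod \<eta>) (NCod \<theta>))
        (\<lambda>x. NC \<theta> (FO (NCod \<eta>) x) \<cdot>\<^bsub>FCod (NDom \<theta>)\<^esub> FM (NDom \<theta>) (NC \<eta> x))"
  "Asc (two_Hilb V ev coev) F G H = hn_id (hf_comp F (hf_comp G H))"
  "Lun (two_Hilb V ev coev) = hn_id" "Run (two_Hilb V ev coev) = hn_id"
  "Vee (two_Hilb V ev coev) = V" "Ev (two_Hilb V ev coev) = ev" "Coev (two_Hilb V ev coev) = coev"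
  by (simp_all add: two_Hilb_def)

lemma unitary_two_Hilb:
  assumes "nat_trans (hn_map F G t)" "FDom F = A" "FCod F = B"
    "\<And>x. x \<in> Obj A \<Longrightarrow> Dag B (t x) \<cdot>\<^bsub>B\<^esub> t x = Idn B (FO F x)"
    "\<And>x. x \<in> Obj A \<Longrightarrow> t x \<cdot>\<^bsub>B\<^esub> Dag B (t x) = Idn B (FO G x)"
  shows "unitary (two_Hilb V ev coev) (hn_map F G t)"
proof -
  have G: "FDom G = A" "FCod G = B"
    using nat_transD(3,4)[OF assms(1), of F G A B] assms(2,3) by simp_all
  show ?thesis
    unfolding unitary_def hn_id_def two_Hilb_sel hn_map_sel mem_Collect_eq
    using assms G by (auto intro!: hn_map_eqI)
qed

text \<open>
  In the strict 2-category of 2-Hilbert spaces the canonical map between two duals of a 1-morphism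
  \<open>F\<close> is the comparison of two adjoints of the functor \<open>F\<close>.
\<close>

lemma (in two_adjoints) unitary_dual_map:
  "unitary (two_Hilb W ev coev) (dual_map (two_Hilb W ev coev) G F V \<epsilon> c)"
proof -
  have "nat_trans (hn_map G V comparison)"
    using G.G V.G comparison_nat by (intro nat_transI[of _ _ B A]) simp_all
  then have "unitary (two_Hilb W ev coev) (hn_map G V comparison)"
    using comparison_isometry comparison_coisometry by (intro unitary_two_Hilb[of _ _ _ B A]) simp_all
  moreover have "dual_map (two_Hilb W ev coev) G F V \<epsilon> c = hn_map G V comparison"
    using G.\<epsilon> V.\<eta> by (auto simp: dual_map_def comparison_def intro!: hn_map_eqI)
  ultimately show ?thesis by simp
qed

section \<open>Tensoring with a 1-morphism\<close>

lemma lact_sel [simp]: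
  "FDom (lact X c y) = hom_hilb X (Trg X y) c" "FCod (lact X c y) = hom_hilb X (Src X y) c"
  "w \<in> Obj X \<Longrightarrow> Src X w = Trg X y \<Longrightarrow> Trg X w = c \<Longrightarrow> FO (lact X c y) w = Ten1 X y w"
  "f \<in> Arr X \<Longrightarrow> Dom X f \<in> hom1 X (Trg X y) c \<Longrightarrow> FM (lact X c y) f = Ten2 X (Idn X y) f"
  by (simp_all add: lact_def)

lemma ract_sel [simp]:
  "FDom (ract X a z) = hom_hilb X a (Src X z)" "FCod (ract X a z) = hom_hilb X a (Trg X z)"
  "w \<in> Obj X \<Longrightarrow> Src X w = a \<Longrightarrow> Trg X w = Src X z \<Longrightarrow> FO (ract X a z) w = Ten1 X w z"
  "f \<in> Arr X \<Longrightarrow> Dom X f \<in> hom1 X a (Src X z) \<Longrightarrow> FM (ract X a z) f = Ten2 X f (Idn X z)"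
  by (simp_all add: ract_def)

context weighted_2category
begin

lemma dagger_functor_lact:
  assumes "y \<in> Obj X" "c \<in> Ob0 X"
  shows "dagger_functor (lact X c y)"
proof (rule dagger_functorI[of _ "hom_hilb X (Trg X y) c" "hom_hilb X (Src X y) c"])
  show "FO (lact X c y) \<in> extensional (Obj (hom_hilb X (Trg X y) c))"
    "FM (lact X c y) \<in> extensional (Arr (hom_hilb X (Trg X y) c))"
    by (simp_all add: lact_def)
qed (use assms in \<open>simp_all add: two_hilbert_hom_hilb whisker_left\<close>)

lemma dagger_functor_ract:
  assumes "z \<in> Obj X" "a \<in> Ob0 X"
  shows "dagger_functor (ract X a z)"
proof (rule dagger_functorI[of _ "hom_hilb X a (Src X z)" "hom_hilb X a (Trg X z)"])
  show "FO (ract X a z) \<in> extensional (Obj (hom_hilb X a (Src X z)))"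
    "FM (ract X a z) \<in> extensional (Arr (hom_hilb X a (Src X z)))"
    by (simp_all add: ract_def)
qed (use assms in \<open>simp_all add: two_hilbert_hom_hilb whisker_right\<close>)

lemmas functor_intros = dagger_functor_lact dagger_functor_ract dagger_functor_hf_id dagger_functor_hf_comp
  two_hilbert_hom_hilb

text \<open>
  In the naturality squares below, \<open>f\<close> passes the associator and the unitor by their naturality and
  passes \<open>n\<close> or \<open>e\<close>, which act on different strands, by interchange.
\<close>

lemma nat_trans_lact_unit:
  assumes "p \<in> Obj X" "q \<in> Obj X" "Trg X p = Src X q" "Trg X q = Src X p" "c \<in> Ob0 X"
    "n \<in> Arr X" "Dom X n = One X (Src X p)" "Cod X n = p \<otimes> q"
  shows "nat_trans (lact_unit X c p q n)"
  unfolding lact_unit_def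
proof (rule nat_transI[of _ _ "hom_hilb X (Src X p) c" "hom_hilb X (Src X p) c"])
  fix f assume "f \<in> Arr (hom_hilb X (Src X p) c)"
  then have f: "f \<in> Arr X" "Dom X f \<in> Obj X" "Src X (Dom X f) = Src X p" "Trg X (Dom X f) = c" by simp_all
  let ?x = "Dom X f" and ?y = "Cod X f"
  have "(\<i>\<d> p \<star> \<i>\<d> q \<star> f) \<cdot> Asc X p q ?x \<cdot> (n \<star> \<i>\<d> ?x) \<cdot> (Lun X ?x)\<dagger>
    = Asc X p q ?y \<cdot> (\<i>\<d> (p \<otimes> q) \<star> f) \<cdot> (n \<star> \<i>\<d> ?x) \<cdot> (Lun X ?x)\<dagger>"
    using f assms by (simp add: asc_out_then)
  also have "\<dots> = Asc X p q ?y \<cdot> (n \<star> \<i>\<d> ?y) \<cdot> (\<i>\<d> (One X (Src X p)) \<star> f) \<cdot> (Lun X ?x)\<dagger>"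
    using f assms by (simp add: exchange_then)
  also have "\<dots> = (Asc X p q ?y \<cdot> (n \<star> \<i>\<d> ?y) \<cdot> (Lun X ?y)\<dagger>) \<cdot> f"
    using f assms by (simp add: lun_dag_nat)
  finally show "(Asc X p q (Cod (hom_hilb X (Src X p) c) f) \<cdot> (n \<star> \<i>\<d> (Cod (hom_hilb X (Src X p) c) f)) \<cdot>
        (Lun X (Cod (hom_hilb X (Src X p) c) f))\<dagger>) \<cdot>\<^bsub>hom_hilb X (Src X p) c\<^esub> FM (hf_id (hom_hilb X (Src X p) c)) f
    = FM (hf_comp (lact X c q) (lact X c p)) f \<cdot>\<^bsub>hom_hilb X (Src X p) c\<^esub>
      (Asc X p q (Dom (hom_hilb X (Src X p) c) f) \<cdot> (n \<star> \<i>\<d> (Dom (hom_hilb X (Src X p) c) f)) \<cdot>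
        (Lun X (Dom (hom_hilb X (Src X p) c) f))\<dagger>)"
    using f assms by simp
qed (use assms in \<open>auto intro!: functor_intros\<close>)

lemma nat_trans_lact_counit:
  assumes "p \<in> Obj X" "q \<in> Obj X" "Trg X p = Src X q" "Trg X q = Src X p" "c \<in> Ob0 X"
    "e \<in> Arr X" "Cod X e = One X (Src X p)" "Dom X e = p \<otimes> q"
  shows "nat_trans (lact_counit X c p q e)"
  unfolding lact_counit_def
proof (rule nat_transI[of _ _ "hom_hilb X (Src X p) c" "hom_hilb X (Src X p) c"])
  fix f assume "f \<in> Arr (hom_hilb X (Src X p) c)"
  then have f: "f \<in> Arr X" "Dom X f \<in> Obj X" "Src X (Dom X f) = Src X p" "Trg X (Dom X f) = c" by simp_all
  let ?x = "Dom X f" and ?y = "Cod X f"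
  have "(Lun X ?y \<cdot> (e \<star> \<i>\<d> ?y) \<cdot> (Asc X p q ?y)\<dagger>) \<cdot> (\<i>\<d> p \<star> \<i>\<d> q \<star> f)
    = Lun X ?y \<cdot> (e \<star> \<i>\<d> ?y) \<cdot> (\<i>\<d> (p \<otimes> q) \<star> f) \<cdot> (Asc X p q ?x)\<dagger>"
    using f assms by (simp add: asc_dag_in)
  also have "\<dots> = (Lun X ?y \<cdot> (\<i>\<d> (One X (Src X (Dom X f))) \<star> f)) \<cdot> (e \<star> \<i>\<d> ?x) \<cdot> (Asc X p q ?x)\<dagger>"
    using f assms by (simp add: exchange_then)
  also have "\<dots> = f \<cdot> Lun X ?x \<cdot> (e \<star> \<i>\<d> ?x) \<cdot> (Asc X p q ?x)\<dagger>"
    unfolding lun_nat[OF f(1)] using f assms by simp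
  finally show "(Lun X (Cod (hom_hilb X (Src X p) c) f) \<cdot> (e \<star> \<i>\<d> (Cod (hom_hilb X (Src X p) c) f)) \<cdot>
        (Asc X p q (Cod (hom_hilb X (Src X p) c) f))\<dagger>) \<cdot>\<^bsub>hom_hilb X (Src X p) c\<^esub> FM (hf_comp (lact X c q) (lact X c p)) f
    = FM (hf_id (hom_hilb X (Src X p) c)) f \<cdot>\<^bsub>hom_hilb X (Src X p) c\<^esub>
      (Lun X (Dom (hom_hilb X (Src X p) c) f) \<cdot> (e \<star> \<i>\<d> (Dom (hom_hilb X (Src X p) c) f)) \<cdot>
        (Asc X p q (Dom (hom_hilb X (Src X p) c) f))\<dagger>)"
    using f assms by simp
qed (use assms in \<open>auto intro!: functor_intros\<close>)

lemma nat_trans_ract_unit: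
  assumes "p \<in> Obj X" "q \<in> Obj X" "Trg X p = Src X q" "Trg X q = Src X p" "a \<in> Ob0 X"
    "n \<in> Arr X" "Dom X n = One X (Src X p)" "Cod X n = p \<otimes> q"
  shows "nat_trans (ract_unit X a p q n)"
  unfolding ract_unit_def
proof (rule nat_transI[of _ _ "hom_hilb X a (Src X p)" "hom_hilb X a (Src X p)"])
  fix f assume "f \<in> Arr (hom_hilb X a (Src X p))"
  then have f: "f \<in> Arr X" "Dom X f \<in> Obj X" "Src X (Dom X f) = a" "Trg X (Dom X f) = Src X p" by simp_all
  let ?x = "Dom X f" and ?y = "Cod X f"
  have "((f \<star> \<i>\<d> p) \<star> \<i>\<d> q) \<cdot> (Asc X ?x p q)\<dagger> \<cdot> (\<i>\<d> ?x \<star> n) \<cdot> (Run X ?x)\<dagger>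
    = (Asc X ?y p q)\<dagger> \<cdot> (f \<star> \<i>\<d> (p \<otimes> q)) \<cdot> (\<i>\<d> ?x \<star> n) \<cdot> (Run X ?x)\<dagger>"
    using f assms by (simp add: asc_dag_in_then)
  also have "\<dots> = (Asc X ?y p q)\<dagger> \<cdot> (\<i>\<d> ?y \<star> n) \<cdot> (f \<star> \<i>\<d> (One X (Src X p))) \<cdot> (Run X ?x)\<dagger>"
    using f assms by (simp add: exchange_then)
  also have "\<dots> = ((Asc X ?y p q)\<dagger> \<cdot> (\<i>\<d> ?y \<star> n) \<cdot> (Run X ?y)\<dagger>) \<cdot> f"
    using f assms by (simp add: run_dag_nat)
  finally show "((Asc X (Cod (hom_hilb X a (Src X p)) f) p q)\<dagger> \<cdot> (\<i>\<d> (Cod (hom_hilb X a (Src X p)) f) \<star> n) \<cdot>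
        (Run X (Cod (hom_hilb X a (Src X p)) f))\<dagger>) \<cdot>\<^bsub>hom_hilb X a (Src X p)\<^esub> FM (hf_id (hom_hilb X a (Src X p))) f
    = FM (hf_comp (ract X a p) (ract X a q)) f \<cdot>\<^bsub>hom_hilb X a (Src X p)\<^esub>
      ((Asc X (Dom (hom_hilb X a (Src X p)) f) p q)\<dagger> \<cdot> (\<i>\<d> (Dom (hom_hilb X a (Src X p)) f) \<star> n) \<cdot>
        (Run X (Dom (hom_hilb X a (Src X p)) f))\<dagger>)"
    using f assms by simp
qed (use assms in \<open>auto intro!: functor_intros\<close>)

lemma nat_trans_ract_counit:
  assumes "p \<in> Obj X" "q \<in> Obj X" "Trg X p = Src X q" "Trg X q = Src X p" "a \<in> Ob0 X"
    "e \<in> Arr X" "Cod X e = One X (Src X p)" "Dom X e = p \<otimes> q"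
  shows "nat_trans (ract_counit X a p q e)"
  unfolding ract_counit_def
proof (rule nat_transI[of _ _ "hom_hilb X a (Src X p)" "hom_hilb X a (Src X p)"])
  fix f assume "f \<in> Arr (hom_hilb X a (Src X p))"
  then have f: "f \<in> Arr X" "Dom X f \<in> Obj X" "Src X (Dom X f) = a" "Trg X (Dom X f) = Src X p" by simp_all
  let ?x = "Dom X f" and ?y = "Cod X f"
  have "(Run X ?y \<cdot> (\<i>\<d> ?y \<star> e) \<cdot> Asc X ?y p q) \<cdot> ((f \<star> \<i>\<d> p) \<star> \<i>\<d> q)
    = Run X ?y \<cdot> (\<i>\<d> ?y \<star> e) \<cdot> (f \<star> \<i>\<d> (p \<otimes> q)) \<cdot> Asc X ?x p q"
    using f assms by (simp add: asc_out)
  also have "\<dots> = (Run X ?y \<cdot> (f \<star> \<i>\<d> (One X (Trg X (Dom X f))))) \<cdot> (\<i>\<d> ?x \<star> e) \<cdot> Asc X ?x p q"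
    using f assms by (simp add: exchange_then)
  also have "\<dots> = f \<cdot> Run X ?x \<cdot> (\<i>\<d> ?x \<star> e) \<cdot> Asc X ?x p q"
    unfolding run_nat[OF f(1)] using f assms by simp
  finally show "(Run X (Cod (hom_hilb X a (Src X p)) f) \<cdot> (\<i>\<d> (Cod (hom_hilb X a (Src X p)) f) \<star> e) \<cdot>
        Asc X (Cod (hom_hilb X a (Src X p)) f) p q) \<cdot>\<^bsub>hom_hilb X a (Src X p)\<^esub> FM (hf_comp (ract X a p) (ract X a q)) f
    = FM (hf_id (hom_hilb X a (Src X p))) f \<cdot>\<^bsub>hom_hilb X a (Src X p)\<^esub>
      (Run X (Dom (hom_hilb X a (Src X p)) f) \<cdot> (\<i>\<d> (Dom (hom_hilb X a (Src X p)) f) \<star> e) \<cdot>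
        Asc X (Dom (hom_hilb X a (Src X p)) f) p q)"
    using f assms by simp
qed (use assms in \<open>auto intro!: functor_intros\<close>)

text \<open>
  The triangle identities are the adjoints of the zig-zag equations of \<open>y\<close> tensored with \<open>w\<close>, and
  compression by the unit is the partial trace over \<open>y\<close>.
\<close>

lemma lact_traced_adjunction:
  assumes y: "y \<in> Obj X" and c: "c \<in> Ob0 X"
  shows "traced_adjunction (hom_hilb X (Trg X y) c) (hom_hilb X (Src X y) c)
    (lact X c y) (lact X c (Vee X y)) (lact_unit X c (Vee X y) y ((Ev X y)\<dagger>)) (lact_counit X c y (Vee X y) ((Coev X y)\<dagger>))"
proof -
  let ?v = "Vee X y"
  note d = vee_dual[OF y]
  interpret A: two_hilbert "hom_hilb X (Trg X y) c" using y c by (simp add: two_hilbert_hom_hilb)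
  interpret B: two_hilbert "hom_hilb X (Src X y) c" using y c by (simp add: two_hilbert_hom_hilb)
  show ?thesis
  proof unfold_locales
    show "nat_trans (lact_unit X c ?v y ((Ev X y)\<dagger>))" "nat_trans (lact_counit X c y ?v ((Coev X y)\<dagger>))"
      using y c by (simp_all add: nat_trans_lact_unit nat_trans_lact_counit)
  next
    fix w assume "w \<in> Obj (hom_hilb X (Trg X y) c)"
    then have w: "w \<in> Obj X" "Src X w = Trg X y" "Trg X w = c" by simp_all
    show "NC (lact_counit X c y ?v ((Coev X y)\<dagger>)) (FO (lact X c y) w) \<cdot>\<^bsub>hom_hilb X (Src X y) c\<^esub>
      FM (lact X c y) (NC (lact_unit X c ?v y ((Ev X y)\<dagger>)) w) = Idn (hom_hilb X (Src X y) c) (FO (lact X c y) w)"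
      using arg_cong[OF lact_zigzag_right[OF d w(1) w(2)[symmetric]], of "Dag X"] y w
      by (simp add: lact_unit_def lact_counit_def)
  next
    fix w assume "w \<in> Obj (hom_hilb X (Src X y) c)"
    then have w: "w \<in> Obj X" "Src X w = Src X y" "Trg X w = c" by simp_all
    show "FM (lact X c ?v) (NC (lact_counit X c y ?v ((Coev X y)\<dagger>)) w) \<cdot>\<^bsub>hom_hilb X (Trg X y) c\<^esub>
      NC (lact_unit X c ?v y ((Ev X y)\<dagger>)) (FO (lact X c ?v) w) = Idn (hom_hilb X (Trg X y) c) (FO (lact X c ?v) w)"
      using arg_cong[OF lact_zigzag_left[OF d w(1) w(2)[symmetric]], of "Dag X"] y w
      by (simp add: lact_unit_def lact_counit_def)
  next
    fix w h assume "w \<in> Obj (hom_hilb X (Trg X y) c)" "h \<in> Arr (hom_hilb X (Src X y) c)"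
      "Dom (hom_hilb X (Src X y) c) h = FO (lact X c y) w" "Cod (hom_hilb X (Src X y) c) h = FO (lact X c y) w"
    then have w: "w \<in> Obj X" "Src X w = Trg X y" "Trg X w = c" and h: "h \<in> Arr X" "Dom X h = y \<otimes> w" "Cod X h = y \<otimes> w"
      by simp_all
    show "Tr (hom_hilb X (Trg X y) c) w
      (Dag (hom_hilb X (Trg X y) c) (NC (lact_unit X c ?v y ((Ev X y)\<dagger>)) w) \<cdot>\<^bsub>hom_hilb X (Trg X y) c\<^esub>
        FM (lact X c ?v) h \<cdot>\<^bsub>hom_hilb X (Trg X y) c\<^esub> NC (lact_unit X c ?v y ((Ev X y)\<dagger>)) w)
      = Tr (hom_hilb X (Src X y) c) (FO (lact X c y) w) h"
      using partial_trace_left[OF y w(1) w(2)[symmetric] h refl] y w h by (simp add: lact_unit_def)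
  qed (use y c in \<open>auto simp: lact_unit_def lact_counit_def intro!: functor_intros\<close>)
qed

lemma ract_traced_adjunction:
  assumes z: "z \<in> Obj X" and a: "a \<in> Ob0 X"
  shows "traced_adjunction (hom_hilb X a (Src X z)) (hom_hilb X a (Trg X z))
    (ract X a z) (ract X a (Vee X z)) (ract_unit X a z (Vee X z) (Coev X z)) (ract_counit X a (Vee X z) z (Ev X z))"
proof -
  let ?v = "Vee X z"
  note d = vee_dual[OF z]
  interpret A: two_hilbert "hom_hilb X a (Src X z)" using z a by (simp add: two_hilbert_hom_hilb)
  interpret B: two_hilbert "hom_hilb X a (Trg X z)" using z a by (simp add: two_hilbert_hom_hilb)
  show ?thesis
  proof unfold_locales
    show "nat_trans (ract_unit X a z ?v (Coev X z))" "nat_trans (ract_counit X a ?v z (Ev X z))"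
      using z a by (simp_all add: nat_trans_ract_unit nat_trans_ract_counit)
  next
    fix w assume "w \<in> Obj (hom_hilb X a (Src X z))"
    then have w: "w \<in> Obj X" "Src X w = a" "Trg X w = Src X z" by simp_all
    show "NC (ract_counit X a ?v z (Ev X z)) (FO (ract X a z) w) \<cdot>\<^bsub>hom_hilb X a (Trg X z)\<^esub>
      FM (ract X a z) (NC (ract_unit X a z ?v (Coev X z)) w) = Idn (hom_hilb X a (Trg X z)) (FO (ract X a z) w)"
      using ract_zigzag_left[OF cstar_2category_axioms d w(1,3)] z w by (simp add: ract_unit_def ract_counit_def)
  next
    fix w assume "w \<in> Obj (hom_hilb X a (Trg X z))"
    then have w: "w \<in> Obj X" "Src X w = a" "Trg X w = Trg X z" by simp_all
    show "FM (ract X a ?v) (NC (ract_counit X a ?v z (Ev X z)) w) \<cdot>\<^bsub>hom_hilb X a (Src X z)\<^esub>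
      NC (ract_unit X a z ?v (Coev X z)) (FO (ract X a ?v) w) = Idn (hom_hilb X a (Src X z)) (FO (ract X a ?v) w)"
      using ract_zigzag_right[OF cstar_2category_axioms d w(1,3)] z w by (simp add: ract_unit_def ract_counit_def)
  next
    fix w h assume "w \<in> Obj (hom_hilb X a (Src X z))" "h \<in> Arr (hom_hilb X a (Trg X z))"
      "Dom (hom_hilb X a (Trg X z)) h = FO (ract X a z) w" "Cod (hom_hilb X a (Trg X z)) h = FO (ract X a z) w"
    then have w: "w \<in> Obj X" "Src X w = a" "Trg X w = Src X z" and h: "h \<in> Arr X" "Dom X h = w \<otimes> z" "Cod X h = w \<otimes> z"
      by simp_all
    show "Tr (hom_hilb X a (Src X z)) w
      (Dag (hom_hilb X a (Src X z)) (NC (ract_unit X a z ?v (Coev X z)) w) \<cdot>\<^bsub>hom_hilb X a (Src X z)\<^esub>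
        FM (ract X a ?v) h \<cdot>\<^bsub>hom_hilb X a (Src X z)\<^esub> NC (ract_unit X a z ?v (Coev X z)) w)
      = Tr (hom_hilb X a (Trg X z)) (FO (ract X a z) w) h"
      using partial_trace_right[OF w(1) z w(3) h refl] z w h by (simp add: ract_unit_def)
  qed (use z a in \<open>auto simp: ract_unit_def ract_counit_def intro!: functor_intros\<close>)
qed

text \<open>
  The reverse of \<open>lact_traced_adjunction\<close>: taking adjoints turns its counit into the coevaluation
  unit and its unit into the evaluation counit.
\<close>

lemma lact_vee_unitary_adjunction:
  assumes y: "y \<in> Obj X" and c: "c \<in> Ob0 X"
  shows "unitary_adjunction (lact X c (Vee X y)) (lact X c y)
    (lact_unit X c y (Vee X y) (Coev X y)) (lact_counit X c (Vee X y) y (Ev X y))"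
proof -
  let ?v = "Vee X y"
  interpret traced_adjunction "hom_hilb X (Trg X y) c" "hom_hilb X (Src X y) c" "lact X c y" "lact X c ?v"
    "lact_unit X c ?v y ((Ev X y)\<dagger>)" "lact_counit X c y ?v ((Coev X y)\<dagger>)"
    by (rule lact_traced_adjunction[OF y c])
  have "hn_map (hf_id (hom_hilb X (Src X y) c)) (hf_comp (lact X c ?v) (lact X c y))
     (\<lambda>b. Dag (hom_hilb X (Src X y) c) (NC (lact_counit X c y ?v ((Coev X y)\<dagger>)) b)) = lact_unit X c y ?v (Coev X y)"
    using y c by (auto simp: lact_counit_def lact_unit_def intro!: hn_map_eqI)
  moreover have "hn_map (hf_comp (lact X c y) (lact X c ?v)) (hf_id (hom_hilb X (Trg X y) c))
     (\<lambda>b. Dag (hom_hilb X (Trg X y) c) (NC (lact_unit X c ?v y ((Ev X y)\<dagger>)) b)) = lact_counit X c ?v y (Ev X y)"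
    using y c by (auto simp: lact_counit_def lact_unit_def intro!: hn_map_eqI)
  ultimately show ?thesis
    using traced_adjunction.unitary_adjunction[OF traced_adjunction_reverse] by simp
qed

end

section \<open>Representable 2-functors\<close>

context weighted_2category
begin

text \<open>
  Since the target is strict, the coherence laws of the 2-functor are coherence laws of the source:
  the associativity law is the pentagon, one unit law is the triangle and the other one is Kelly's
  form of it.
\<close>

lemma dagger_2functor_hom_into:
  assumes c: "c \<in> Ob0 X"
  shows "dagger_2functor (op1 X) (two_Hilb V ev coev) (hom_into X c)"
proof -
  have F2: "nat_trans (hn_map (lact X c (Dom X f)) (lact X c (Cod X f)) (\<lambda>w. f \<star> \<i>\<d> w))" if f: "f \<in> Arr X" for f
    using f c by (intro nat_transI[of _ _ "hom_hilb X (Trg X (Dom X f)) c" "hom_hilb X (Src X (Dom X f)) c"])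
      (auto simp: exchange intro!: functor_intros)
  have Fmul: "nat_trans (hn_map (hf_comp (lact X c x) (lact X c y)) (lact X c (y \<otimes> x)) (\<lambda>w. (Asc X y x w)\<dagger>))"
    if "x \<in> Obj X" "y \<in> Obj X" "Trg X y = Src X x" for x y
    using that c by (intro nat_transI[of _ _ "hom_hilb X (Trg X x) c" "hom_hilb X (Src X y) c"])
      (auto simp: asc_dag_in intro!: functor_intros)
  have Funi: "nat_trans (hn_map (hf_id (hom_hilb X a c)) (lact X c (One X a)) (\<lambda>w. (Lun X w)\<dagger>))"
    if "a \<in> Ob0 X" for a
    using that c by (intro nat_transI[of _ _ "hom_hilb X a c" "hom_hilb X a c"])
      (auto simp: lun_dag_nat intro!: functor_intros)
  show ?thesis
  proof (rule dagger_2functor.intro, goal_cases)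
    \<comment> \<open>typing of the composition constraint\<close>
    case (9 x a b y d)
    then show ?case using Fmul[of x y] by (auto simp: hom_into_def)
  next
    \<comment> \<open>unitarity of the composition constraint\<close>
    case (10 x a b y d)
    then show ?case unfolding hom_into_def using Fmul[of x y]
      by (auto intro!: unitary_two_Hilb[of _ _ _ "hom_hilb X (Trg X x) c" "hom_hilb X (Src X y) c"])
  next
    \<comment> \<open>naturality of the composition constraint\<close>
    case (11 f x x' g y y')
    then have f: "f \<in> Arr X" "Dom X f = x" "Cod X f = x'" and g: "g \<in> Arr X" "Dom X g = y" "Cod X g = y'"
      and s: "Src X x = Trg X y" by auto
    have "(Asc X y' x' w)\<dagger> \<cdot> (g \<star> f \<star> \<i>\<d> w) = ((g \<star> f) \<star> \<i>\<d> w) \<cdot> (Asc X y x w)\<dagger>"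
      if "w \<in> hom1 X (Trg X x) c" for w
      using that f g s asc_dag_nat[of g f "\<i>\<d> w"] by simp
    then show ?case
      using f g s dom_obj[OF f(1)] dom_obj[OF g(1)]
      by (auto simp: hom_into_def exchange intro!: hn_map_eqI)
  next
    \<comment> \<open>typing of the unit constraint\<close>
    case (12 a)
    then show ?case using Funi by (simp add: hom_into_def)
  next
    \<comment> \<open>unitarity of the unit constraint\<close>
    case (13 a)
    then show ?case unfolding hom_into_def using Funi[of a]
      by (auto intro!: unitary_two_Hilb[of _ _ _ "hom_hilb X a c" "hom_hilb X a c"])
  next
    \<comment> \<open>the associativity law\<close>
    case (14 x a b y d z e)
    then have o: "x \<in> Obj X" "y \<in> Obj X" "z \<in> Obj X" "Trg X z = Src X y" "Trg X y = Src X x" by auto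
    have "((Asc X z y x)\<dagger> \<star> \<i>\<d> w) \<cdot> (Asc X z (y \<otimes> x) w)\<dagger> \<cdot> (\<i>\<d> z \<star> (Asc X y x w)\<dagger>) =
      (Asc X (z \<otimes> y) x w)\<dagger> \<cdot> (Asc X z y (x \<otimes> w))\<dagger>" if "w \<in> hom1 X (Trg X x) c" for w
    proof -
      have "Dag X ((\<i>\<d> z \<star> Asc X y x w) \<cdot> Asc X z (y \<otimes> x) w \<cdot> (Asc X z y x \<star> \<i>\<d> w)) =
        Dag X (Asc X z y (x \<otimes> w) \<cdot> Asc X (z \<otimes> y) x w)"
        using o that by (subst pentagon_eq) simp_all
      then show ?thesis using o that by simp
    qed
    then show ?case using o c
      by (auto simp: hom_into_def hf_comp_assoc dagger_functor_lact intro!: hn_map_eqI)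
  next
    \<comment> \<open>the left unit law\<close>
    case (15 x a b)
    then have o: "x \<in> Obj X" "a = Trg X x" by auto
    have "(Run X x \<star> \<i>\<d> w) \<cdot> (Asc X x (One X a) w)\<dagger> \<cdot> (\<i>\<d> x \<star> (Lun X w)\<dagger>) = \<i>\<d> (x \<otimes> w)"
      if "w \<in> hom1 X (Trg X x) c" for w
      using o that by (simp add: triangle_dag exchange)
    then show ?case using o c
      by (auto simp: hom_into_def hn_id_def hf_comp_id dagger_functor_lact intro!: hn_map_eqI)
  next
    \<comment> \<open>the right unit law\<close>
    case (16 x a b)
    then have o: "x \<in> Obj X" "b = Src X x" by auto
    have "(Lun X x \<star> \<i>\<d> w) \<cdot> (Asc X (One X b) x w)\<dagger> \<cdot> (Lun X (x \<otimes> w))\<dagger> = \<i>\<d> (x \<otimes> w)"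
      if "w \<in> hom1 X (Trg X x) c" for w
      using o that by (simp add: lun_ten_dag exchange)
    then show ?case using o c
      by (auto simp: hom_into_def hn_id_def hf_comp_id dagger_functor_lact intro!: hn_map_eqI)
  qed (use c F2 in \<open>auto simp: hom_into_def hn_id_def whisker_right intro!: functor_intros hn_map_eqI\<close>)
qed

lemma dagger_2functor_hom_from:
  assumes a: "a \<in> Ob0 X"
  shows "dagger_2functor X (two_Hilb V ev coev) (hom_from X a)"
proof -
  have F2: "nat_trans (hn_map (ract X a (Dom X f)) (ract X a (Cod X f)) (\<lambda>w. \<i>\<d> w \<star> f))" if f: "f \<in> Arr X" for f
    using f a by (intro nat_transI[of _ _ "hom_hilb X a (Src X (Dom X f))" "hom_hilb X a (Trg X (Dom X f))"])
      (auto simp: exchange intro!: functor_intros)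
  have Fmul: "nat_trans (hn_map (hf_comp (ract X a x) (ract X a y)) (ract X a (x \<otimes> y)) (\<lambda>w. Asc X w x y))"
    if "x \<in> Obj X" "y \<in> Obj X" "Trg X x = Src X y" for x y
    using that a asc_out(1)[where y = x and z = y] by (intro nat_transI[of _ _ "hom_hilb X a (Src X x)" "hom_hilb X a (Trg X y)"])
      (auto intro!: functor_intros)
  have Funi: "nat_trans (hn_map (hf_id (hom_hilb X a b)) (ract X a (One X b)) (\<lambda>w. (Run X w)\<dagger>))"
    if "b \<in> Ob0 X" for b
    using that a by (intro nat_transI[of _ _ "hom_hilb X a b" "hom_hilb X a b"])
      (auto simp: run_dag_nat intro!: functor_intros)
  show ?thesis
  proof (rule dagger_2functor.intro, goal_cases)
    \<comment> \<open>typing of the composition constraint\<close>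
    case (9 x b c y d)
    then show ?case using Fmul[of x y] by (auto simp: hom_from_def)
  next
    \<comment> \<open>unitarity of the composition constraint\<close>
    case (10 x b c y d)
    then show ?case unfolding hom_from_def using Fmul[of x y]
      by (auto intro!: unitary_two_Hilb[of _ _ _ "hom_hilb X a (Src X x)" "hom_hilb X a (Trg X y)"])
  next
    \<comment> \<open>naturality of the composition constraint\<close>
    case (11 f x x' g y y')
    then have f: "f \<in> Arr X" "Dom X f = x" "Cod X f = x'" and g: "g \<in> Arr X" "Dom X g = y" "Cod X g = y'"
      and s: "Trg X x = Src X y" by auto
    have "Asc X w x' y' \<cdot> ((\<i>\<d> w \<star> f) \<star> g) = (\<i>\<d> w \<star> f \<star> g) \<cdot> Asc X w x y"
      if "w \<in> hom1 X a (Src X x)" for w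
      using that f g s asc_nat[of "\<i>\<d> w" f g w x' y'] by simp
    then show ?case
      using f g s dom_obj[OF f(1)] dom_obj[OF g(1)]
      by (auto simp: hom_from_def exchange intro!: hn_map_eqI)
  next
    \<comment> \<open>typing of the unit constraint\<close>
    case (12 b)
    then show ?case using Funi by (simp add: hom_from_def)
  next
    \<comment> \<open>unitarity of the unit constraint\<close>
    case (13 b)
    then show ?case unfolding hom_from_def using Funi[of b]
      by (auto intro!: unitary_two_Hilb[of _ _ _ "hom_hilb X a b" "hom_hilb X a b"])
  next
    \<comment> \<open>the associativity law\<close>
    case (14 x b c y d z e)
    then have o: "x \<in> Obj X" "y \<in> Obj X" "z \<in> Obj X" "Trg X x = Src X y" "Trg X y = Src X z" by auto
    then show ?case using a pentagon_eq[of _ x y z]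
      by (auto simp: hom_from_def hf_comp_assoc dagger_functor_ract intro!: hn_map_eqI)
  next
    \<comment> \<open>the left unit law\<close>
    case (15 x b c)
    then have o: "x \<in> Obj X" "b = Src X x" by auto
    have "(\<i>\<d> w \<star> Lun X x) \<cdot> Asc X w (One X b) x \<cdot> ((Run X w)\<dagger> \<star> \<i>\<d> x) = \<i>\<d> (w \<otimes> x)"
      if "w \<in> hom1 X a (Src X x)" for w
      using o that by (simp add: triangle_then exchange)
    then show ?case using o a
      by (auto simp: hom_from_def hn_id_def hf_comp_id dagger_functor_ract intro!: hn_map_eqI)
  next
    \<comment> \<open>the right unit law\<close>
    case (16 x b c)
    then have o: "x \<in> Obj X" "c = Trg X x" by auto
    have "(\<i>\<d> w \<star> Run X x) \<cdot> Asc X w x (One X c) \<cdot> (Run X (w \<otimes> x))\<dagger> = \<i>\<d> (w \<otimes> x)"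
      if "w \<in> hom1 X a (Src X x)" for w
      using o that by (simp flip: run_ten[OF cstar_2category_axioms])
    then show ?case using o a
      by (auto simp: hom_from_def hn_id_def hf_comp_id dagger_functor_ract intro!: hn_map_eqI)
  qed (use a F2 in \<open>auto simp: hom_from_def hn_id_def whisker_left intro!: functor_intros hn_map_eqI\<close>)
qed

text \<open>
  The image of the evaluation of \<open>x\<close> in the 1-opposite is the counit of the unitary adjunction
  between \<open>x \<otimes> -\<close> and \<open>x\<^sup>\<or> \<otimes> -\<close>.  So the canonical map compares two unitary adjoints of the
  same functor.
\<close>

lemma three_hilbert_morphism_hom_into:
  assumes c: "c \<in> Ob0 X" and V: "unitary_adjoint_choice V ev coev"
  shows "three_hilbert_morphism (op1 X) (two_Hilb V ev coev) (hom_into X c)"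
proof (rule three_hilbert_morphism.intro[OF dagger_2functor_hom_into[OF c]], unfold_locales)
  let ?T = "two_Hilb V ev coev"
  fix x assume "x \<in> Obj (op1 X)"
  then have x: "x \<in> Obj X" by simp
  let ?F = "lact X c x" and ?v = "Vee X x"
  have "unitary_adjunction ?F (V ?F) (coev ?F) (ev ?F)"
    using V dagger_functor_lact[OF x c] unfolding unitary_adjoint_choice_def by blast
  then have V: "traced_adjunction (hom_hilb X (Trg X x) c) (hom_hilb X (Src X x) c) ?F (V ?F) (coev ?F) (ev ?F)"
    by (rule traced_adjunction_of_unitary) simp_all
  have "Dag ?T (Funi (hom_into X c) (Src X x)) \<cdot>\<^bsub>?T\<^esub> F2 (hom_into X c) ((Coev X x)\<dagger>) \<cdot>\<^bsub>?T\<^esub> Fmul (hom_into X c) ?v x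
    = lact_counit X c x ?v ((Coev X x)\<dagger>)"
    using x c by (auto simp: hom_into_def lact_counit_def intro!: hn_map_eqI)
  then have "vee_comparison (op1 X) ?T (hom_into X c) x =
    dual_map ?T (lact X c ?v) ?F (V ?F) (lact_counit X c x ?v ((Coev X x)\<dagger>)) (coev ?F)"
    by (simp only: vee_comparison_def op1_sel two_Hilb_sel) (simp add: hom_into_def)
  then show "unitary ?T (vee_comparison (op1 X) ?T (hom_into X c) x)"
    using two_adjoints.unitary_dual_map[OF two_adjoints.intro[OF lact_traced_adjunction[OF x c] V]] by simp
qed

lemma three_hilbert_morphism_hom_from:
  assumes a: "a \<in> Ob0 X" and V: "unitary_adjoint_choice V ev coev"
  shows "three_hilbert_morphism X (two_Hilb V ev coev) (hom_from X a)"
proof (rule three_hilbert_morphism.intro[OF dagger_2functor_hom_from[OF a]], unfold_locales)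
  let ?T = "two_Hilb V ev coev"
  fix x assume x: "x \<in> Obj X"
  let ?F = "ract X a x" and ?v = "Vee X x"
  have "unitary_adjunction ?F (V ?F) (coev ?F) (ev ?F)"
    using V dagger_functor_ract[OF x a] unfolding unitary_adjoint_choice_def by blast
  then have V: "traced_adjunction (hom_hilb X a (Src X x)) (hom_hilb X a (Trg X x)) ?F (V ?F) (coev ?F) (ev ?F)"
    by (rule traced_adjunction_of_unitary) simp_all
  have "Dag ?T (Funi (hom_from X a) (Trg X x)) \<cdot>\<^bsub>?T\<^esub> F2 (hom_from X a) (Ev X x) \<cdot>\<^bsub>?T\<^esub> Fmul (hom_from X a) ?v x
    = ract_counit X a ?v x (Ev X x)"
    using x a by (auto simp: hom_from_def ract_counit_def intro!: hn_map_eqI)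
  then have "vee_comparison X ?T (hom_from X a) x =
    dual_map ?T (ract X a ?v) ?F (V ?F) (ract_counit X a ?v x (Ev X x)) (coev ?F)"
    by (simp only: vee_comparison_def two_Hilb_sel) (simp add: hom_from_def)
  then show "unitary ?T (vee_comparison X ?T (hom_from X a) x)"
    using two_adjoints.unitary_dual_map[OF two_adjoints.intro[OF ract_traced_adjunction[OF x a] V]] by simp
qed

end

theorem lemma3p32:
  fixes X :: "('x, 'm, 'o) threehilb"
  assumes "three_hilbert X"
  shows
    "(\<forall>a \<in> Ob0 X. \<forall>b \<in> Ob0 X. \<forall>c \<in> Ob0 X. \<forall>Y \<in> hom1 X a b.
        unitary_adjunction (lact X c Y) (lact X c (Vee X Y))
          (lact_unit X c (Vee X Y) Y (Dag X (Ev X Y)))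
          (lact_counit X c Y (Vee X Y) (Dag X (Coev X Y))) \<and>
        unitary_adjunction (lact X c (Vee X Y)) (lact X c Y)
          (lact_unit X c Y (Vee X Y) (Coev X Y))
          (lact_counit X c (Vee X Y) Y (Ev X Y))) \<and>
     (\<forall>c \<in> Ob0 X. \<forall>V ev coev. unitary_adjoint_choice V ev coev \<longrightarrow>
        three_hilbert_morphism (op1 X) (two_Hilb V ev coev) (hom_into X c)) \<and>
     (\<forall>a \<in> Ob0 X. \<forall>b \<in> Ob0 X. \<forall>c \<in> Ob0 X. \<forall>Z \<in> hom1 X b c.
        unitary_adjunction (ract X a Z) (ract X a (Vee X Z))
          (ract_unit X a Z (Vee X Z) (Coev X Z))
          (ract_counit X a (Vee X Z) Z (Ev X Z))) \<and>
     (\<forall>a \<in> Ob0 X. \<forall>V ev coev. unitary_adjoint_choice V ev coev \<longrightarrow>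
        three_hilbert_morphism X (two_Hilb V ev coev) (hom_from X a))"
proof -
  interpret weighted_2category X
    using assms by (simp add: three_hilbert_def weighted_2category_def)
  show ?thesis
    by (intro conjI ballI allI impI three_hilbert_morphism_hom_into three_hilbert_morphism_hom_from
        lact_vee_unitary_adjunction traced_adjunction.unitary_adjunction[OF lact_traced_adjunction]
        traced_adjunction.unitary_adjunction[OF ract_traced_adjunction]) simp_all
qed

end
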